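(* Let $\Gamma=(X,\mathcal E)$ be the Desargues graph (the distance-regular graph with $20$ vertices and intersection array $\{3,2,2,1,1;1,1,2,2,3\}$); the spectrum of its adjacency matrix $A$ is $3^12^41^5(-1)^5(-2)^4(-3)^1$. Let $x\in X$ and $T=T(x)$. Order the three vertices of $\Gamma_1(x)$ arbitrarily, and order $\Gamma_2(x)$ as $y_1,\dots,y_6$ so that each of the pairs $\{y_1,y_2\},\{y_3,y_4\},\{y_5,y_6\}$ has a common neighbor in $\Gamma_1(x)$, the vertices $y_1,y_3,y_5$ are pairwise at distance 2, and the vertices $y_2,y_4,y_6$ are pairwise at distance 2. Then the standard module $V=\mathbb C^X$ is an orthogonal direct sum of irreducible $T$-modules $V=W_0\oplus W_{1,a}\oplus W_{1,b}\oplus W_{2,a}\oplus W_{2,b}\oplus W_{2,c}$, where two summands are isomorphic if and only if they have the same type in the following list, and the data are as listed. Each listed basis is a pure basis of the module. For each summand other than $W_0$, the seed vector $\nu$ spans $E_r^*W$ (so $\dim E_r^*W=1$), where $r$ is the endpoint of the summand $W$, and is given by its essential part. Type I ($W_0$): endpoint 0, multiplicity 1, dimension 6, diameter 5, shape $(1,1,1,1,1,1)$; basis $e_0^*,\dots,e_5^*$; matrix representing $A$: $\begin{pmatrix}0&3&0&0&0&0\\1&0&2&0&0&0\\0&1&0&2&0&0\\0&0&2&0&1&0\\0&0&0&2&0&1\\0&0&0&0&3&0\end{pmatrix}$, with eigenvalues $3,2,1,-1,-2,-3$. Type II ($W_{1,a},W_{1,b}$): endpoint 1, multiplicity 2, dimension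 4, diameter 3, shape $(1,1,1,1)$; basis $\nu,A\nu,E_3^*A^2\nu,E_4^*A^3\nu$ (with $A\nu=E_2^*A\nu$), where $\nu=[1,-1,0]$ for $W_{1,a}$ and $\nu=[1,1,-2]$ for $W_{1,b}$; matrix representing $A$: $\begin{pmatrix}0&2&0&0\\1&0&1&0\\0&1&0&2\\0&0&1&0\end{pmatrix}$, with eigenvalues $2,1,-1,-2$. Type III ($W_{2,a}$): endpoint 2, multiplicity 1, dimension 2, diameter 1, shape $(1,1)$; basis $\nu,A\nu$ (with $A\nu=E_3^*A\nu$), where $\nu=[1,-1,1,-1,1,-1]$; matrix representing $A$: $\begin{pmatrix}0&4\\1&0\end{pmatrix}$, with eigenvalues $2,-2$. Type IV ($W_{2,b},W_{2,c}$): endpoint 2, multiplicity 2, dimension 2, diameter 1, shape $(1,1)$; basis $\nu,A\nu$ (with $A\nu=E_3^*A\nu$), where $\nu=[2,-2,-1,1,-1,1]$ for $W_{2,b}$ and $\nu=[0,0,1,-1,-1,1]$ for $W_{2,c}$; matrix representing $A$: $\begin{pmatrix}0&1\\1&0\end{pmatrix}$, with eigenvalues $1,-1$. Moreover $\dim T=6^2+4^2+2^2+2^2=60$.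
   Context: Let $\Gamma=(X,\mathcal E)$ be a finite undirected connected graph without loops or multiple edges, with path-length distance $d$ and diameter $D\ge1$; put $\Gamma_i(x)=\{y\in X:d(x,y)=i\}$. $\Gamma$ is distance-regular if for all $0\le h,i,j\le D$ the number $p^h_{i,j}=|\Gamma_i(y)\cap\Gamma_j(z)|$ is the same for all $y,z\in X$ with $d(y,z)=h$. Its intersection array is $\{b_0,\dots,b_{D-1};c_1,\dots,c_D\}$ with $b_i=p^i_{1,i+1}$, $c_i=p^i_{1,i-1}$. $A\in\mathrm{Mat}_X(\mathbb C)$ is the adjacency matrix; in its spectrum, exponents denote multiplicities. The standard module $V=\mathbb C^X$ (column vectors) carries the Hermitian inner product $\langle u,v\rangle=u^t\bar v$. Fix a base vertex $x\in X$. For $0\le i\le D$, $E_i^*=E_i^*(x)$ is the diagonal matrix with $(y,y)$-entry $1$ if $d(x,y)=i$ and $0$ otherwise, and $e_i^*\in V$ is the vector with $y$-entry $1$ if $d(x,y)=i$ and $0$ otherwise. The Terwilliger algebra $T=T(x)$ is the subalgebra of $\mathrm{Mat}_X(\mathbb C)$ generated by $A$ and $E_0^*,\dots,E_D^*$. A $T$-module is a subspace $W\subseteq V$ with $BW\subseteq W$ for all $B\in T$; it is irreducible if $W\ne0$ and it properly contains no nonzero $T$-module. Isomorphisms of $T$-modules are vector space isomorphisms commuting with every $B\in T$. The endpoint of $W$ is $r=\min\{i:E_i^*W\ne0\}$; the diameter of an irreducible $W$ is $\delta=|\{i:E_i^*W\ne0\}|-1$, and its shape is $(\dim E_r^*W,\dots,\dim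 E_{r+\delta}^*W)$. The multiplicity of an irreducible module is the number of summands isomorphic to it in an orthogonal decomposition of $V$ into irreducible $T$-modules. A nonzero vector is pure with support $i$ if it lies in $E_i^*V$; its essential part is the row vector of its coordinates at the vertices of $\Gamma_i(x)$, in the chosen order (all its other coordinates are $0$). A pure basis of an irreducible $T$-module is an ordered basis of pure vectors with weakly increasing supports. The matrix $B$ representing $A$ with respect to a basis $v_1,\dots,v_\ell$ is given by $Av_j=\sum_iB_{ij}v_i$. *)

theory Defs
  imports "Jordan_Normal_Form.Char_Poly" "HOL-Analysis.Analysis"
begin

(* Both imports use infix "$"; only the coordinate operator of the type 'a ^ 'n is needed here. *)
no_notation Matrix.vec_index (infixl \<open>$\<close> 100)

section \<open>Distance-regular graphs\<close>

text \<open>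
  A graph is given by its adjacency relation on a finite vertex type, so that
  multiple edges are excluded by the encoding.
\<close>

definition simple_graph :: "('v::finite \<Rightarrow> 'v \<Rightarrow> bool) \<Rightarrow> bool" where
  "simple_graph adj \<longleftrightarrow> symp adj \<and> irreflp adj"

definition connected_graph :: "('v::finite \<Rightarrow> 'v \<Rightarrow> bool) \<Rightarrow> bool" where
  "connected_graph adj \<longleftrightarrow> (\<forall>y z. adj\<^sup>*\<^sup>* y z)"

text \<open>The length of a shortest walk; only meaningful for connected graphs.\<close>

definition gdist :: "('v::finite \<Rightarrow> 'v \<Rightarrow> bool) \<Rightarrow> 'v \<Rightarrow> 'v \<Rightarrow> nat" where
  "gdist adj y z = (LEAST n. (adj ^^ n) y z)"

definition gdiam :: "('v::finite \<Rightarrow> 'v \<Rightarrow> bool) \<Rightarrow> nat" where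
  "gdiam adj = Max {gdist adj y z | y z. True}"

definition sphere_at :: "('v::finite \<Rightarrow> 'v \<Rightarrow> bool) \<Rightarrow> nat \<Rightarrow> 'v \<Rightarrow> 'v set" where
  "sphere_at adj i y = {z. gdist adj y z = i}"

definition distance_regular :: "('v::finite \<Rightarrow> 'v \<Rightarrow> bool) \<Rightarrow> bool" where
  "distance_regular adj \<longleftrightarrow>
     simple_graph adj \<and> connected_graph adj \<and> gdiam adj \<ge> 1 \<and>
     (\<forall>h i j. h \<le> gdiam adj \<longrightarrow> i \<le> gdiam adj \<longrightarrow> j \<le> gdiam adj \<longrightarrow>
        (\<exists>p. \<forall>y z. gdist adj y z = h \<longrightarrow>
           card (sphere_at adj i y \<inter> sphere_at adj j z) = p))"

text \<open>\<open>intersection_number adj h i j\<close> is \<open>p\<close> with upper index \<open>h\<close> and lower indices \<open>i, j\<close>.\<close>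

definition intersection_number ::
    "('v::finite \<Rightarrow> 'v \<Rightarrow> bool) \<Rightarrow> nat \<Rightarrow> nat \<Rightarrow> nat \<Rightarrow> nat" where
  "intersection_number adj h i j =
     (THE p. \<forall>y z. gdist adj y z = h \<longrightarrow> card (sphere_at adj i y \<inter> sphere_at adj j z) = p)"

definition intersection_array :: "('v::finite \<Rightarrow> 'v \<Rightarrow> bool) \<Rightarrow> nat list \<times> nat list" where
  "intersection_array adj =
     (map (\<lambda>i. intersection_number adj i 1 (i + 1)) [0..<gdiam adj],
      map (\<lambda>i. intersection_number adj i 1 (i - 1)) [1..<gdiam adj + 1])"

definition desargues_graph :: "('v::finite \<Rightarrow> 'v \<Rightarrow> bool) \<Rightarrow> bool" where
  "desargues_graph adj \<longleftrightarrow>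
     distance_regular adj \<and> CARD('v) = 20 \<and>
     intersection_array adj = ([3, 2, 2, 1, 1], [1, 1, 2, 2, 3])"


section \<open>Complex matrices and vectors indexed by the vertices\<close>

text \<open>
  Subspaces, spans and dimensions in the standard module are the complex ones
  (\<open>vec.subspace\<close>, \<open>vec.span\<close>, \<open>vec.dim\<close>); the unqualified constants refer to real scalars.
\<close>

definition hinner :: "complex ^ 'v \<Rightarrow> complex ^ 'v \<Rightarrow> complex" where
  "hinner u v = (\<Sum>y\<in>UNIV. u $ y * cnj (v $ y))"

definition cmat_scale :: "complex \<Rightarrow> complex ^ 'm ^ 'n \<Rightarrow> complex ^ 'm ^ 'n" where
  "cmat_scale c M = (\<chi> i j. c * M $ i $ j)"

interpretation cmat: Vector_Spaces.vector_space
    "cmat_scale :: complex \<Rightarrow> complex ^ 'm ^ 'n \<Rightarrow> complex ^ 'm ^ 'n"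
  by unfold_locales (simp_all add: cmat_scale_def Finite_Cartesian_Product.vec_eq_iff algebra_simps)

text \<open>
  The eigenvalues of a matrix, each paired with the dimension of its eigenspace. For the
  adjacency matrix of an undirected graph, which is real symmetric, this dimension is also
  the algebraic multiplicity.
\<close>

definition spectrum_mult :: "complex ^ 'v ^ 'v \<Rightarrow> (complex \<times> nat) set" where
  "spectrum_mult M =
     {(\<theta>, vec.dim {v. M *v v = \<theta> *s v}) | \<theta>. \<exists>v. v \<noteq> 0 \<and> M *v v = \<theta> *s v}"

definition adj_matrix :: "('v::finite \<Rightarrow> 'v \<Rightarrow> bool) \<Rightarrow> complex ^ 'v ^ 'v" where
  "adj_matrix adj = (\<chi> y z. if adj y z then 1 else 0)"

definition Estar :: "('v::finite \<Rightarrow> 'v \<Rightarrow> bool) \<Rightarrow> 'v \<Rightarrow> nat \<Rightarrow> complex ^ 'v ^ 'v" where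
  "Estar adj x i = (\<chi> y z. if y = z \<and> gdist adj x y = i then 1 else 0)"

definition estar :: "('v::finite \<Rightarrow> 'v \<Rightarrow> bool) \<Rightarrow> 'v \<Rightarrow> nat \<Rightarrow> complex ^ 'v" where
  "estar adj x i = (\<chi> y. if gdist adj x y = i then 1 else 0)"

definition matrix_subalgebra :: "(complex ^ 'v ^ 'v) set \<Rightarrow> bool" where
  "matrix_subalgebra S \<longleftrightarrow>
     cmat.subspace S \<and> Finite_Cartesian_Product.mat 1 \<in> S \<and> (\<forall>B\<in>S. \<forall>C\<in>S. B ** C \<in> S)"

definition terwilliger :: "('v::finite \<Rightarrow> 'v \<Rightarrow> bool) \<Rightarrow> 'v \<Rightarrow> (complex ^ 'v ^ 'v) set" where
  "terwilliger adj x =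
     matrix_subalgebra hull (insert (adj_matrix adj) (Estar adj x ` {0..gdiam adj}))"


section \<open>Modules for an algebra of matrices\<close>

definition alg_module :: "(complex ^ 'v ^ 'v) set \<Rightarrow> (complex ^ 'v) set \<Rightarrow> bool" where
  "alg_module T W \<longleftrightarrow> vec.subspace W \<and> (\<forall>B\<in>T. \<forall>w\<in>W. B *v w \<in> W)"

definition irreducible_module :: "(complex ^ 'v ^ 'v) set \<Rightarrow> (complex ^ 'v) set \<Rightarrow> bool" where
  "irreducible_module T W \<longleftrightarrow>
     alg_module T W \<and> W \<noteq> {0} \<and> (\<forall>U. alg_module T U \<and> U \<subset> W \<longrightarrow> U = {0})"

definition module_iso ::
    "(complex ^ 'v ^ 'v) set \<Rightarrow> (complex ^ 'v) set \<Rightarrow> (complex ^ 'v) set \<Rightarrow> bool" where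
  "module_iso T U W \<longleftrightarrow>
     (\<exists>f. bij_betw f U W \<and>
          (\<forall>u\<in>U. \<forall>v\<in>U. f (u + v) = f u + f v) \<and>
          (\<forall>c. \<forall>u\<in>U. f (c *s u) = c *s f u) \<and>
          (\<forall>B\<in>T. \<forall>u\<in>U. f (B *v u) = B *v f u))"

text \<open>
  Mutually orthogonal subspaces that span the standard module form a direct sum. Summands are
  listed, so a subspace cannot be counted once for two positions.
\<close>

definition orthogonal_decomposition ::
    "(complex ^ 'v ^ 'v) set \<Rightarrow> (complex ^ 'v) set list \<Rightarrow> bool" where
  "orthogonal_decomposition T Ws \<longleftrightarrow>
     (\<forall>W\<in>set Ws. irreducible_module T W) \<and>
     (\<forall>i<length Ws. \<forall>j<length Ws. i \<noteq> j \<longrightarrow>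
        (\<forall>u\<in>Ws ! i. \<forall>v\<in>Ws ! j. hinner u v = 0)) \<and>
     vec.span (\<Union>(set Ws)) = UNIV"

text \<open>
  The definite description is justified by the independence of the number of summands
  from the decomposition; determining this value includes proving that independence.
\<close>

definition module_multiplicity ::
    "(complex ^ 'v ^ 'v) set \<Rightarrow> (complex ^ 'v) set \<Rightarrow> nat" where
  "module_multiplicity T W =
     (THE m. \<exists>Ws. orthogonal_decomposition T Ws \<and> length (filter (module_iso T W) Ws) = m)"


section \<open>Endpoint, diameter, shape and pure bases\<close>

definition module_support ::
    "('v::finite \<Rightarrow> 'v \<Rightarrow> bool) \<Rightarrow> 'v \<Rightarrow> (complex ^ 'v) set \<Rightarrow> nat set" where
  "module_support adj x W = {i. i \<le> gdiam adj \<and> (*v) (Estar adj x i) ` W \<noteq> {0}}"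

definition endpoint :: "('v::finite \<Rightarrow> 'v \<Rightarrow> bool) \<Rightarrow> 'v \<Rightarrow> (complex ^ 'v) set \<Rightarrow> nat" where
  "endpoint adj x W = Min (module_support adj x W)"

definition module_diameter ::
    "('v::finite \<Rightarrow> 'v \<Rightarrow> bool) \<Rightarrow> 'v \<Rightarrow> (complex ^ 'v) set \<Rightarrow> nat" where
  "module_diameter adj x W = card (module_support adj x W) - 1"

definition module_shape ::
    "('v::finite \<Rightarrow> 'v \<Rightarrow> bool) \<Rightarrow> 'v \<Rightarrow> (complex ^ 'v) set \<Rightarrow> nat list" where
  "module_shape adj x W =
     map (\<lambda>i. vec.dim ((*v) (Estar adj x i) ` W))
       [endpoint adj x W ..< endpoint adj x W + module_diameter adj x W + 1]"

definition pure :: "('v::finite \<Rightarrow> 'v \<Rightarrow> bool) \<Rightarrow> 'v \<Rightarrow> nat \<Rightarrow> complex ^ 'v \<Rightarrow> bool" where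
  "pure adj x i v \<longleftrightarrow> v \<noteq> 0 \<and> v \<in> range ((*v) (Estar adj x i))"

definition pure_basis ::
    "('v::finite \<Rightarrow> 'v \<Rightarrow> bool) \<Rightarrow> 'v \<Rightarrow> (complex ^ 'v) set \<Rightarrow> (complex ^ 'v) list \<Rightarrow> bool" where
  "pure_basis adj x W vs \<longleftrightarrow>
     distinct vs \<and> vec.independent (set vs) \<and> vec.span (set vs) = W \<and>
     (\<exists>ks. sorted ks \<and> list_all2 (pure adj x) ks vs)"

text \<open>The list \<open>ys\<close> is the chosen order of the vertices in the subconstituent.\<close>

definition essential_part :: "'v list \<Rightarrow> complex ^ 'v \<Rightarrow> complex list" where
  "essential_part ys v = map (\<lambda>y. v $ y) ys"

definition seed_vector ::
    "('v::finite \<Rightarrow> 'v \<Rightarrow> bool) \<Rightarrow> 'v \<Rightarrow> (complex ^ 'v) set \<Rightarrow>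
       'v list \<Rightarrow> complex list \<Rightarrow> complex ^ 'v \<Rightarrow> bool" where
  "seed_vector adj x W ys cs \<nu> \<longleftrightarrow>
     pure adj x (endpoint adj x W) \<nu> \<and>
     essential_part ys \<nu> = cs \<and>
     vec.span {\<nu>} = (*v) (Estar adj x (endpoint adj x W)) ` W \<and>
     vec.dim ((*v) (Estar adj x (endpoint adj x W)) ` W) = 1"

definition represents :: "complex Matrix.mat \<Rightarrow> complex ^ 'v ^ 'v \<Rightarrow> (complex ^ 'v) list \<Rightarrow> bool" where
  "represents B M vs \<longleftrightarrow>
     B \<in> carrier_mat (length vs) (length vs) \<and>
     (\<forall>j<length vs. M *v (vs ! j) = (\<Sum>i<length vs. (B $$ (i, j)) *s (vs ! i)))"


section \<open>Orders of the first two subconstituents\<close>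

definition ordering_of :: "'v list \<Rightarrow> 'v set \<Rightarrow> bool" where
  "ordering_of ys S \<longleftrightarrow> distinct ys \<and> set ys = S"

definition admissible_order2 ::
    "('v::finite \<Rightarrow> 'v \<Rightarrow> bool) \<Rightarrow> 'v \<Rightarrow> 'v list \<Rightarrow> bool" where
  "admissible_order2 adj x ys \<longleftrightarrow>
     length ys = 6 \<and> ordering_of ys (sphere_at adj 2 x) \<and>
     (\<forall>(i, j) \<in> {(0, 1), (2, 3), (4, 5)}.
        \<exists>u \<in> sphere_at adj 1 x. adj u (ys ! i) \<and> adj u (ys ! j)) \<and>
     (\<forall>(i, j) \<in> {(0, 2), (0, 4), (2, 4), (1, 3), (1, 5), (3, 5)}.
        gdist adj (ys ! i) (ys ! j) = 2)"

end

(*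
  Fix the base vertex x and list the other vertices by their distance from x. The intersection
  numbers force the following picture, with k = 1, 2, 3: the neighbours u_k of x have children p_k
  and q_k; the common neighbour of p_i and p_j is P_k and that of q_i and q_j is Q_k
  ({i, j, k} = {1, 2, 3}); finally P_k and Q_k are joined to t_k, the antipode of u_k, and all t_k
  to the antipode of x. The number b_4 = 1 excludes the alternative in which the p's and q's form a
  hexagon.

  In these coordinates there is an orthogonal basis of 20 vectors, one chain for each of the six
  summands, on which A acts by the listed tridiagonal matrices and each E_i^* by 0 or 1. Hence T
  acts by the same matrix on chains of equal type. Conversely T contains, for each type, the
  projection onto the first vectors of the chains of that type (killing the other types), and since
  the off-diagonal entries of the tridiagonal matrices do not vanish it contains all matrix units.
  So T is the direct sum of full matrix algebras of sizes 6, 4, 2, 2; irreducibility,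
  isomorphisms and dim T follow, and the rank of a diagonal matrix unit on V computes the
  multiplicity in every orthogonal decomposition.
*)

theory Submission
  imports Defs
begin

section \<open>Linear algebra of orthogonal families\<close>

text \<open>The obstacle is that the chains of types III and IV occupy the same layers, so no
  \<open>Estar\<close> tells them apart. On vectors with opposite values at p_k and q_k, applying
  \<open>A\<close> from layer 2 to layer 3 and back acts on the triple of values at p_1, p_2, p_3 as
  I + J, where J is the all-ones matrix. Its eigenvalues, 4 on constant triples and 1 on triples of
  sum 0, are the upper right entries of the two 2 by 2 matrices; they make the two types
  non-isomorphic and let the algebra separate them. The neighbour sums of such vectors vanish at the
  u_k and the t_k, so these chains have two layers only. P_k and Q_k have the same neighbour in
  layer 4 because the layer-4 neighbour of either is at distance 5 from u_k, and a sphere of radius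
  5 has one vertex. The spectrum comes from the same basis: each tridiagonal matrix has
  one-dimensional eigenspaces, so the multiplicity of an eigenvalue of \<open>A\<close> is the
  number of chains whose matrix has it.\<close>

lemma hinner_sum_left: "hinner (\<Sum>i\<in>I. f i) v = (\<Sum>i\<in>I. hinner (f i) v)"
  unfolding hinner_def by (simp add: sum_distrib_right sum.swap[of _ UNIV])

lemma hinner_add_left: "hinner (u + w) v = hinner u v + hinner w v"
  unfolding hinner_def by (simp add: ring_distribs sum.distrib)

lemma hinner_scale_left: "hinner (c *s u) v = c * hinner u v"
  unfolding hinner_def by (simp add: sum_distrib_left mult.assoc)

lemma hinner_commute: "hinner u v = cnj (hinner v u)"
  unfolding hinner_def by (simp add: mult.commute)

lemma hinner_zero_left [simp]: "hinner 0 v = 0"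
  unfolding hinner_def by simp

lemma hinner_eq_0_commute: "hinner u v = 0 \<Longrightarrow> hinner v u = 0"
  by (metis hinner_commute complex_cnj_zero)

lemma hinner_self_eq_0 [simp]: "hinner v v = 0 \<longleftrightarrow> v = 0"
proof
  assume "hinner v v = 0"
  then have "(\<Sum>y\<in>UNIV. complex_of_real ((cmod (v $ y))\<^sup>2)) = 0"
    unfolding hinner_def by (simp add: complex_mult_cnj cmod_power2)
  then have "(\<Sum>y\<in>UNIV. (cmod (v $ y))\<^sup>2) = 0"
    by (metis of_real_eq_0_iff of_real_sum)
  then have "\<forall>y. v $ y = 0"
    by (simp add: sum_nonneg_eq_0_iff)
  then show "v = 0"
    by (simp add: Finite_Cartesian_Product.vec_eq_iff)
qed simp

lemma hinner_orthogonal_subspace: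
  assumes "\<And>v. v \<in> S \<Longrightarrow> hinner u v = 0" "v \<in> vec.span S"
  shows "hinner u v = 0"
proof -
  \<comment> \<open>The form is linear in its first argument only, so the span induction runs in
    that slot.\<close>
  have "hinner v u = 0"
    using assms(2)
  proof (induction rule: vec.span_induct_alt)
    case (step c w z)
    then show ?case
      using hinner_eq_0_commute[OF assms(1)] by (simp add: hinner_add_left hinner_scale_left)
  qed simp
  then show ?thesis
    by (rule hinner_eq_0_commute)
qed

lemma orthogonal_family_coeff:
  assumes "finite I" "\<And>i j. i \<in> I \<Longrightarrow> j \<in> I \<Longrightarrow> i \<noteq> j \<Longrightarrow> hinner (f i) (f j) = 0" "j \<in> I"
  shows "hinner (\<Sum>i\<in>I. c i *s f i) (f j) = c j * hinner (f j) (f j)"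
proof -
  have "hinner (\<Sum>i\<in>I. c i *s f i) (f j) = (\<Sum>i\<in>I. if i = j then c j * hinner (f j) (f j) else 0)"
    unfolding hinner_sum_left by (rule sum.cong) (auto simp: hinner_scale_left assms)
  then show ?thesis
    using assms by simp
qed

lemma independent_family:
  fixes f :: "'i \<Rightarrow> complex ^ 'v::finite"
  assumes "finite I" and zero: "\<And>c j. (\<Sum>i\<in>I. c i *s f i) = 0 \<Longrightarrow> j \<in> I \<Longrightarrow> c j = 0"
  shows "inj_on f I" "vec.independent (f ` I)"
proof -
  show inj: "inj_on f I"
  proof (rule inj_onI, rule ccontr)
    fix i j assume ij: "i \<in> I" "j \<in> I" "f i = f j" "i \<noteq> j"
    \<comment> \<open>Equal vectors at two indices would give the nontrivial relation with
      coefficients 1 and -1.\<close>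
    define c :: "'i \<Rightarrow> complex" where "c k = (if k = i then 1 else if k = j then - 1 else 0)" for k
    have "(\<Sum>k\<in>I. c k *s f k) = (\<Sum>k\<in>{i, j}. c k *s f k)"
      by (rule sum.mono_neutral_right) (use ij assms in \<open>auto simp: c_def\<close>)
    also have "\<dots> = 0"
      using ij by (simp add: c_def)
    finally have "c i = 0"
      using zero ij by blast
    then show False
      by (simp add: c_def)
  qed
  show "vec.independent (f ` I)"
  proof (rule vec.independent_if_scalars_zero)
    fix g v assume g: "(\<Sum>v\<in>f ` I. g v *s v) = 0" and "v \<in> f ` I"
    then obtain i where "i \<in> I" "v = f i"
      by auto
    moreover have "(\<Sum>i\<in>I. g (f i) *s f i) = 0"
      using g by (simp add: sum.reindex[OF inj])
    ultimately show "g v = 0"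
      using zero[of "\<lambda>i. g (f i)"] by auto
  qed (use assms in auto)
qed

lemma independent_family_zero:
  fixes f :: "'i \<Rightarrow> complex ^ 'v::finite"
  assumes "finite I" "inj_on f I" "vec.independent (f ` I)"
    "(\<Sum>i\<in>I. c i *s f i) = 0" "j \<in> I"
  shows "c j = 0"
proof -
  have "(\<Sum>v\<in>f ` I. c (the_inv_into I f v) *s v) = 0"
    using assms by (simp add: sum.reindex the_inv_into_f_f)
  then have "\<forall>v\<in>f ` I. c (the_inv_into I f v) = 0"
    using assms(3)[unfolded vec.independent_explicit, THEN conjunct2, THEN spec,
        of "\<lambda>v. c (the_inv_into I f v)"] by blast
  then show ?thesis
    using assms by (simp add: the_inv_into_f_f)
qed

lemma independent_family_eqI:
  fixes f :: "'i \<Rightarrow> complex ^ 'v::finite"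
  assumes "finite I" "inj_on f I" "vec.independent (f ` I)"
    "(\<Sum>i\<in>I. c i *s f i) = (\<Sum>i\<in>I. c' i *s f i)" "j \<in> I"
  shows "c j = c' j"
  using independent_family_zero[OF assms(1-3), of "\<lambda>i. c i - c' i" j] assms(4,5)
  by (simp add: vec.scale_left_diff_distrib sum_subtractf)

lemma orthogonal_family_independent:
  fixes f :: "'i \<Rightarrow> complex ^ 'v::finite"
  assumes "finite I" "\<And>i j. i \<in> I \<Longrightarrow> j \<in> I \<Longrightarrow> i \<noteq> j \<Longrightarrow> hinner (f i) (f j) = 0"
    "\<And>i. i \<in> I \<Longrightarrow> f i \<noteq> 0"
  shows "inj_on f I" "vec.independent (f ` I)"
proof -
  have "c j = 0" if "(\<Sum>i\<in>I. c i *s f i) = 0" "j \<in> I" for c j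
    using orthogonal_family_coeff[of I f j c] assms that by auto
  then show "inj_on f I" "vec.independent (f ` I)"
    using independent_family[OF assms(1), of f] by blast+
qed

lemma span_family:
  fixes f :: "'i \<Rightarrow> complex ^ 'v::finite"
  assumes "finite I"
  shows "vec.span (f ` I) = {\<Sum>i\<in>I. c i *s f i | c. True}" (is "_ = ?R")
proof
  show "?R \<subseteq> vec.span (f ` I)"
    by (rule subsetI, clarify, intro vec.span_sum vec.span_scale, simp add: vec.span_base)
  show "vec.span (f ` I) \<subseteq> ?R"
  proof
    fix v assume "v \<in> vec.span (f ` I)"
    then show "v \<in> ?R"
    proof (induction rule: vec.span_induct_alt)
      case base
      show ?case
        by (auto intro!: exI[of _ "\<lambda>_. 0"])
    next
      case (step a w z)
      then obtain c k where c: "z = (\<Sum>i\<in>I. c i *s f i)" and k: "k \<in> I" "w = f k"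
        by auto
      have "(\<Sum>i\<in>I. (if i = k then a else 0) *s f i) = (\<Sum>i\<in>I. if i = k then a *s f k else 0)"
        by (rule sum.cong) auto
      then have "a *s w + z = (\<Sum>i\<in>I. ((if i = k then a else 0) + c i) *s f i)"
        using k assms by (simp add: c vec.scale_left_distrib sum.distrib)
      then show ?case
        by (auto intro: exI[of _ "\<lambda>i. (if i = k then a else 0) + c i"])
    qed
  qed
qed

lemma matrix_vector_mult_sum: "B *v (\<Sum>i\<in>I. c i *s f i) = (\<Sum>i\<in>I. c i *s (B *v f i))"
  for B :: "complex ^ 'n ^ 'm"
  by (simp add: vec.sum vec.scale)

text \<open>Each summand meets the span of the later ones in 0 only, so dimensions add. A list is
  used because in the counting of summands several of the subspaces may be the same zero
  space.\<close>

lemma dim_span_orthogonal_list: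
  fixes Ws :: "(complex ^ 'v::finite) set list"
  assumes "\<And>W. W \<in> set Ws \<Longrightarrow> vec.subspace W"
    and "\<And>i j. i < length Ws \<Longrightarrow> j < length Ws \<Longrightarrow> i \<noteq> j \<Longrightarrow> \<forall>u\<in>Ws ! i. \<forall>v\<in>Ws ! j. hinner u v = 0"
  shows "vec.dim (vec.span (\<Union>(set Ws))) = (\<Sum>W\<leftarrow>Ws. vec.dim W)"
  using assms
proof (induction Ws)
  case (Cons W Ws)
  let ?S = "vec.span (\<Union>(set Ws))"
  have sub: "vec.subspace W"
    using Cons.prems(1) by simp
  have IH: "vec.dim ?S = (\<Sum>W\<leftarrow>Ws. vec.dim W)"
  proof (rule Cons.IH)
    fix i j assume "i < length Ws" "j < length Ws" "i \<noteq> j"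
    then show "\<forall>u\<in>Ws ! i. \<forall>v\<in>Ws ! j. hinner u v = 0"
      using Cons.prems(2)[of "Suc i" "Suc j"] by simp
  qed (use Cons.prems(1) in auto)
  have orth: "hinner u v = 0" if "u \<in> W" "v \<in> ?S" for u v
  proof (rule hinner_orthogonal_subspace[OF _ that(2)])
    fix z assume "z \<in> \<Union>(set Ws)"
    then obtain j where "j < length Ws" "z \<in> Ws ! j"
      by (auto simp: in_set_conv_nth)
    then show "hinner u z = 0"
      using Cons.prems(2)[of 0 "Suc j"] that(1) by simp
  qed
  have "W \<inter> ?S = {0}"
    using orth vec.subspace_0[OF sub] vec.span_zero by (fastforce dest: hinner_self_eq_0[THEN iffD1])
  moreover have "vec.span (\<Union>(set (W # Ws))) = {x + y | x y. x \<in> W \<and> y \<in> ?S}"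
    using vec.span_Un[of W "\<Union>(set Ws)"] vec.span_eq_iff[THEN iffD2, OF sub] by simp
  ultimately show ?case
    using vec.dim_sums_Int[OF sub vec.subspace_span, of "\<Union>(set Ws)"] IH by simp
qed simp

section \<open>Block matrix algebras with matrix units\<close>

lemma matrix_subalgebra_scale:
  "matrix_subalgebra S \<Longrightarrow> B \<in> S \<Longrightarrow> cmat_scale c B \<in> S"
  unfolding matrix_subalgebra_def by (simp add: cmat.subspace_scale)

lemma cmat_scale_mult_vec: "cmat_scale c B *v v = c *s (B *v v)"
  by (simp add: cmat_scale_def matrix_vector_mult_def Finite_Cartesian_Product.vec_eq_iff
      sum_distrib_left mult.assoc)

lemma cmat_sum_mult_vec: "(\<Sum>k\<in>K. cmat_scale (c k) (B k)) *v v = (\<Sum>k\<in>K. c k *s (B k *v v))"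
  by (induction K rule: infinite_finite_induct)
    (simp_all add: matrix_vector_mult_add_rdistrib cmat_scale_mult_vec)

text \<open>\<open>b s\<close> is the chain with number \<open>s\<close>; its length depends only on
  its type \<open>ty s\<close>. By \<open>total\<close> there are as many nonzero orthogonal vectors
  as the dimension, so they form a basis.\<close>

locale orthogonal_blocks =
  fixes n :: nat and ty :: "nat \<Rightarrow> nat" and d :: "nat \<Rightarrow> nat"
    and b :: "nat \<Rightarrow> nat \<Rightarrow> complex ^ 'v::finite"
  assumes orthogonal: "\<And>s i s' j. s < n \<Longrightarrow> i < d (ty s) \<Longrightarrow> s' < n \<Longrightarrow> j < d (ty s') \<Longrightarrow>
      (s, i) \<noteq> (s', j) \<Longrightarrow> hinner (b s i) (b s' j) = 0"
    and nonzero: "\<And>s i. s < n \<Longrightarrow> i < d (ty s) \<Longrightarrow> b s i \<noteq> 0"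
    and size_pos: "\<And>s. s < n \<Longrightarrow> d (ty s) > 0"
    and total: "(\<Sum>s<n. d (ty s)) = CARD('v)"
begin

definition coord :: "complex ^ 'v \<Rightarrow> nat \<Rightarrow> nat \<Rightarrow> complex" where
  "coord v s i = hinner v (b s i) / hinner (b s i) (b s i)"

lemma basis_family:
  "inj_on (case_prod b) (SIGMA s:{..<n}. {..<d (ty s)})"
  "vec.independent (case_prod b ` (SIGMA s:{..<n}. {..<d (ty s)}))"
  "vec.span (case_prod b ` (SIGMA s:{..<n}. {..<d (ty s)})) = UNIV"
proof -
  let ?I = "SIGMA s:{..<n}. {..<d (ty s)}"
  have fin: "finite ?I"
    by auto
  have "hinner (case_prod b k) (case_prod b k') = 0" if "k \<in> ?I" "k' \<in> ?I" "k \<noteq> k'" for k k'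
    using orthogonal[of "fst k" "snd k" "fst k'" "snd k'"] that by (auto simp: case_prod_beta)
  moreover have "case_prod b k \<noteq> 0" if "k \<in> ?I" for k
    using nonzero that by auto
  ultimately show inj: "inj_on (case_prod b) ?I" and ind: "vec.independent (case_prod b ` ?I)"
    using orthogonal_family_independent[OF fin, of "case_prod b"] by blast+
  have "card (case_prod b ` ?I) = vec.dim (UNIV :: (complex ^ 'v) set)"
    using total by (simp add: card_image[OF inj] vec.dim_UNIV card_cart_basis)
  then have "UNIV \<subseteq> vec.span (case_prod b ` ?I)"
    using vec.card_eq_dim[of "case_prod b ` ?I" UNIV] ind fin by auto
  then show "vec.span (case_prod b ` ?I) = UNIV"
    by auto
qed

lemma coord_combination:
  assumes "s < n" "i < d (ty s)"
  shows "coord (\<Sum>s<n. \<Sum>i<d (ty s). c s i *s b s i) s i = c s i"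
proof -
  let ?I = "SIGMA s:{..<n}. {..<d (ty s)}"
  have "(\<Sum>s<n. \<Sum>i<d (ty s). c s i *s b s i) = (\<Sum>k\<in>?I. case_prod c k *s case_prod b k)"
    by (subst sum.Sigma) (auto intro!: sum.cong)
  moreover have "hinner (\<Sum>k\<in>?I. case_prod c k *s case_prod b k) (case_prod b (s, i)) =
      case_prod c (s, i) * hinner (case_prod b (s, i)) (case_prod b (s, i))"
    by (rule orthogonal_family_coeff) (use orthogonal assms in auto)
  ultimately show ?thesis
    using nonzero[OF assms] by (simp add: coord_def)
qed

lemma expand: "v = (\<Sum>s<n. \<Sum>i<d (ty s). coord v s i *s b s i)"
proof -
  let ?I = "SIGMA s:{..<n}. {..<d (ty s)}"
  have fin: "finite ?I"
    by auto
  have "v \<in> vec.span (case_prod b ` ?I)"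
    using basis_family by simp
  then obtain c where c: "v = (\<Sum>k\<in>?I. c k *s case_prod b k)"
    unfolding span_family[OF fin] by auto
  have v: "v = (\<Sum>s<n. \<Sum>i<d (ty s). c (s, i) *s b s i)"
    by (subst c, subst sum.Sigma) (auto intro!: sum.cong)
  have "coord v s i = c (s, i)" if "s < n" "i < d (ty s)" for s i
    unfolding v using coord_combination[OF that, of "\<lambda>s i. c (s, i)"] .
  then show ?thesis
    using v by simp
qed

lemma matrix_eqI:
  assumes "\<And>s j. s < n \<Longrightarrow> j < d (ty s) \<Longrightarrow> B *v b s j = C *v b s j"
  shows "B = C"
proof -
  have "B *v v = C *v v" for v
    by (subst (1 2) expand) (simp add: matrix_vector_mult_sum vec.sum assms)
  then show ?thesis
    by (simp add: matrix_eq)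
qed

lemma independent_block:
  assumes "s < n"
  shows "inj_on (b s) {..<d (ty s)}" "vec.independent (b s ` {..<d (ty s)})"
  by (rule orthogonal_family_independent; use assms orthogonal nonzero in force)+

abbreviation block :: "nat \<Rightarrow> (complex ^ 'v) set" where
  "block s \<equiv> vec.span (b s ` {..<d (ty s)})"

end

text \<open>The upper and the lower bound that make \<open>T\<close> a direct sum of full matrix
  algebras. In \<open>blockwise\<close> the coefficients depend on the type of \<open>s\<close> and
  not on \<open>s\<close> itself; a unit in \<open>matrix_units\<close> acts on all chains of its
  type at once.\<close>

locale block_algebra = orthogonal_blocks n ty d b
  for n :: nat and ty :: "nat \<Rightarrow> nat" and d :: "nat \<Rightarrow> nat"
    and b :: "nat \<Rightarrow> nat \<Rightarrow> complex ^ 'v::finite" +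
  fixes T :: "(complex ^ 'v ^ 'v) set"
  assumes algebra: "matrix_subalgebra T"
    and blockwise: "\<And>B. B \<in> T \<Longrightarrow>
      \<exists>c. \<forall>s<n. \<forall>j<d (ty s). B *v b s j = (\<Sum>i<d (ty s). c (ty s) i j *s b s i)"
    and matrix_units: "\<And>s i j. s < n \<Longrightarrow> i < d (ty s) \<Longrightarrow> j < d (ty s) \<Longrightarrow>
      \<exists>E\<in>T. \<forall>s'<n. \<forall>l<d (ty s'). E *v b s' l = (if ty s' = ty s \<and> l = j then b s' i else 0)"
begin

text \<open>The values are determined only for types that occur and for indices below the size;
  elsewhere the choice is arbitrary.\<close>

definition coef :: "complex ^ 'v ^ 'v \<Rightarrow> nat \<Rightarrow> nat \<Rightarrow> nat \<Rightarrow> complex" where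
  "coef B = (SOME c. \<forall>s<n. \<forall>j<d (ty s). B *v b s j = (\<Sum>i<d (ty s). c (ty s) i j *s b s i))"

lemma mult_basis:
  assumes "B \<in> T" "s < n" "j < d (ty s)"
  shows "B *v b s j = (\<Sum>i<d (ty s). coef B (ty s) i j *s b s i)"
  using someI_ex[OF blockwise[OF assms(1)]] assms(2,3) unfolding coef_def by blast

definition munit :: "nat \<Rightarrow> nat \<Rightarrow> nat \<Rightarrow> complex ^ 'v ^ 'v" where
  "munit l i j = (SOME E. E \<in> T \<and>
     (\<forall>s<n. \<forall>k<d (ty s). E *v b s k = (if ty s = l \<and> k = j then b s i else 0)))"

lemma munit:
  assumes "l \<in> ty ` {..<n}" "i < d l" "j < d l"
  shows "munit l i j \<in> T"
    and "s < n \<Longrightarrow> k < d (ty s) \<Longrightarrow> munit l i j *v b s k = (if ty s = l \<and> k = j then b s i else 0)"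
proof -
  have "\<exists>E. E \<in> T \<and> (\<forall>s<n. \<forall>k<d (ty s). E *v b s k = (if ty s = l \<and> k = j then b s i else 0))"
    using matrix_units assms by fastforce
  from someI_ex[OF this] show "munit l i j \<in> T"
    and "s < n \<Longrightarrow> k < d (ty s) \<Longrightarrow> munit l i j *v b s k = (if ty s = l \<and> k = j then b s i else 0)"
    unfolding munit_def by blast+
qed

lemma munit_block:
  "s' < n \<Longrightarrow> i < d (ty s') \<Longrightarrow> j < d (ty s') \<Longrightarrow> s < n \<Longrightarrow> k < d (ty s) \<Longrightarrow>
    munit (ty s') i j *v b s k = (if ty s = ty s' \<and> k = j then b s i else 0)"
  using munit(2) by simp

lemma munit_mult:
  assumes "l \<in> ty ` {..<n}" "i < d l" "j < d l"
  shows "munit l i j *v v = (\<Sum>s | s < n \<and> ty s = l. coord v s j *s b s i)"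
proof -
  have "munit l i j *v v = (\<Sum>s<n. \<Sum>k<d (ty s). coord v s k *s (munit l i j *v b s k))"
    by (subst expand) (simp add: matrix_vector_mult_sum vec.sum)
  also have "\<dots> = (\<Sum>s<n. if ty s = l then coord v s j *s b s i else 0)"
  proof (rule sum.cong)
    fix s assume s: "s \<in> {..<n}"
    have "(\<Sum>k<d (ty s). coord v s k *s (munit l i j *v b s k)) =
        (\<Sum>k<d (ty s). if k = j then (if ty s = l then coord v s j *s b s i else 0) else 0)"
      by (rule sum.cong) (use s in \<open>auto simp: munit(2)[OF assms]\<close>)
    then show "(\<Sum>k<d (ty s). coord v s k *s (munit l i j *v b s k)) =
        (if ty s = l then coord v s j *s b s i else 0)"
      using assms by auto
  qed simp
  also have "\<dots> = (\<Sum>s | s < n \<and> ty s = l. coord v s j *s b s i)"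
    by (subst sum.inter_filter[symmetric]) (auto intro!: sum.cong)
  finally show ?thesis .
qed

text \<open>The vectors of a block are independent, so its two expansions can be compared. This
  carries the action of the units from the blocks over to arbitrary copies.\<close>

lemma coef_munit:
  assumes l: "l \<in> ty ` {..<n}" "i < d l" "j < d l"
    and l': "l' \<in> ty ` {..<n}" "a < d l'" "k < d l'"
  shows "coef (munit l i j) l' a k = (if l' = l \<and> a = i \<and> k = j then 1 else 0)"
proof -
  obtain s where s: "s < n" "l' = ty s"
    using l' by auto
  have "(\<Sum>a<d (ty s). coef (munit l i j) (ty s) a k *s b s a) =
      (if ty s = l \<and> k = j then b s i else 0)"
    using mult_basis[OF munit(1)[OF l] s(1), of k] munit(2)[OF l s(1), of k] l' s by simp
  also have "\<dots> = (\<Sum>a<d (ty s). if a = i then (if ty s = l \<and> k = j then 1 else 0) *s b s a else 0)"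
    using l by auto
  also have "\<dots> = (\<Sum>a<d (ty s). (if ty s = l \<and> a = i \<and> k = j then 1 else 0) *s b s a)"
    by (rule sum.cong) auto
  finally show ?thesis
    using independent_family_eqI[OF _ independent_block[OF s(1)], of
        "\<lambda>a. coef (munit l i j) (ty s) a k" "\<lambda>a. if ty s = l \<and> a = i \<and> k = j then 1 else 0" a] l' s
    by simp
qed

text \<open>\<open>is_copy U l w\<close>: the vectors \<open>w 0, w 1, \<dots>\<close> form a basis of \<open>U\<close> on which \<open>T\<close> acts
  by the same matrices as on a block of type \<open>l\<close>.\<close>

definition is_copy :: "(complex ^ 'v) set \<Rightarrow> nat \<Rightarrow> (nat \<Rightarrow> complex ^ 'v) \<Rightarrow> bool" where
  "is_copy U l w \<longleftrightarrow> l \<in> ty ` {..<n} \<and> inj_on w {..<d l} \<and> vec.independent (w ` {..<d l}) \<and>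
     U = vec.span (w ` {..<d l}) \<and>
     (\<forall>B\<in>T. \<forall>j<d l. B *v w j = (\<Sum>i<d l. coef B l i j *s w i))"

lemma is_copy_block: "s < n \<Longrightarrow> is_copy (block s) (ty s) (b s)"
  unfolding is_copy_def using independent_block mult_basis by auto

lemma is_copy_alg_module:
  assumes "is_copy U l w"
  shows "alg_module T U"
  unfolding alg_module_def
proof (intro conjI ballI)
  show "vec.subspace U"
    using assms by (auto simp: is_copy_def)
  fix B v assume B: "B \<in> T" and "v \<in> U"
  then obtain c where c: "v = (\<Sum>j<d l. c j *s w j)"
    using assms by (auto simp: is_copy_def span_family)
  have "w i \<in> U" if "i < d l" for i
    using assms that by (auto simp: is_copy_def intro: vec.span_base)
  then show "B *v v \<in> U"
    using assms B \<open>vec.subspace U\<close> unfolding c is_copy_def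
    by (auto simp: matrix_vector_mult_sum intro!: vec.subspace_sum vec.subspace_scale)
qed

text \<open>The linear map taking \<open>w i\<close> to \<open>w' i\<close> commutes with
  \<open>T\<close>, since each \<open>B\<close> has the same coefficients \<open>coef B l\<close> on
  both bases.\<close>

lemma is_copy_iso:
  assumes U: "is_copy U l w" and U': "is_copy U' l w'"
  shows "module_iso T U U'"
proof -
  let ?S = "w ` {..<d l}"
  have inj: "inj_on w {..<d l}" "inj_on w' {..<d l}" and ind: "vec.independent ?S"
    "vec.independent (w' ` {..<d l})" and eq: "U = vec.span ?S" "U' = vec.span (w' ` {..<d l})"
    using assms by (auto simp: is_copy_def)
  obtain f where f: "Vector_Spaces.linear (*s) (*s) f"
    and "\<forall>v\<in>?S. f v = w' (the_inv_into {..<d l} w v)"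
    using vec.linear_independent_extend[OF ind(1), of "\<lambda>v. w' (the_inv_into {..<d l} w v)"] by auto
  then have fw: "f (w i) = w' i" if "i < d l" for i
    using that inj by (simp add: the_inv_into_f_f)
  have img: "f ` ?S = w' ` {..<d l}"
    using fw by (force simp: image_iff)
  have "inj_on f ?S"
    by (rule inj_onI) (use fw inj in \<open>auto dest: inj_onD\<close>)
  then have "inj_on f U"
    unfolding eq using vec.linear_inj_on_span_independent_image[OF f] ind img by simp
  moreover have "f ` U = U'"
    unfolding eq img[symmetric] by (rule vec.linear_span_image[OF f, symmetric])
  moreover have "f (B *v u) = B *v f u" if B: "B \<in> T" and u: "u \<in> U" for B u
  proof -
    obtain c where c: "u = (\<Sum>j<d l. c j *s w j)"
      using u[unfolded eq span_family[OF finite_lessThan]] by blast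
    have *: "B *v w j = (\<Sum>i<d l. coef B l i j *s w i)" "B *v w' j = (\<Sum>i<d l. coef B l i j *s w' i)"
      if "j < d l" for j
      using B that assms by (auto simp: is_copy_def)
    show ?thesis
      unfolding c by (simp add: matrix_vector_mult_sum vec.linear_sum[OF f] vec.linear_scale[OF f] * fw)
  qed
  ultimately show ?thesis
    unfolding module_iso_def bij_betw_def
    using vec.linear_add[OF f] vec.linear_scale[OF f] by blast
qed

lemma is_copy_munit_mult:
  assumes "is_copy U l w" "l' \<in> ty ` {..<n}" "i < d l'" "j < d l'" "k < d l"
  shows "munit l' i j *v w k = (if l = l' \<and> k = j then w i else 0)"
proof -
  have "munit l' i j *v w k = (\<Sum>a<d l. coef (munit l' i j) l a k *s w a)"
    using assms munit(1) by (auto simp: is_copy_def)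
  also have "\<dots> = (\<Sum>a<d l. if a = i then (if l = l' \<and> k = j then w a else 0) else 0)"
    by (rule sum.cong) (use assms in \<open>auto simp: coef_munit is_copy_def\<close>)
  also have "\<dots> = (if l = l' \<and> k = j then w i else 0)"
    using assms by auto
  finally show ?thesis .
qed

lemma is_copy_nonzero: "is_copy U l w \<Longrightarrow> i < d l \<Longrightarrow> w i \<noteq> 0"
  unfolding is_copy_def using vec.dependent_zero by (metis imageI lessThan_iff)

lemma type_size_pos: "l \<in> ty ` {..<n} \<Longrightarrow> 0 < d l"
  using size_pos by auto

text \<open>\<open>munit l 0 0\<close> fixes the nonzero vector \<open>w 0\<close> but annihilates
  every copy of another type.\<close>

lemma is_copy_not_iso:
  assumes U: "is_copy U l w" and U': "is_copy U' l' w'" and "l \<noteq> l'"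
  shows "\<not> module_iso T U U'"
proof
  assume "module_iso T U U'"
  then obtain f where f: "bij_betw f U U'" "\<And>c u. u \<in> U \<Longrightarrow> f (c *s u) = c *s f u"
    "\<And>B u. B \<in> T \<Longrightarrow> u \<in> U \<Longrightarrow> f (B *v u) = B *v f u"
    unfolding module_iso_def by blast
  have l: "l \<in> ty ` {..<n}" "0 < d l"
    using U type_size_pos by (auto simp: is_copy_def)
  have w: "w 0 \<in> U"
    using U l by (auto simp: is_copy_def intro: vec.span_base)
  have zero: "0 \<in> U" "f 0 = 0"
    using f(2)[OF w, of 0] U by (auto simp: is_copy_def vec.span_zero)
  have "f (w 0) \<in> U'"
    using f(1) w by (auto simp: bij_betw_def)
  then obtain c where c: "f (w 0) = (\<Sum>j<d l'. c j *s w' j)"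
    using U' by (auto simp: is_copy_def span_family)
  have "f (w 0) = f (munit l 0 0 *v w 0)"
    using is_copy_munit_mult[OF U l(1), of 0 0 0] l by simp
  also have "\<dots> = munit l 0 0 *v f (w 0)"
    using f(3) w munit(1)[OF l(1)] l by simp
  also have "\<dots> = 0"
    unfolding c using is_copy_munit_mult[OF U' l(1), of 0 0] l \<open>l \<noteq> l'\<close>
    by (simp add: matrix_vector_mult_sum)
  finally have "f (w 0) = f 0"
    using zero by simp
  then have "w 0 = 0"
    using inj_onD[of f U "w 0" 0] f(1) w zero by (auto simp: bij_betw_def)
  then show False
    using is_copy_nonzero[OF U] l by simp
qed

lemma is_copy_iso_iff:
  assumes "is_copy U l w" "is_copy U' l' w'"
  shows "module_iso T U U' \<longleftrightarrow> l = l'"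
  using is_copy_iso is_copy_not_iso assms by metis

lemma is_copy_rank:
  assumes U: "is_copy U l w" and l': "l' \<in> ty ` {..<n}"
  shows "vec.dim ((*v) (munit l' 0 0) ` U) = (if l = l' then 1 else 0)"
proof -
  have d: "0 < d l'" "0 < d l"
    using l' U type_size_pos by (auto simp: is_copy_def)
  have "(*v) (munit l' 0 0) ` U = vec.span ((*v) (munit l' 0 0) ` w ` {..<d l})"
    using U by (simp add: is_copy_def vec.span_image)
  also have "(*v) (munit l' 0 0) ` w ` {..<d l} = (\<lambda>k. if l = l' \<and> k = 0 then w 0 else 0) ` {..<d l}"
    unfolding image_image by (rule image_cong) (use is_copy_munit_mult[OF U l'] d in auto)
  finally have eq: "(*v) (munit l' 0 0) ` U =
      vec.span ((\<lambda>k. if l = l' \<and> k = 0 then w 0 else 0) ` {..<d l})" .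
  show ?thesis
  proof (cases "l = l'")
    case True
    have "(\<lambda>k. if l = l' \<and> k = 0 then w 0 else 0) ` {..<d l} \<subseteq> {0, w 0}"
      by auto
    moreover have "w 0 \<in> (\<lambda>k. if l = l' \<and> k = 0 then w 0 else 0) ` {..<d l}"
      using True d by force
    ultimately have "vec.span ((\<lambda>k. if l = l' \<and> k = 0 then w 0 else 0) ` {..<d l}) = vec.span {w 0}"
      by (metis (no_types, lifting) empty_subsetI insert_subset vec.span_insert_0 vec.span_mono subset_antisym)
    then show ?thesis
      using is_copy_nonzero[OF U] d True unfolding eq by (simp add: vec.dim_eq_card_independent)
  next
    case False
    then have "(\<lambda>k. if l = l' \<and> k = 0 then w 0 else 0) ` {..<d l} = {0}"
      using d by auto
    then show ?thesis
      using False unfolding eq by (simp add: vec.dim_eq_0)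
  qed
qed

text \<open>A nonzero vector of a submodule has a nonzero coefficient at some \<open>j\<close>; the
  units of column \<open>j\<close> turn it into nonzero multiples of every
  \<open>b s i\<close>.\<close>

lemma irreducible_block:
  assumes s: "s < n"
  shows "irreducible_module T (block s)"
  unfolding irreducible_module_def
proof (intro conjI allI impI)
  show "alg_module T (block s)"
    using is_copy_alg_module[OF is_copy_block[OF s]] .
  have "b s 0 \<in> block s"
    using size_pos[OF s] by (auto intro: vec.span_base)
  then show "block s \<noteq> {0}"
    using nonzero[OF s] size_pos[OF s] by auto
  fix U assume U: "alg_module T U \<and> U \<subset> block s"
  show "U = {0}"
  proof (rule ccontr)
    assume "U \<noteq> {0}"
    moreover have "0 \<in> U"
      using U by (auto simp: alg_module_def vec.subspace_0)
    ultimately obtain u where u: "u \<in> U" "u \<noteq> 0"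
      by auto
    then obtain c where c: "u = (\<Sum>j<d (ty s). c j *s b s j)"
      using U by (auto simp: span_family)
    then obtain j where j: "j < d (ty s)" "c j \<noteq> 0"
      using u by (metis (no_types, lifting) lessThan_iff sum.neutral vec.scale_zero_left)
    have "b s i \<in> U" if i: "i < d (ty s)" for i
    proof -
      have "munit (ty s) i j *v u = (\<Sum>k<d (ty s). if k = j then c j *s b s i else 0)"
        unfolding c matrix_vector_mult_sum
        by (rule sum.cong) (use s i j in \<open>auto simp: munit(2)\<close>)
      then have "munit (ty s) i j *v u = c j *s b s i"
        using j by simp
      moreover have "munit (ty s) i j *v u \<in> U"
        using U u munit(1) s i j by (auto simp: alg_module_def)
      ultimately have "inverse (c j) *s (c j *s b s i) \<in> U"
        using U vec.subspace_scale[of U "c j *s b s i" "inverse (c j)"] by (simp add: alg_module_def)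
      then show ?thesis
        using j by (simp add: vector_smult_assoc)
    qed
    then have "block s \<subseteq> U"
      using U by (intro vec.span_minimal) (auto simp: alg_module_def)
    then show False
      using U by auto
  qed
qed

text \<open>The module may lie diagonally across several chains of one type. The units of one
  column, applied to a single suitable vector, produce a chain inside it, and the span of that chain
  is everything by irreducibility.\<close>

lemma irreducible_is_copy:
  assumes "irreducible_module T U"
  obtains l w where "is_copy U l w"
proof -
  have mod: "alg_module T U" and sub: "vec.subspace U" and "U \<noteq> {0}"
    and min: "\<And>U'. alg_module T U' \<Longrightarrow> U' \<subseteq> U \<Longrightarrow> U' \<noteq> {0} \<Longrightarrow> U' = U"
    using assms by (auto simp: irreducible_module_def alg_module_def)
  then obtain u where u: "u \<in> U" "u \<noteq> 0"
    using vec.subspace_0[OF sub] by blast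
  then obtain s j where s: "s < n" and j: "j < d (ty s)" and cj: "coord u s j \<noteq> 0"
    using expand[of u] by (metis (no_types, lifting) lessThan_iff sum.neutral vec.scale_zero_left)
  define l where "l = ty s"
  \<comment> \<open>By \<open>munit_mult\<close> this is \<open>munit l i j *v u\<close>, so it
    stays in \<open>U\<close>.\<close>
  define w where "w i = (\<Sum>s | s < n \<and> ty s = l. coord u s j *s b s i)" for i
  have l: "l \<in> ty ` {..<n}" "j < d l"
    using s j by (auto simp: l_def)
  have wU: "w i \<in> U" if "i < d l" for i
    using mod u(1) munit(1)[OF l(1) that l(2)]
    unfolding w_def munit_mult[OF l(1) that l(2), of u, symmetric] by (simp add: alg_module_def)
  \<comment> \<open>The coefficient in chain \<open>s\<close> moves from place \<open>j\<close> to
    place \<open>i\<close> unchanged, hence no \<open>w i\<close> vanishes.\<close>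
  have coord: "coord (w i) s i = coord u s j" if "i < d l" for i
  proof -
    have "hinner (w i) (b s i) = coord u s j * hinner (b s i) (b s i)"
      unfolding w_def by (rule orthogonal_family_coeff[of _ "\<lambda>s. b s i"])
        (use s that orthogonal in \<open>auto simp: l_def\<close>)
    then show ?thesis
      using nonzero[OF s] that by (simp add: coord_def l_def)
  qed
  have wnz: "w i \<noteq> 0" if "i < d l" for i
    using coord[OF that] cj by (auto simp: coord_def)
  have orth: "hinner (w i) (w k) = 0" if "i < d l" "k < d l" "i \<noteq> k" for i k
  proof -
    have "hinner (b s' i) (b s'' k) = 0" if "s' < n" "ty s' = l" "s'' < n" "ty s'' = l" for s' s''
      using that \<open>i < d l\<close> \<open>k < d l\<close> \<open>i \<noteq> k\<close> orthogonal[of s' i s'' k] by simp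
    then have "hinner (w i) (b s'' k) = 0" if "s'' < n" "ty s'' = l" for s''
      using that by (simp add: w_def hinner_sum_left hinner_scale_left)
    then have "hinner (b s'' k) (w i) = 0" if "s'' < n" "ty s'' = l" for s''
      using that by (blast intro: hinner_eq_0_commute)
    then have "hinner (w k) (w i) = 0"
      by (simp add: w_def[of k] hinner_sum_left hinner_scale_left)
    then show ?thesis
      by (rule hinner_eq_0_commute)
  qed
  have ind: "inj_on w {..<d l}" "vec.independent (w ` {..<d l})"
    by (rule orthogonal_family_independent; use orth wnz in force)+
  have act: "B *v w k = (\<Sum>i<d l. coef B l i k *s w i)" if "B \<in> T" "k < d l" for B k
  proof -
    have "B *v w k = (\<Sum>s | s < n \<and> ty s = l. coord u s j *s (\<Sum>i<d l. coef B l i k *s b s i))"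
      unfolding w_def matrix_vector_mult_sum
      by (rule sum.cong) (use that mult_basis in auto)
    also have "\<dots> = (\<Sum>s | s < n \<and> ty s = l. \<Sum>i<d l. coef B l i k *s (coord u s j *s b s i))"
      by (simp add: vec.scale_sum_right mult.commute)
    also have "\<dots> = (\<Sum>i<d l. coef B l i k *s w i)"
      unfolding w_def vec.scale_sum_right by (rule sum.swap)
    finally show ?thesis .
  qed
  have "is_copy (vec.span (w ` {..<d l})) l w"
    unfolding is_copy_def using l ind act by auto
  moreover from this have "vec.span (w ` {..<d l}) = U"
  proof (intro min is_copy_alg_module)
    show "vec.span (w ` {..<d l}) \<subseteq> U"
      using wU sub by (intro vec.span_minimal) auto
    have "w j \<in> vec.span (w ` {..<d l})"
      using l by (auto intro: vec.span_base)
    then show "vec.span (w ` {..<d l}) \<noteq> {0}"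
      using wnz l by auto
  qed
  ultimately show thesis
    using that by metis
qed

lemma block_iso_iff:
  "s < n \<Longrightarrow> s' < n \<Longrightarrow> module_iso T (block s) (block s') \<longleftrightarrow> ty s = ty s'"
  using is_copy_iso_iff is_copy_block by metis

lemma orthogonal_blocks:
  assumes "s < n" "s' < n" "s \<noteq> s'" "u \<in> block s" "v \<in> block s'"
  shows "hinner u v = 0"
proof (rule hinner_orthogonal_subspace[OF _ assms(5)])
  fix y assume "y \<in> b s' ` {..<d (ty s')}"
  then have "hinner y z = 0" if "z \<in> b s ` {..<d (ty s)}" for z
    using that orthogonal assms(1-3) by auto
  then have "hinner y u = 0"
    using assms(4) by (rule hinner_orthogonal_subspace)
  then show "hinner u y = 0"
    by (rule hinner_eq_0_commute)
qed

lemma orthogonal_decomposition_blocks: "orthogonal_decomposition T (map block [0..<n])"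
proof -
  have "case_prod b ` (SIGMA s:{..<n}. {..<d (ty s)}) \<subseteq> \<Union>(block ` {..<n})"
    by (auto intro!: vec.span_base)
  then have "vec.span (\<Union>(block ` {..<n})) = UNIV"
    using vec.span_mono basis_family(3) by blast
  then show ?thesis
    unfolding orthogonal_decomposition_def using irreducible_block orthogonal_blocks
    by (auto simp: atLeast0LessThan)
qed

text \<open>The rank of \<open>munit l 0 0\<close> on the standard module counts the summands of type \<open>l\<close>.\<close>

lemma count_summands:
  assumes Ws: "orthogonal_decomposition T Ws" and s: "s < n"
  shows "length (filter (module_iso T (block s)) Ws) = vec.dim (range ((*v) (munit (ty s) 0 0)))"
proof -
  let ?E = "munit (ty s) 0 0"
  have E: "?E \<in> T" and tys: "ty s \<in> ty ` {..<n}"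
    using munit(1) size_pos s by auto
  have irr: "irreducible_module T W" if "W \<in> set Ws" for W
    using Ws that by (auto simp: orthogonal_decomposition_def)
  have inv: "(*v) ?E ` W \<subseteq> W" "vec.subspace W" if "W \<in> set Ws" for W
    using irr[OF that] E by (auto simp: irreducible_module_def alg_module_def)
  have dimW: "vec.dim ((*v) ?E ` W) = (if module_iso T (block s) W then 1 else 0)" if W: "W \<in> set Ws" for W
  proof -
    obtain l w where lw: "is_copy W l w"
      using irreducible_is_copy[OF irr[OF W]] by blast
    show ?thesis
      using is_copy_iso_iff[OF is_copy_block[OF s] lw] is_copy_rank[OF lw tys] by auto
  qed
  have "range ((*v) ?E) = (*v) ?E ` vec.span (\<Union>(set Ws))"
    using Ws by (simp add: orthogonal_decomposition_def)
  also have "\<dots> = vec.span (\<Union>(set (map ((`) ((*v) ?E)) Ws)))"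
    by (simp add: vec.span_image[symmetric] image_Union)
  finally have "vec.dim (range ((*v) ?E)) = vec.dim (vec.span (\<Union>(set (map ((`) ((*v) ?E)) Ws))))"
    by simp
  \<comment> \<open>The image of a summand stays inside that summand, so the images are again
    mutually orthogonal and their dimensions add up.\<close>
  also have "\<dots> = (\<Sum>W\<leftarrow>map ((`) ((*v) ?E)) Ws. vec.dim W)"
  proof (rule dim_span_orthogonal_list)
    fix W assume "W \<in> set (map ((`) ((*v) ?E)) Ws)"
    then show "vec.subspace W"
      using inv by (auto intro: vec.subspace_image)
  next
    fix i j assume ij: "i < length (map ((`) ((*v) ?E)) Ws)" "j < length (map ((`) ((*v) ?E)) Ws)" "i \<noteq> j"
    then have "\<forall>u\<in>Ws ! i. \<forall>v\<in>Ws ! j. hinner u v = 0"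
      using Ws by (auto simp: orthogonal_decomposition_def)
    moreover have "map ((`) ((*v) ?E)) Ws ! i \<subseteq> Ws ! i" "map ((`) ((*v) ?E)) Ws ! j \<subseteq> Ws ! j"
      using ij inv[of "Ws ! i"] inv[of "Ws ! j"] by auto
    ultimately show "\<forall>u\<in>map ((`) ((*v) ?E)) Ws ! i. \<forall>v\<in>map ((`) ((*v) ?E)) Ws ! j. hinner u v = 0"
      by blast
  qed
  also have "\<dots> = (\<Sum>W\<leftarrow>Ws. if module_iso T (block s) W then 1 else 0)"
    using dimW by (auto intro!: arg_cong[of _ _ sum_list])
  also have "\<dots> = length (filter (module_iso T (block s)) Ws)"
    by (induction Ws) auto
  finally show ?thesis ..
qed

lemma module_multiplicity_block:
  assumes s: "s < n"
  shows "module_multiplicity T (block s) = card {s'. s' < n \<and> ty s' = ty s}"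
proof -
  let ?Ws = "map block [0..<n]"
  have len: "length (filter (module_iso T (block s)) ?Ws) = card {s'. s' < n \<and> ty s' = ty s}"
    by (simp add: length_filter_conv_card block_iso_iff[OF s] eq_commute[of "ty s"] cong: conj_cong)
  then have ex: "\<exists>Ws. orthogonal_decomposition T Ws \<and>
      length (filter (module_iso T (block s)) Ws) = card {s'. s' < n \<and> ty s' = ty s}"
    using orthogonal_decomposition_blocks by blast
  show ?thesis
    unfolding module_multiplicity_def
  proof (rule the_equality)
    \<comment> \<open>Any decomposition gives the rank of one fixed matrix, so the value agrees with
      that for the blocks.\<close>
    fix m assume "\<exists>Ws. orthogonal_decomposition T Ws \<and> length (filter (module_iso T (block s)) Ws) = m"
    then show "m = card {s'. s' < n \<and> ty s' = ty s}"
      using count_summands[OF _ s] count_summands[OF orthogonal_decomposition_blocks s] len by metis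
  qed (rule ex)
qed

text \<open>The units \<open>munit l i j\<close> of the occurring types form a basis of
  \<open>T\<close>.\<close>

lemma dim_algebra: "cmat.dim T = (\<Sum>l\<in>ty ` {..<n}. (d l)\<^sup>2)"
proof -
  let ?K = "SIGMA l:ty ` {..<n}. {..<d l} \<times> {..<d l}"
  let ?g = "\<lambda>(l, i, j). munit l i j"
  have fin: "finite ?K"
    by (intro finite_SigmaI) auto
  have gT: "?g k \<in> T" if "k \<in> ?K" for k
  proof -
    obtain l i j where "k = (l, i, j)" "l \<in> ty ` {..<n}" "i < d l" "j < d l"
      using \<open>k \<in> ?K\<close> by blast
    then show ?thesis
      using munit(1) by simp
  qed
  \<comment> \<open>On \<open>b s j\<close> only the units of type \<open>ty s\<close> and column
    \<open>j\<close> survive, so the coefficients of a combination can be read off.\<close>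
  have val: "(\<Sum>k\<in>?K. c k *s (?g k *v b s j)) = (\<Sum>i<d (ty s). c (ty s, i, j) *s b s i)"
    if "s < n" "j < d (ty s)" for c s j
  proof -
    have "(\<Sum>k\<in>?K. c k *s (?g k *v b s j)) =
        (\<Sum>k\<in>(\<lambda>i. (ty s, i, j)) ` {..<d (ty s)}. c k *s (?g k *v b s j))"
      by (rule sum.mono_neutral_right)
        (use that in \<open>auto simp: image_iff munit_block split: if_splits\<close>)
    also have "\<dots> = (\<Sum>i<d (ty s). c (ty s, i, j) *s b s i)"
      by (subst sum.reindex) (use that in \<open>auto simp: inj_on_def munit_block\<close>)
    finally show ?thesis .
  qed
  have zero: "c k = 0" if c: "(\<Sum>k\<in>?K. cmat_scale (c k) (?g k)) = 0" and k: "k \<in> ?K" for c k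
  proof -
    obtain s i j where s: "k = (ty s, i, j)" "s < n" "i < d (ty s)" "j < d (ty s)"
      using k by auto
    have "(\<Sum>k\<in>?K. c k *s (?g k *v b s j)) = 0"
      using c cmat_sum_mult_vec[of c ?g ?K "b s j"] by simp
    then show ?thesis
      using val[OF s(2,4)] s
        independent_family_zero[OF _ independent_block[OF s(2)], of "\<lambda>i. c (ty s, i, j)" i] by simp
  qed
  have inj: "inj_on ?g ?K"
  proof (rule inj_onI, rule ccontr)
    fix k k' assume kk: "k \<in> ?K" "k' \<in> ?K" "?g k = ?g k'" "k \<noteq> k'"
    define c :: "_ \<Rightarrow> complex" where "c m = (if m = k then 1 else if m = k' then - 1 else 0)" for m
    have "(\<Sum>m\<in>?K. cmat_scale (c m) (?g m)) = (\<Sum>m\<in>{k, k'}. cmat_scale (c m) (?g m))"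
      by (rule sum.mono_neutral_right) (use kk fin in \<open>auto simp: c_def\<close>)
    also have "\<dots> = 0"
      using kk by (simp add: c_def)
    finally have "c k = 0"
      using zero kk by blast
    then show False
      by (simp add: c_def)
  qed
  have "cmat.independent (?g ` ?K)"
  proof (rule cmat.independent_if_scalars_zero)
    fix c B assume c: "(\<Sum>B\<in>?g ` ?K. cmat_scale (c B) B) = 0" and "B \<in> ?g ` ?K"
    then obtain k where k: "k \<in> ?K" "B = ?g k"
      by auto
    show "c B = 0"
      using c zero[of "\<lambda>k. c (?g k)" k] k by (simp add: sum.reindex[OF inj])
  qed (use fin in auto)
  moreover have "cmat.span (?g ` ?K) = cmat.span T"
  proof
    show "cmat.span (?g ` ?K) \<subseteq> cmat.span T"
      using gT by (auto intro!: cmat.span_mono)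
    have "B \<in> cmat.span (?g ` ?K)" if B: "B \<in> T" for B
    proof -
      have "B = (\<Sum>k\<in>?K. cmat_scale ((\<lambda>(l, i, j). coef B l i j) k) (?g k))"
      proof (rule matrix_eqI)
        fix s j assume s: "s < n" "j < d (ty s)"
        show "B *v b s j = (\<Sum>k\<in>?K. cmat_scale ((\<lambda>(l, i, j). coef B l i j) k) (?g k)) *v b s j"
          unfolding cmat_sum_mult_vec val[OF s] using mult_basis[OF B s] by simp
      qed
      also have "\<dots> \<in> cmat.span (?g ` ?K)"
        by (intro cmat.span_sum cmat.span_scale cmat.span_base imageI)
      finally show ?thesis .
    qed
    then show "cmat.span T \<subseteq> cmat.span (?g ` ?K)"
      by (intro cmat.span_minimal) auto
  qed
  ultimately have "cmat.dim T = card (?g ` ?K)"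
    by (intro cmat.dim_eq_card)
  also have "\<dots> = (\<Sum>l\<in>ty ` {..<n}. (d l)\<^sup>2)"
    by (simp add: card_image[OF inj] card_SigmaI power2_eq_square)
  finally show ?thesis .
qed

end

section \<open>Structure of the Desargues graph\<close>

locale desargues =
  fixes adj :: "'v::finite \<Rightarrow> 'v \<Rightarrow> bool"
  assumes desargues: "desargues_graph adj"
begin

section \<open>Distances and local neighbour counts\<close>

abbreviation dist_adj :: "'v \<Rightarrow> 'v \<Rightarrow> nat" where
  "dist_adj \<equiv> gdist adj"

lemma adj_sym: "adj y z \<Longrightarrow> adj z y"
  using desargues by (auto simp: desargues_graph_def distance_regular_def simple_graph_def dest: sympD)

lemma adj_irrefl: "\<not> adj y y"
  using desargues by (auto simp: desargues_graph_def distance_regular_def simple_graph_def dest: irreflpD)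

lemma relpowp_gdist: "(adj ^^ dist_adj y z) y z"
proof -
  have "adj\<^sup>*\<^sup>* y z"
    using desargues by (auto simp: desargues_graph_def distance_regular_def connected_graph_def)
  then show ?thesis
    unfolding gdist_def by (metis rtranclp_power LeastI)
qed

lemma gdist_le: "(adj ^^ k) y z \<Longrightarrow> dist_adj y z \<le> k"
  unfolding gdist_def by (rule Least_le)

lemma gdist_0_iff [simp]: "dist_adj y z = 0 \<longleftrightarrow> y = z"
  using relpowp_gdist[of y z] gdist_le[of 0 y z] by auto

lemma gdist_self [simp]: "dist_adj y y = 0"
  by simp

lemma gdist_commute: "dist_adj y z = dist_adj z y"
proof -
  have "(adj ^^ k) z y" if "(adj ^^ k) y z" for k y z
    using that
  proof (induction k arbitrary: z)
    case (Suc k)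
    then obtain w where "(adj ^^ k) y w" "adj w z"
      by auto
    then show ?case
      using Suc.IH adj_sym relpowp_Suc_I2[of adj z w k y] by blast
  qed simp
  then show ?thesis
    using relpowp_gdist gdist_le by (metis le_antisym)
qed

lemma gdist_adj_le: "adj y w \<Longrightarrow> dist_adj z w \<le> Suc (dist_adj z y)"
  using relpowp_gdist[of z y] gdist_le[of "Suc (dist_adj z y)" z w] by auto

lemma gdist_1_iff: "dist_adj y z = 1 \<longleftrightarrow> adj y z"
proof
  assume "dist_adj y z = 1"
  then show "adj y z"
    using relpowp_gdist[of y z] by auto
next
  assume "adj y z"
  then have "dist_adj y z \<le> 1" "dist_adj y z \<noteq> 0"
    using gdist_le[of 1 y z] adj_irrefl by auto
  then show "dist_adj y z = 1"
    by linarith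
qed

lemma gdist_Suc_neighbour:
  assumes "dist_adj z y = Suc k"
  obtains w where "adj y w" "dist_adj z w = k"
proof -
  obtain w where w: "(adj ^^ k) z w" "adj w y"
    using relpowp_gdist[of z y] assms by auto
  then have "dist_adj z w \<le> k" "Suc k \<le> Suc (dist_adj z w)"
    using gdist_le[of k z w] gdist_adj_le[of w y z] assms by auto
  then show thesis
    using that[of w] w adj_sym by simp
qed

lemma array: "intersection_array adj = ([3, 2, 2, 1, 1], [1, 1, 2, 2, 3])"
  using desargues by (simp add: desargues_graph_def)

lemma gdiam: "gdiam adj = 5"
proof -
  have "length (fst (intersection_array adj)) = gdiam adj"
    by (simp add: intersection_array_def)
  then show ?thesis
    by (simp add: array)
qed

lemma finite_gdists: "finite {dist_adj y z | y z. True}"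
  using finite_image_set2[of "\<lambda>_. True" "\<lambda>_. True" dist_adj] by simp

lemma gdist_le_5: "dist_adj y z \<le> 5"
proof -
  have "dist_adj y z \<le> gdiam adj"
    unfolding gdiam_def using finite_gdists by (intro Max_ge) auto
  then show ?thesis
    by (simp add: gdiam)
qed

text \<open>The definite description determines a value only if some pair is at distance
  \<open>h\<close>; the first hypothesis supplies one.\<close>

lemma intersection_number_eq:
  assumes "dist_adj y z = h" "i \<le> 5" "j \<le> 5"
  shows "intersection_number adj h i j = card {w. dist_adj y w = i \<and> dist_adj z w = j}"
proof -
  have "h \<le> 5"
    using assms gdist_le_5 by blast
  then obtain p where p: "\<And>y z. dist_adj y z = h \<Longrightarrow> card (sphere_at adj i y \<inter> sphere_at adj j z) = p"
    using desargues assms unfolding desargues_graph_def distance_regular_def gdiam by metis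
  have "intersection_number adj h i j = p"
    unfolding intersection_number_def
    by (rule the_equality) (use p assms(1) in auto)
  also have "p = card {w. dist_adj y w = i \<and> dist_adj z w = j}"
    using p[OF assms(1)] by (simp add: sphere_at_def Int_def)
  finally show ?thesis .
qed

lemma card_up:
  assumes "dist_adj z y = i" "i < 5"
  shows "card {w. adj y w \<and> dist_adj z w = Suc i} = [3, 2, 2, 1, 1] ! i"
proof -
  have "fst (intersection_array adj) ! i = intersection_number adj i 1 (i + 1)"
    unfolding intersection_array_def gdiam using assms by simp
  also have "\<dots> = card {w. dist_adj y w = 1 \<and> dist_adj z w = Suc i}"
    using assms intersection_number_eq[of y z i 1 "i + 1"] by (simp add: gdist_commute[of y z])
  finally show ?thesis
    unfolding array gdist_1_iff by simp
qed

text \<open>Position \<open>i\<close> of this list holds c_(i+1), because the list starts with c_1;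
  in \<open>card_up\<close>, position \<open>i\<close> holds b_i.\<close>

lemma card_down:
  assumes "dist_adj z y = Suc i"
  shows "card {w. adj y w \<and> dist_adj z w = i} = [1, 1, 2, 2, 3] ! i"
proof -
  have i: "i < 5"
    using assms gdist_le_5[of z y] by simp
  then have "snd (intersection_array adj) ! i = intersection_number adj (Suc i) 1 i"
    unfolding intersection_array_def gdiam by (simp del: upt_Suc add: nth_append)
  also have "\<dots> = card {w. dist_adj y w = 1 \<and> dist_adj z w = i}"
    using assms i intersection_number_eq[of y z "Suc i" 1 i] by (simp add: gdist_commute[of y z])
  finally show ?thesis
    unfolding array gdist_1_iff by simp
qed

lemma degree: "card {w. adj y w} = 3"
proof -
  have "{w. adj y w} = {w. adj y w \<and> dist_adj y w = Suc 0}"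
    using gdist_1_iff by auto
  then show ?thesis
    using card_up[of y y 0] by simp
qed

text \<open>In this array b_i + c_i = 3 for all i (with c_0 = b_5 = 0), so no neighbour of
  \<open>y\<close> is left at the same distance from \<open>z\<close> as \<open>y\<close>.\<close>

lemma bipartite:
  assumes "adj y w"
  shows "dist_adj z w = Suc (dist_adj z y) \<or> dist_adj z y = Suc (dist_adj z w)"
proof -
  let ?i = "dist_adj z y"
  let ?U = "{w. adj y w \<and> dist_adj z w = Suc ?i}" and ?D = "{w. adj y w \<and> Suc (dist_adj z w) = ?i}"
  have "card ?U + card ?D \<ge> 3"
  proof (cases "?i")
    case 0
    then show ?thesis
      using card_up[of z y 0] by simp
  next
    case (Suc k)
    then have D: "card ?D = [1, 1, 2, 2, 3] ! k"
      using card_down[of z y k] by simp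
    have "k \<in> {0, 1, 2, 3, 4}"
      using gdist_le_5[of z y] Suc by auto
    then show ?thesis
      using card_up[of z y "Suc k"] D Suc by auto
  qed
  moreover have "card (?U \<union> ?D) = card ?U + card ?D"
    by (rule card_Un_disjoint) auto
  ultimately have "?U \<union> ?D = {w. adj y w}"
    using degree[of y] by (intro card_seteq) auto
  then show ?thesis
    using assms by auto
qed

text \<open>Double counting of the edges between two consecutive spheres.\<close>

lemma card_sphere_Suc:
  assumes "i < 5"
  shows "card {y. dist_adj z y = Suc i} * [1, 1, 2, 2, 3] ! i =
    card {y. dist_adj z y = i} * [3, 2, 2, 1, 1] ! i"
proof -
  let ?S = "{y. dist_adj z y = i}" and ?R = "{y. dist_adj z y = Suc i}"
  have "card ?S * [3, 2, 2, 1, 1] ! i = (\<Sum>y\<in>?S. card {w. adj y w \<and> dist_adj z w = Suc i})"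
    using card_up[of z _ i] assms by simp
  also have "\<dots> = (\<Sum>y\<in>?S. \<Sum>w\<in>?R. if adj y w then 1 else 0)"
    by (rule sum.cong) (auto simp: sum.If_cases intro!: arg_cong[of _ _ card])
  also have "\<dots> = (\<Sum>w\<in>?R. \<Sum>y\<in>?S. if adj y w then 1 else 0)"
    by (rule sum.swap)
  also have "\<dots> = (\<Sum>w\<in>?R. card {y. adj w y \<and> dist_adj z y = i})"
    by (rule sum.cong) (auto simp: sum.If_cases intro!: arg_cong[of _ _ card] adj_sym)
  also have "\<dots> = card ?R * [1, 1, 2, 2, 3] ! i"
    using card_down[of z _ i] by simp
  finally show ?thesis ..
qed

text \<open>The sphere sizes are 1, 3, 6, 6, 3, 1.\<close>

lemma card_sphere_5: "card {y. dist_adj z y = 5} = 1"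
  using card_sphere_Suc[of 0 z] card_sphere_Suc[of 1 z] card_sphere_Suc[of 2 z]
    card_sphere_Suc[of 3 z] card_sphere_Suc[of 4 z]
  by (simp add: numeral_eq_Suc)

lemma antipode_unique: "dist_adj z y = 5 \<Longrightarrow> dist_adj z y' = 5 \<Longrightarrow> y = y'"
  using card_sphere_5[of z] by (metis (mono_tags, lifting) card_1_singletonE mem_Collect_eq singletonD)

section \<open>How the intersection numbers force the layers around the base vertex\<close>

lemma neighbours_eq:
  assumes "adj y a" "adj y a'" "adj y a''" "a \<noteq> a'" "a \<noteq> a''" "a' \<noteq> a''"
  shows "{w. adj y w} = {a, a', a''}"
proof -
  have "{a, a', a''} = {w. adj y w}"
    by (rule card_subset_eq) (use assms degree[of y] in auto)
  then show ?thesis ..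
qed

text \<open>This is c_2 = 1.\<close>

lemma parent_unique:
  assumes "dist_adj x p = 2" "adj p u" "dist_adj x u = 1" "adj p u'" "dist_adj x u' = 1"
  shows "u = u'"
proof -
  have "card {w. adj p w \<and> dist_adj x w = 1} = 1"
    using card_down[of x p 1] assms by (simp add: numeral_2_eq_2)
  then show ?thesis
    using assms by (metis (mono_tags, lifting) card_1_singletonE mem_Collect_eq singletonD)
qed

text \<open>A common neighbour of \<open>p\<close> and \<open>p'\<close> lies in layer 1 or 3 by
  bipartiteness, and layer 1 is excluded. Then b_3 = 1 supplies the third neighbour
  \<open>t\<close>.\<close>

lemma third_level_vertex:
  assumes p: "dist_adj x p = 2" "dist_adj x p' = 2" "dist_adj p p' = 2"
    and no_parent: "\<And>u. dist_adj x u = 1 \<Longrightarrow> adj u p \<Longrightarrow> adj u p' \<Longrightarrow> False"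
  obtains w t where "dist_adj x w = 3" "adj w p" "adj w p'" "adj w t" "dist_adj x t = 4"
    "{z. adj w z} = {p, p', t}"
proof -
  obtain w where w: "adj p' w" "dist_adj p w = 1"
    using gdist_Suc_neighbour[of p p' 1] p by (auto simp: numeral_2_eq_2)
  then have wp: "adj w p" "adj w p'"
    using adj_sym gdist_1_iff by auto
  have "dist_adj x w = 3 \<or> dist_adj x w = 1"
    using bipartite[OF w(1), of x] p by auto
  then have dw: "dist_adj x w = 3"
    using no_parent wp by blast
  have "card {z. adj w z \<and> dist_adj x z = 4} = 1"
    using card_up[of x w 3] dw by (simp add: numeral_eq_Suc)
  then obtain t where t: "adj w t" "dist_adj x t = 4"
    by (auto simp: card_1_singleton_iff)
  have "p \<noteq> p'" "p \<noteq> t" "p' \<noteq> t"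
    using p t by (metis gdist_0_iff zero_neq_numeral, auto)
  then show thesis
    using that[OF dw wp t] neighbours_eq[OF wp t(1)] by simp
qed

text \<open>\<open>u\<close> and \<open>w\<close> are at distance 4, so b_4 = 1 gives a neighbour of
  \<open>w\<close> at distance 5 from \<open>u\<close>; \<open>p\<close> and \<open>p'\<close> are
  within distance 3 of \<open>u\<close>, which leaves \<open>t\<close>.\<close>

lemma antipode_in_fourth_level:
  assumes u: "dist_adj x u = 1" "\<not> adj u p" "\<not> adj u p'"
    and p: "dist_adj x p = 2" "dist_adj x p' = 2"
    and w: "dist_adj x w = 3" "{z. adj w z} = {p, p', t}" "dist_adj x t = 4"
  shows "dist_adj u t = 5"
proof -
  have xu: "adj x u" and ux: "adj u x"
    using u(1) gdist_1_iff adj_sym by auto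
  have "dist_adj w u = 4 \<or> dist_adj w u = 2"
    using bipartite[OF xu, of w] w(1) gdist_commute[of x w] by auto
  \<comment> \<open>A common neighbour would be \<open>p\<close>, \<open>p'\<close> or
    \<open>t\<close>: the first two are not adjacent to \<open>u\<close>, and \<open>t\<close> is
    three layers above \<open>u\<close>.\<close>
  moreover have "dist_adj w u \<noteq> 2"
  proof
    assume "dist_adj w u = 2"
    then obtain z where z: "adj u z" "dist_adj w z = 1"
      using gdist_Suc_neighbour[of w u 1] by (auto simp: numeral_2_eq_2)
    then have "z \<in> {p, p', t}"
      using w(2) gdist_1_iff by blast
    then have "z = t"
      using u z by auto
    then show False
      using gdist_adj_le[OF z(1), of x] u(1) w(3) by simp
  qed
  ultimately have "dist_adj u w = 4"
    by (simp add: gdist_commute)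
  then have "card {z. adj w z \<and> dist_adj u z = 5} = 1"
    using card_up[of u w 4] by (simp add: numeral_eq_Suc)
  then obtain z where z: "adj w z" "dist_adj u z = 5"
    by (auto simp: card_1_singleton_iff)
  have "dist_adj z u \<le> 3" if "dist_adj x z = 2"
    using gdist_adj_le[OF xu, of z] that gdist_commute[of x z] by simp
  moreover have "z \<in> {p, p', t}"
    using z(1) w(2) by blast
  ultimately have "z = t"
    using z(2) p gdist_commute[of u z] by auto
  then show ?thesis
    using z by simp
qed

text \<open>This is b_1 = 2; the third neighbour of \<open>u\<close> is \<open>x\<close>.\<close>

lemma children:
  assumes "dist_adj x u = 1"
  obtains p q where "p \<noteq> q" "dist_adj x p = 2" "dist_adj x q = 2" "{w. adj u w} = {x, p, q}"
proof -
  have "card {w. adj u w \<and> dist_adj x w = 2} = 2"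
    using card_up[of x u 1] assms by (simp add: numeral_2_eq_2)
  then obtain p q where pq: "{w. adj u w \<and> dist_adj x w = 2} = {p, q}" "p \<noteq> q"
    by (auto simp: card_2_iff)
  then have *: "adj u p" "adj u q" "dist_adj x p = 2" "dist_adj x q = 2"
    by blast+
  have "adj u x"
    using assms gdist_1_iff adj_sym by auto
  moreover have "x \<noteq> p" "x \<noteq> q"
    using * by auto
  ultimately have "{w. adj u w} = {x, p, q}"
    using * pq by (intro neighbours_eq) auto
  then show thesis
    using that pq * by blast
qed

text \<open>\<open>p\<close> is at distance 3 from \<open>u\<close>, so by c_3 = 2 exactly two
  neighbours of \<open>u\<close> are at distance 2 from \<open>p\<close>. One of them is
  \<open>x\<close>; the other is exactly one of the two children.\<close>

lemma opposite_child:
  assumes "dist_adj x p = 2" "dist_adj x u = 1" "\<not> adj u p" "{w. adj u w} = {x, a, a'}" "a \<noteq> a'"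
    "dist_adj x a = 2" "dist_adj x a' = 2"
  shows "dist_adj p a = 2 \<longleftrightarrow> dist_adj p a' \<noteq> 2"
proof -
  have "adj x u"
    using assms gdist_1_iff by auto
  moreover have "dist_adj p x = 2"
    using assms(1) gdist_commute[of x p] by simp
  moreover have "dist_adj p u \<noteq> 1"
    using assms(3) gdist_1_iff adj_sym by blast
  ultimately have "dist_adj p u = 3"
    using bipartite[of x u p] by auto
  then have "card {w. adj u w \<and> dist_adj p w = 2} = 2"
    using card_down[of p u 2] by (simp add: numeral_eq_Suc)
  moreover have "{w. adj u w \<and> dist_adj p w = 2} = {w \<in> {x, a, a'}. dist_adj p w = 2}"
    unfolding assms(4)[symmetric] by simp
  moreover have "{w \<in> {x, a, a'}. dist_adj p w = 2} =
      insert x ((if dist_adj p a = 2 then {a} else {}) \<union> (if dist_adj p a' = 2 then {a'} else {}))"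
    using \<open>dist_adj p x = 2\<close> by auto
  moreover have "x \<noteq> a" "x \<noteq> a'"
    using assms(6,7) by auto
  ultimately show ?thesis
    using assms(5) by (simp split: if_splits)
qed

end

text \<open>
  The labels 0 to 19 stand for \<open>x; u\<^sub>1, u\<^sub>2, u\<^sub>3; p\<^sub>1, q\<^sub>1, p\<^sub>2, q\<^sub>2, p\<^sub>3, q\<^sub>3\<close>;
  \<open>P\<^sub>1, Q\<^sub>1, P\<^sub>2, Q\<^sub>2, P\<^sub>3, Q\<^sub>3; t\<^sub>1, t\<^sub>2, t\<^sub>3\<close> and the antipode of \<open>x\<close>.
\<close>

definition nbr_table :: "nat list list" where
  "nbr_table =
    [[1, 2, 3],
     [0, 4, 5], [0, 6, 7], [0, 8, 9],
     [1, 12, 14], [1, 13, 15], [2, 10, 14], [2, 11, 15], [3, 10, 12], [3, 11, 13],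
     [6, 8, 16], [7, 9, 16], [4, 8, 17], [5, 9, 17], [4, 6, 18], [5, 7, 18],
     [10, 11, 19], [12, 13, 19], [14, 15, 19],
     [16, 17, 18]]"

definition layer :: "nat list" where
  "layer = [0, 1, 1, 1, 2, 2, 2, 2, 2, 2, 3, 3, 3, 3, 3, 3, 4, 4, 4, 5]"

text \<open>Such a list is an isomorphism from one fixed model onto the graph, taking label 0 to the
  base vertex.\<close>

definition labelling :: "('v::finite \<Rightarrow> 'v \<Rightarrow> bool) \<Rightarrow> 'v list \<Rightarrow> bool" where
  "labelling adj vs \<longleftrightarrow> length vs = 20 \<and> distinct vs \<and> set vs = UNIV \<and>
     (\<forall>i<20. {w. adj (vs ! i) w} = (!) vs ` set (nbr_table ! i)) \<and>
     (\<forall>i<20. gdist adj (vs ! 0) (vs ! i) = layer ! i)"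

lemma all_less_20: "(\<forall>i<20. P (i :: nat)) \<longleftrightarrow> list_all P [0, 1, 2, 3, 4, 5, 6, 7, 8, 9, 10, 11, 12, 13, 14, 15, 16, 17, 18, 19]"
proof -
  have "(\<forall>i<20. P i) \<longleftrightarrow> (\<forall>i\<in>set [0..<20]. P i)"
    by auto
  also have "[0..<20] = [0, 1, 2, 3, 4, 5, 6, 7, 8, 9, 10, 11, 12, 13, 14, 15, 16, 17, 18, 19]"
    by (simp add: upt_rec)
  finally show ?thesis
    by (simp only: list_all_iff)
qed

section \<open>The labelling attached to an order of layer 2\<close>

context desargues
begin

lemma no_common_parent:
  assumes "dist_adj x u = 1" "{w. adj u w} = {x, p, q}" "dist_adj x p = 2" "dist_adj x p' = 2"
    "p' \<noteq> p" "p' \<noteq> q" "dist_adj x v = 1" "adj v p" "adj v p'"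
  shows False
proof -
  have "adj p u" "adj p v"
    using assms adj_sym by blast+
  then have "v = u"
    using parent_unique assms by blast
  then have "p' \<in> {x, p, q}"
    using assms by blast
  then show False
    using assms by auto
qed

text \<open>Each of the six pairs in \<open>pp\<close> and \<open>qq\<close> produces one vertex of
  layer 3. Antipodes of the u_k then settle layer 4, and the count of 20 vertices shows that nothing
  is missing.\<close>

lemma ex_labelling:
  assumes u: "dist_adj x u1 = 1" "dist_adj x u2 = 1" "dist_adj x u3 = 1"
    and up: "adj u1 p1" "adj u1 q1" "adj u2 p2" "adj u2 q2" "adj u3 p3" "adj u3 q3"
    and x2: "dist_adj x p1 = 2" "dist_adj x q1 = 2" "dist_adj x p2 = 2" "dist_adj x q2 = 2"
      "dist_adj x p3 = 2" "dist_adj x q3 = 2"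
    and dist: "distinct [p1, q1, p2, q2, p3, q3]"
    and pp: "dist_adj p1 p2 = 2" "dist_adj p1 p3 = 2" "dist_adj p2 p3 = 2"
    and qq: "dist_adj q1 q2 = 2" "dist_adj q1 q3 = 2" "dist_adj q2 q3 = 2"
  obtains ws where "labelling adj ([x, u1, u2, u3, p1, q1, p2, q2, p3, q3] @ ws)"
proof -
  have xu: "adj x u1" "adj x u2" "adj x u3" and ux: "adj u1 x" "adj u2 x" "adj u3 x"
    using u gdist_1_iff adj_sym by auto
  have mem_nbr: "adj a w \<longleftrightarrow> w \<in> S" if "{z. adj a z} = S" for a w S
    using that by blast
  have xne: "x \<noteq> p1" "x \<noteq> q1" "x \<noteq> p2" "x \<noteq> q2" "x \<noteq> p3" "x \<noteq> q3"
    using x2 by auto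
  have Nu: "{w. adj u1 w} = {x, p1, q1}" "{w. adj u2 w} = {x, p2, q2}" "{w. adj u3 w} = {x, p3, q3}"
    using neighbours_eq[OF ux(1) up(1,2)] neighbours_eq[OF ux(2) up(3,4)]
      neighbours_eq[OF ux(3) up(5,6)] dist xne by simp_all
  have adju: "adj u1 w \<longleftrightarrow> w \<in> {x, p1, q1}" "adj u2 w \<longleftrightarrow> w \<in> {x, p2, q2}"
    "adj u3 w \<longleftrightarrow> w \<in> {x, p3, q3}" for w
    using Nu[THEN mem_nbr] by simp_all
  have une: "u1 \<noteq> u2" "u1 \<noteq> u3" "u2 \<noteq> u3"
    using adju[of p1] adju[of p2] dist xne by auto
  have Nx: "{w. adj x w} = {u1, u2, u3}"
    using une by (intro neighbours_eq xu)
  note np = no_common_parent[OF u(1) Nu(1)] no_common_parent[OF u(2) Nu(2)]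
    no_common_parent[OF u(1), of q1 p1] no_common_parent[OF u(2), of q2 p2]
  obtain P3 t3 where P3: "dist_adj x P3 = 3" "adj P3 p1" "adj P3 p2" "adj P3 t3" "dist_adj x t3 = 4"
    "{z. adj P3 z} = {p1, p2, t3}"
    using third_level_vertex[OF x2(1,3) pp(1)] np(1)[OF x2(1,3)] dist by (metis distinct_length_2_or_more)
  obtain P2 t2 where P2: "dist_adj x P2 = 3" "adj P2 p1" "adj P2 p3" "adj P2 t2" "dist_adj x t2 = 4"
    "{z. adj P2 z} = {p1, p3, t2}"
    using third_level_vertex[OF x2(1,5) pp(2)] np(1)[OF x2(1,5)] dist by (metis distinct_length_2_or_more)
  obtain P1 t1 where P1: "dist_adj x P1 = 3" "adj P1 p2" "adj P1 p3" "adj P1 t1" "dist_adj x t1 = 4"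
    "{z. adj P1 z} = {p2, p3, t1}"
    using third_level_vertex[OF x2(3,5) pp(3)] np(2)[OF x2(3,5)] dist by (metis distinct_length_2_or_more)
  have Nu': "{w. adj u1 w} = {x, q1, p1}" "{w. adj u2 w} = {x, q2, p2}"
    using Nu by auto
  obtain Q3 s3 where Q3: "dist_adj x Q3 = 3" "adj Q3 q1" "adj Q3 q2" "adj Q3 s3" "dist_adj x s3 = 4"
    "{z. adj Q3 z} = {q1, q2, s3}"
    using third_level_vertex[OF x2(2,4) qq(1)] np(3)[OF Nu'(1) x2(2,4)] dist by (metis distinct_length_2_or_more)
  obtain Q2 s2 where Q2: "dist_adj x Q2 = 3" "adj Q2 q1" "adj Q2 q3" "adj Q2 s2" "dist_adj x s2 = 4"
    "{z. adj Q2 z} = {q1, q3, s2}"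
    using third_level_vertex[OF x2(2,6) qq(2)] np(3)[OF Nu'(1) x2(2,6)] dist by (metis distinct_length_2_or_more)
  obtain Q1 s1 where Q1: "dist_adj x Q1 = 3" "adj Q1 q2" "adj Q1 q3" "adj Q1 s1" "dist_adj x s1 = 4"
    "{z. adj Q1 z} = {q2, q3, s1}"
    using third_level_vertex[OF x2(4,6) qq(3)] np(4)[OF Nu'(2) x2(4,6)] dist by (metis distinct_length_2_or_more)
  have nu: "\<not> adj u1 p2" "\<not> adj u1 p3" "\<not> adj u2 p1" "\<not> adj u2 p3" "\<not> adj u3 p1" "\<not> adj u3 p2"
    "\<not> adj u1 q2" "\<not> adj u1 q3" "\<not> adj u2 q1" "\<not> adj u2 q3" "\<not> adj u3 q1" "\<not> adj u3 q2"
    using dist xne by (auto simp: adju)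
  have anti: "dist_adj u1 t1 = 5" "dist_adj u2 t2 = 5" "dist_adj u3 t3 = 5"
    using antipode_in_fourth_level[OF u(1) nu(1,2) x2(3,5) P1(1,6,5)]
      antipode_in_fourth_level[OF u(2) nu(3,4) x2(1,5) P2(1,6,5)]
      antipode_in_fourth_level[OF u(3) nu(5,6) x2(1,3) P3(1,6,5)] by auto
  moreover have "dist_adj u1 s1 = 5" "dist_adj u2 s2 = 5" "dist_adj u3 s3 = 5"
    using antipode_in_fourth_level[OF u(1) nu(7,8) x2(4,6) Q1(1,6,5)]
      antipode_in_fourth_level[OF u(2) nu(9,10) x2(2,6) Q2(1,6,5)]
      antipode_in_fourth_level[OF u(3) nu(11,12) x2(2,4) Q3(1,6,5)] by auto
  \<comment> \<open>\<open>t1\<close> and \<open>s1\<close> are both antipodes of \<open>u1\<close>,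
    and likewise for the other indices; this is what joins the p half to the q half.\<close>
  ultimately have s: "s1 = t1" "s2 = t2" "s3 = t3"
    using antipode_unique by blast+
  \<comment> \<open>Distance is symmetric, so a coincidence would give one vertex two
    antipodes.\<close>
  have tne: "t1 \<noteq> t2" "t1 \<noteq> t3" "t2 \<noteq> t3"
    using anti une antipode_unique gdist_commute by metis+
  have tq: "t \<noteq> p1 \<and> t \<noteq> q1 \<and> t \<noteq> p2 \<and> t \<noteq> q2 \<and> t \<noteq> p3 \<and> t \<noteq> q3" if "dist_adj x t = 4" for t
    using x2 that by auto
  note tne' = tq[OF P1(5)] tq[OF P2(5)] tq[OF P3(5)]
  have adjP: "adj P1 w \<longleftrightarrow> w \<in> {p2, p3, t1}" "adj P2 w \<longleftrightarrow> w \<in> {p1, p3, t2}" "adj P3 w \<longleftrightarrow> w \<in> {p1, p2, t3}"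
    "adj Q1 w \<longleftrightarrow> w \<in> {q2, q3, t1}" "adj Q2 w \<longleftrightarrow> w \<in> {q1, q3, t2}" "adj Q3 w \<longleftrightarrow> w \<in> {q1, q2, t3}" for w
    using P1(6)[THEN mem_nbr] P2(6)[THEN mem_nbr] P3(6)[THEN mem_nbr] Q1(6)[THEN mem_nbr]
      Q2(6)[THEN mem_nbr] Q3(6)[THEN mem_nbr] unfolding s by simp_all
  have dP: "distinct [P1, Q1, P2, Q2, P3, Q3]"
  proof -
    have "\<not> adj P1 p1" "adj P1 p2" "adj P2 p1" "\<not> adj P2 p2" "adj P3 p1" "adj P3 p2"
      "\<not> adj Q1 p1" "\<not> adj Q1 p2" "\<not> adj Q2 p1" "\<not> adj Q2 p2" "\<not> adj Q3 p1" "\<not> adj Q3 p2"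
      "\<not> adj Q1 q1" "adj Q1 q2" "adj Q2 q1" "\<not> adj Q2 q2" "adj Q3 q1" "adj Q3 q2"
      using dist tne' unfolding adjP by auto
    then show ?thesis
      by auto
  qed
  have down: "adj p1 u1" "adj q1 u1" "adj p2 u2" "adj q2 u2" "adj p3 u3" "adj q3 u3"
    "adj p2 P1" "adj p3 P1" "adj p1 P2" "adj p3 P2" "adj p1 P3" "adj p2 P3"
    "adj q2 Q1" "adj q3 Q1" "adj q1 Q2" "adj q3 Q2" "adj q1 Q3" "adj q2 Q3"
    "adj t1 P1" "adj t1 Q1" "adj t2 P2" "adj t2 Q2" "adj t3 P3" "adj t3 Q3"
    by (rule adj_sym, simp add: adju adjP)+
  have uP: "u \<noteq> w" if "dist_adj x u = 1" "dist_adj x w = 3" for u w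
    using that by auto
  have Np: "{w. adj p1 w} = {u1, P2, P3}" "{w. adj p2 w} = {u2, P1, P3}" "{w. adj p3 w} = {u3, P1, P2}"
    "{w. adj q1 w} = {u1, Q2, Q3}" "{w. adj q2 w} = {u2, Q1, Q3}" "{w. adj q3 w} = {u3, Q1, Q2}"
    using neighbours_eq[OF down(1,9,11)] neighbours_eq[OF down(3,7,12)] neighbours_eq[OF down(5,8,10)]
      neighbours_eq[OF down(2,15,17)] neighbours_eq[OF down(4,13,18)] neighbours_eq[OF down(6,14,16)]
      dP uP[OF u(1)] uP[OF u(2)] uP[OF u(3)] P1(1) P2(1) P3(1) Q1(1) Q2(1) Q3(1) by simp_all
  have ex5: "\<exists>y. adj t y \<and> dist_adj x y = 5" if "dist_adj x t = 4" for t
  proof -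
    have "card {w. adj t w \<and> dist_adj x w = 5} = 1"
      using card_up[of x t 4] that by (simp add: numeral_eq_Suc)
    then have "{w. adj t w \<and> dist_adj x w = 5} \<noteq> {}"
      by force
    then show ?thesis
      by blast
  qed
  obtain y where y: "adj t1 y" "dist_adj x y = 5"
    using ex5 P1(5) by blast
  \<comment> \<open>Each \<open>t\<close> has a neighbour in layer 5, and that layer has a single
    vertex.\<close>
  have yt: "adj t2 y" "adj t3 y"
    using ex5[OF P2(5)] ex5[OF P3(5)] antipode_unique[OF y(2)] by blast+
  have Py: "w \<noteq> y" if "dist_adj x w = 3" for w
    using that y by auto
  have Nt: "{w. adj t1 w} = {P1, Q1, y}" "{w. adj t2 w} = {P2, Q2, y}" "{w. adj t3 w} = {P3, Q3, y}"
    using neighbours_eq[OF down(19,20) y(1)] neighbours_eq[OF down(21,22) yt(1)]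
      neighbours_eq[OF down(23,24) yt(2)] dP Py P1(1) P2(1) P3(1) Q1(1) Q2(1) Q3(1) by simp_all
  have Ny: "{w. adj y w} = {t1, t2, t3}"
    using tne by (intro neighbours_eq adj_sym[OF y(1)] adj_sym[OF yt(1)] adj_sym[OF yt(2)])
  let ?ws = "[P1, Q1, P2, Q2, P3, Q3, t1, t2, t3, y]"
  let ?vs = "[x, u1, u2, u3, p1, q1, p2, q2, p3, q3] @ ?ws"
  have layers: "map (dist_adj x) ?vs = layer"
    by (simp add: layer_def u[simplified] x2 P1(1,5) P2(1,5) P3(1,5) Q1(1) Q2(1) Q3(1) y)
  have apart: "a \<noteq> c" if "dist_adj x a \<noteq> dist_adj x c" for a c
    using that by auto
  have dvs: "distinct ?vs"
  proof -
    have "distinct [x]" "distinct [u1, u2, u3]" "distinct [t1, t2, t3]" "distinct [y]"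
      using une tne by auto
    moreover have "(\<forall>a\<in>set [x]. dist_adj x a = 0) \<and> (\<forall>a\<in>set [u1, u2, u3]. dist_adj x a = 1) \<and>
      (\<forall>a\<in>set [p1, q1, p2, q2, p3, q3]. dist_adj x a = 2) \<and>
      (\<forall>a\<in>set [P1, Q1, P2, Q2, P3, Q3]. dist_adj x a = 3) \<and>
      (\<forall>a\<in>set [t1, t2, t3]. dist_adj x a = 4) \<and> (\<forall>a\<in>set [y]. dist_adj x a = 5)"
      using u x2 P1(1,5) P2(1,5) P3(1,5) Q1(1) Q2(1) Q3(1) y(2) by simp
    ultimately have "distinct ([x] @ [u1, u2, u3] @ [p1, q1, p2, q2, p3, q3] @
        [P1, Q1, P2, Q2, P3, Q3] @ [t1, t2, t3] @ [y])"
      using dist dP unfolding distinct_append set_append by fastforce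
    then show ?thesis
      by simp
  qed
  have "card (set ?vs) = CARD('v)"
    unfolding distinct_card[OF dvs] using desargues by (simp add: desargues_graph_def)
  then have "set ?vs = UNIV"
    by (intro card_subset_eq) auto
  moreover have "\<forall>i<20. {w. adj (?vs ! i) w} = (!) ?vs ` set (nbr_table ! i)"
    unfolding all_less_20 using Nx Nu Np Nt Ny P1(6) P2(6) P3(6) Q1(6) Q2(6) Q3(6)
    by (simp add: nbr_table_def s)
  moreover have "\<forall>i<20. dist_adj (?vs ! 0) (?vs ! i) = layer ! i"
    unfolding layers[symmetric] all_less_20 by simp
  ultimately have "labelling adj ?vs"
    using dvs unfolding labelling_def by simp
  then show thesis
    using that by blast
qed

text \<open>The given order is preserved: \<open>ys\<close> occupies the labels 4 to 9, so essential
  parts with respect to \<open>ys\<close> are read off from label coordinates.\<close>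

lemma admissible_labelling:
  assumes "admissible_order2 adj x ys"
  obtains u1 u2 u3 ws where "labelling adj ([x, u1, u2, u3] @ ys @ ws)"
proof -
  obtain p1 q1 p2 q2 p3 q3 where ys: "ys = [p1, q1, p2, q2, p3, q3]"
    using assms by (auto simp: admissible_order2_def length_Suc_conv numeral_eq_Suc)
  then have set: "{p1, q1, p2, q2, p3, q3} = {z. dist_adj x z = 2}" and dist: "distinct [p1, q1, p2, q2, p3, q3]"
    using assms by (auto simp: admissible_order2_def ordering_of_def sphere_at_def)
  have "dist_adj x p1 = 2" "dist_adj x q1 = 2" "dist_adj x p2 = 2" "dist_adj x q2 = 2"
      "dist_adj x p3 = 2" "dist_adj x q3 = 2"
    using set by blast+
  moreover have "dist_adj p1 p2 = 2" "dist_adj p1 p3 = 2" "dist_adj p2 p3 = 2"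
    "dist_adj q1 q2 = 2" "dist_adj q1 q3 = 2" "dist_adj q2 q3 = 2"
    using assms ys by (simp_all add: admissible_order2_def)
  moreover obtain u1 u2 u3 where "dist_adj x u1 = 1" "adj u1 p1" "adj u1 q1"
    "dist_adj x u2 = 1" "adj u2 p2" "adj u2 q2" "dist_adj x u3 = 1" "adj u3 p3" "adj u3 q3"
    using assms ys by (auto simp: admissible_order2_def sphere_at_def)
  ultimately obtain ws where "labelling adj ([x, u1, u2, u3, p1, q1, p2, q2, p3, q3] @ ws)"
    using ex_labelling[of x u1 u2 u3 p1 q1 p2 q2 p3 q3] dist by blast
  then show thesis
    using that[of u1 u2 u3 ws] ys by simp
qed

text \<open>This excludes the hexagon. Otherwise \<open>p2\<close> is at distance 2 from
  \<open>q3\<close> and at distance 4 from \<open>p3\<close>, while all three neighbours of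
  \<open>p2\<close> are within distance 3 of \<open>p3\<close>, against b_4 = 1.\<close>

lemma triangle_closes:
  assumes x2: "dist_adj x p1 = 2" "dist_adj x p2 = 2" "dist_adj x p3 = 2" "dist_adj x q3 = 2"
    and u2: "dist_adj x u2 = 1" "adj u2 p2" "\<not> adj u2 p1" "\<not> adj u2 p3" "\<not> adj u2 q3"
    and u3: "dist_adj x u3 = 1" "{w. adj u3 w} = {x, p3, q3}"
    and ne: "p2 \<noteq> p3" "p2 \<noteq> q3" "p1 \<noteq> p3" "p1 \<noteq> q3" "p3 \<noteq> q3"
    and d: "dist_adj p1 p2 = 2" "dist_adj p1 p3 = 2"
  shows "dist_adj p2 p3 = 2"
proof (rule ccontr)
  assume n2: "dist_adj p2 p3 \<noteq> 2"
  have nu3: "\<not> adj u3 p2"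
  proof
    assume "adj u3 p2"
    then have "p2 \<in> {x, p3, q3}"
      using u3(2) by blast
    then show False
      using ne x2(2) by auto
  qed
  have d23: "dist_adj p2 q3 = 2"
    using opposite_child[OF x2(2) u3(1) nu3 u3(2) ne(5) x2(3,4)] n2 by simp
  have up3: "adj p3 u3" "adj q3 u3"
    using u3(2) adj_sym by blast+
  have np: "False" if "dist_adj x u = 1" "adj u p2" "adj u p1 \<or> adj u q3" for u
    using parent_unique[OF x2(2) adj_sym[OF u2(2)] u2(1) adj_sym[OF that(2)] that(1)] u2 that by auto
  obtain a t where a: "dist_adj x a = 3" "adj a p1" "adj a p2" "adj a t" "dist_adj x t = 4" "{z. adj a z} = {p1, p2, t}"
    using third_level_vertex[OF x2(1,2) d(1)] np by blast
  obtain b s where b: "dist_adj x b = 3" "adj b p2" "adj b q3" "adj b s" "dist_adj x s = 4" "{z. adj b z} = {p2, q3, s}"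
    using third_level_vertex[OF x2(2,4) d23] np by blast
  have "q3 \<noteq> t"
    using x2 a by auto
  then have "\<not> adj a q3"
    using a(6) ne by auto
  then have "a \<noteq> b"
    using b(3) by auto
  moreover have "u2 \<noteq> a" "u2 \<noteq> b"
    using a(1) b(1) u2(1) by auto
  ultimately have N: "{w. adj p2 w} = {u2, a, b}"
    by (intro neighbours_eq adj_sym[OF u2(2)] adj_sym[OF a(3)] adj_sym[OF b(2)])
  \<comment> \<open>The short walks from \<open>p3\<close> pass through \<open>x\<close>,
    \<open>p1\<close> and \<open>q3\<close>, respectively.\<close>
  have near: "dist_adj p3 u2 \<le> 3" "dist_adj p3 a \<le> 3" "dist_adj p3 b \<le> 3"
  proof -
    have "dist_adj p3 x = 2" "dist_adj p3 p1 = 2" "adj x u2"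
      using x2(3) d(2) u2(1) gdist_1_iff[of x u2] gdist_commute[of x p3] gdist_commute[of p1 p3] by auto
    then show "dist_adj p3 u2 \<le> 3" "dist_adj p3 a \<le> 3"
      using gdist_adj_le[of x u2 p3] gdist_adj_le[OF adj_sym[OF a(2)], of p3] by auto
    have "dist_adj p3 u3 \<le> 1"
      using gdist_adj_le[OF up3(1), of p3] by simp
    then have "dist_adj p3 q3 \<le> 2"
      using gdist_adj_le[OF adj_sym[OF up3(2)], of p3] by simp
    then show "dist_adj p3 b \<le> 3"
      using gdist_adj_le[OF adj_sym[OF b(3)], of p3] by simp
  qed
  have pu: "dist_adj p3 u2 = 3"
  proof -
    have "dist_adj p3 u2 \<noteq> 1"
      using u2(4) gdist_1_iff adj_sym by blast
    moreover have "dist_adj p3 x = 2" "adj x u2"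
      using x2(3) u2(1) gdist_1_iff[of x u2] gdist_commute[of x p3] by auto
    ultimately show ?thesis
      using bipartite[of x u2 p3] by auto
  qed
  have "dist_adj p3 p2 \<noteq> 2"
    using n2 gdist_commute by metis
  then have "dist_adj p3 p2 = 4"
    using bipartite[OF u2(2), of p3] pu by auto
  then have "card {w. adj p2 w \<and> dist_adj p3 w = 5} = 1"
    using card_up[of p3 p2 4] by (simp add: numeral_eq_Suc)
  then obtain w where "w \<in> {w. adj p2 w}" "dist_adj p3 w = 5"
    by (auto simp: card_1_singleton_iff)
  then show False
    using near unfolding N by auto
qed

text \<open>The names are fixed by \<open>p1\<close>: exactly one child of each of \<open>u2\<close>
  and \<open>u3\<close> is at distance 2 from it, and that child is called \<open>p2\<close> or
  \<open>p3\<close>. This also keeps the statement about all orders from being vacuous.\<close>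

lemma ex_admissible: "\<exists>ys. admissible_order2 adj x ys"
proof -
  have "card {u. adj x u} = 3"
    by (rule degree)
  then obtain u1 u2 u3 where N: "{u. adj x u} = {u1, u2, u3}" and une: "u1 \<noteq> u2" "u1 \<noteq> u3" "u2 \<noteq> u3"
    by (auto simp: card_3_iff)
  have u: "dist_adj x u1 = 1" "dist_adj x u2 = 1" "dist_adj x u3 = 1"
    unfolding gdist_1_iff using N by blast+
  obtain p1 q1 where 1: "p1 \<noteq> q1" "dist_adj x p1 = 2" "dist_adj x q1 = 2" "{w. adj u1 w} = {x, p1, q1}"
    using children[OF u(1)] by blast
  have split: thesis if v: "dist_adj x v = 1" "\<not> adj v p1"
    and *: "\<And>p q. \<lbrakk>p \<noteq> q; dist_adj x p = 2; dist_adj x q = 2; {w. adj v w} = {x, p, q}; dist_adj p1 p = 2;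
      dist_adj p1 q \<noteq> 2\<rbrakk> \<Longrightarrow> thesis" for v thesis
  proof -
    obtain a b where ab: "a \<noteq> b" "dist_adj x a = 2" "dist_adj x b = 2" "{w. adj v w} = {x, a, b}"
      using children[OF v(1)] by blast
    show ?thesis
      using opposite_child[OF 1(2) v ab(4,1-3)] *[OF ab] *[of b a] ab
      by (auto simp: insert_commute)
  qed
  have mem: "adj v w \<longleftrightarrow> w \<in> S" if "{w. adj v w} = S" for v w S
    using that by blast
  have child_unique: "v = v'" if "dist_adj x w = 2" "adj v w" "adj v' w" "dist_adj x v = 1" "dist_adj x v' = 1" for v v' w
    using parent_unique that adj_sym by blast
  have up1: "adj u1 p1" "adj u1 q1"
    using 1 by blast+
  have nu1: "\<not> adj u2 p1" "\<not> adj u3 p1" "\<not> adj u2 q1" "\<not> adj u3 q1"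
    using child_unique[OF 1(2) up1(1) _ u(1)] child_unique[OF 1(3) up1(2) _ u(1)] u une by blast+
  obtain p2 q2 where 2: "p2 \<noteq> q2" "dist_adj x p2 = 2" "dist_adj x q2 = 2" "{w. adj u2 w} = {x, p2, q2}"
    "dist_adj p1 p2 = 2" "dist_adj p1 q2 \<noteq> 2"
    using split[OF u(2) nu1(1)] by metis
  obtain p3 q3 where 3: "p3 \<noteq> q3" "dist_adj x p3 = 2" "dist_adj x q3 = 2" "{w. adj u3 w} = {x, p3, q3}"
    "dist_adj p1 p3 = 2" "dist_adj p1 q3 \<noteq> 2"
    using split[OF u(3) nu1(2)] by metis
  have up: "adj u2 p2" "adj u2 q2" "adj u3 p3" "adj u3 q3"
    using 2 3 by blast+
  have nu: "\<not> adj u1 p2" "\<not> adj u1 q2" "\<not> adj u3 p2" "\<not> adj u3 q2"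
    "\<not> adj u1 p3" "\<not> adj u1 q3" "\<not> adj u2 p3" "\<not> adj u2 q3"
    using child_unique[OF 2(2) up(1) _ u(2)] child_unique[OF 2(3) up(2) _ u(2)]
      child_unique[OF 3(2) up(3) _ u(3)] child_unique[OF 3(3) up(4) _ u(3)] u une by metis+
  have dist: "distinct [p1, q1, p2, q2, p3, q3]"
    using 1(1) 2(1) 3(1) up1 up nu nu1 by auto
  have pp: "dist_adj p2 p3 = 2"
    by (rule triangle_closes[OF 1(2) 2(2) 3(2,3) u(2) up(1) nu1(1) nu(7,8) u(3) 3(4)])
      (use dist 2(5) 3(5) in auto)
  have comm: "dist_adj y z = 2 \<longleftrightarrow> dist_adj z y = 2" for y z
    by (simp add: gdist_commute)
  have q12: "dist_adj q1 q2 = 2"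
    using opposite_child[OF 2(3) u(1) nu(2) 1(4,1-3)] 2(6) comm by blast
  have q13: "dist_adj q1 q3 = 2"
    using opposite_child[OF 3(3) u(1) nu(6) 1(4,1-3)] 3(6) comm by blast
  \<comment> \<open>\<open>p3\<close> is at distance 2 from \<open>p2\<close>, hence not from
    \<open>q2\<close>; so \<open>q2\<close> is at distance 2 from the other child of
    \<open>u3\<close>.\<close>
  have q23: "dist_adj q2 q3 = 2"
    using opposite_child[OF 3(2) u(2) nu(7) 2(4,1-3)] opposite_child[OF 2(3) u(3) nu(4) 3(4,1-3)] pp comm by blast
  have "{z. dist_adj x z = 2} \<subseteq> {p1, q1, p2, q2, p3, q3}"
  proof
    fix z assume "z \<in> {z. dist_adj x z = 2}"
    then have z: "dist_adj x z = Suc 1"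
      by simp
    obtain v where v: "adj z v" "dist_adj x v = 1"
      using gdist_Suc_neighbour[OF z] by blast
    then have "v \<in> {u1, u2, u3}"
      using N gdist_1_iff by blast
    then have "z \<in> {x, p1, q1} \<or> z \<in> {x, p2, q2} \<or> z \<in> {x, p3, q3}"
      using adj_sym[OF v(1)] mem[OF 1(4)] mem[OF 2(4)] mem[OF 3(4)] by blast
    then show "z \<in> {p1, q1, p2, q2, p3, q3}"
      using z by auto
  qed
  then have "{z. dist_adj x z = 2} = {p1, q1, p2, q2, p3, q3}"
    using 1 2 3 by blast
  then have "admissible_order2 adj x [p1, q1, p2, q2, p3, q3]"
    unfolding admissible_order2_def ordering_of_def sphere_at_def
    using dist up up1 u 2(5) 3(5) pp q12 q13 q23 by auto
  then show ?thesis
    by blast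
qed

end

section \<open>Blocks of the Terwilliger algebra\<close>

lemma matrix_subalgebra_terwilliger: "matrix_subalgebra (terwilliger adj x)"
  unfolding terwilliger_def
  by (rule hull_in) (auto simp: matrix_subalgebra_def intro: cmat.subspace_Inter)

lemma adj_matrix_in_terwilliger: "adj_matrix adj \<in> terwilliger adj x"
  unfolding terwilliger_def by (rule hull_inc) simp

lemma Estar_in_terwilliger: "k \<le> gdiam adj \<Longrightarrow> Estar adj x k \<in> terwilliger adj x"
  unfolding terwilliger_def by (rule hull_inc) simp

lemma matrix_subalgebra_diff: "matrix_subalgebra S \<Longrightarrow> B \<in> S \<Longrightarrow> C \<in> S \<Longrightarrow> B - C \<in> S"
  unfolding matrix_subalgebra_def by (simp add: cmat.subspace_diff)

lemma matrix_subalgebra_mult: "matrix_subalgebra S \<Longrightarrow> B \<in> S \<Longrightarrow> C \<in> S \<Longrightarrow> B ** C \<in> S"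
  unfolding matrix_subalgebra_def by simp

lemma Estar_mult_vec: "(Estar adj x k *v v) $ y = (if gdist adj x y = k then v $ y else 0)"
  by (cases "gdist adj x y = k")
    (simp_all add: matrix_vector_mult_def Estar_def if_distrib[of "\<lambda>a. a * _"] cong: if_cong)

text \<open>Closure of this shape under the algebra operations lets it pass from the generators to
  the whole hull; products correspond to matrix products of the coefficients.\<close>

lemma matrix_subalgebra_blockwise:
  fixes b :: "nat \<Rightarrow> nat \<Rightarrow> complex ^ 'v::finite"
  shows "matrix_subalgebra {B. \<exists>c. \<forall>s<n. \<forall>j<d (ty s :: nat).
    B *v b s j = (\<Sum>i<d (ty s). c (ty s) i j *s b s i)}" (is "matrix_subalgebra ?S")
  unfolding matrix_subalgebra_def
proof (intro conjI ballI)
  show "cmat.subspace ?S"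
  proof (rule cmat.subspaceI)
    show "0 \<in> ?S"
      by (auto intro!: exI[of _ "\<lambda>_ _ _. 0"])
  next
    fix B C assume "B \<in> ?S" "C \<in> ?S"
    then obtain c c' where
      "\<forall>s<n. \<forall>j<d (ty s). B *v b s j = (\<Sum>i<d (ty s). c (ty s) i j *s b s i)"
      "\<forall>s<n. \<forall>j<d (ty s). C *v b s j = (\<Sum>i<d (ty s). c' (ty s) i j *s b s i)"
      by blast
    then have "\<forall>s<n. \<forall>j<d (ty s). (B + C) *v b s j = (\<Sum>i<d (ty s). (c (ty s) i j + c' (ty s) i j) *s b s i)"
      by (simp add: matrix_vector_mult_add_rdistrib vec.scale_left_distrib sum.distrib)
    then show "B + C \<in> ?S"
      by (intro CollectI exI[of _ "\<lambda>l i j. c l i j + c' l i j"])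
  next
    fix a B assume "B \<in> ?S"
    then obtain c where "\<forall>s<n. \<forall>j<d (ty s). B *v b s j = (\<Sum>i<d (ty s). c (ty s) i j *s b s i)"
      by blast
    then have "\<forall>s<n. \<forall>j<d (ty s). cmat_scale a B *v b s j = (\<Sum>i<d (ty s). (a * c (ty s) i j) *s b s i)"
      by (simp add: cmat_scale_mult_vec vec.scale_sum_right)
    then show "cmat_scale a B \<in> ?S"
      by (intro CollectI exI[of _ "\<lambda>l i j. a * c l i j"])
  qed
  have "(\<Sum>i<d (ty s). (if i = j then 1 else 0) *s b s i) = b s j" if "j < d (ty s)" for s j
  proof -
    have "(\<Sum>i<d (ty s). (if i = j then 1 else 0) *s b s i) = (\<Sum>i<d (ty s). if i = j then b s j else 0)"
      by (rule sum.cong) auto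
    then show ?thesis
      using that by simp
  qed
  then show "Finite_Cartesian_Product.mat 1 \<in> ?S"
    by (auto intro!: exI[of _ "\<lambda>_ i j. if i = j then 1 else 0"])
  fix B C assume "B \<in> ?S" "C \<in> ?S"
  then obtain c c' where
    c: "\<forall>s<n. \<forall>j<d (ty s). B *v b s j = (\<Sum>i<d (ty s). c (ty s) i j *s b s i)"
    and c': "\<forall>s<n. \<forall>j<d (ty s). C *v b s j = (\<Sum>i<d (ty s). c' (ty s) i j *s b s i)"
    by blast
  have "(B ** C) *v b s j = (\<Sum>i<d (ty s). (\<Sum>k<d (ty s). c (ty s) i k * c' (ty s) k j) *s b s i)"
    if "s < n" "j < d (ty s)" for s j
  proof -
    have "(B ** C) *v b s j = (\<Sum>k<d (ty s). \<Sum>i<d (ty s). (c (ty s) i k * c' (ty s) k j) *s b s i)"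
      using that c c'
      by (simp add: matrix_vector_mul_assoc[symmetric] matrix_vector_mult_sum vec.scale_sum_right mult.commute)
    also have "\<dots> = (\<Sum>i<d (ty s). \<Sum>k<d (ty s). (c (ty s) i k * c' (ty s) k j) *s b s i)"
      by (rule sum.swap)
    finally show ?thesis
      by (simp add: vec.scale_sum_left)
  qed
  then show "B ** C \<in> ?S"
    by (intro CollectI exI[of _ "\<lambda>l i j. \<Sum>k<d l. c l i k * c' l k j"]) simp
qed

lemma (in orthogonal_blocks) coord_eqI:
  assumes "\<And>s i. s < n \<Longrightarrow> i < d (ty s) \<Longrightarrow> coord u s i = coord v s i"
  shows "u = v"
proof -
  have "u = (\<Sum>s<n. \<Sum>i<d (ty s). coord u s i *s b s i)"
    by (rule expand)
  also have "\<dots> = (\<Sum>s<n. \<Sum>i<d (ty s). coord v s i *s b s i)"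
    using assms by simp
  also have "\<dots> = v"
    by (rule expand[symmetric])
  finally show ?thesis .
qed

text \<open>A chain of type \<open>l\<close> has one vector in each of the layers from
  \<open>r l\<close> on. So \<open>Estar\<close> after \<open>A\<close> isolates a single entry of
  \<open>M\<close>, and the nonvanishing entries next to the diagonal allow a step up or down the
  chain.\<close>

locale ladder_blocks = orthogonal_blocks n ty d b
  for n :: nat and ty :: "nat \<Rightarrow> nat" and d :: "nat \<Rightarrow> nat"
    and b :: "nat \<Rightarrow> nat \<Rightarrow> complex ^ 'v::finite" +
  fixes adj :: "'v \<Rightarrow> 'v \<Rightarrow> bool" and x :: 'v
    and r :: "nat \<Rightarrow> nat" and M :: "nat \<Rightarrow> nat \<Rightarrow> nat \<Rightarrow> complex"
  assumes act: "\<And>s j. s < n \<Longrightarrow> j < d (ty s) \<Longrightarrow>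
      adj_matrix adj *v b s j = (\<Sum>i<d (ty s). M (ty s) i j *s b s i)"
    and layered: "\<And>s j k. s < n \<Longrightarrow> j < d (ty s) \<Longrightarrow>
      Estar adj x k *v b s j = (if k = r (ty s) + j then b s j else 0)"
    and fits: "\<And>s. s < n \<Longrightarrow> r (ty s) + d (ty s) \<le> Suc (gdiam adj)"
    and raise: "\<And>s i. s < n \<Longrightarrow> Suc i < d (ty s) \<Longrightarrow> M (ty s) (Suc i) i \<noteq> 0"
    and lower: "\<And>s i. s < n \<Longrightarrow> Suc i < d (ty s) \<Longrightarrow> M (ty s) i (Suc i) \<noteq> 0"
begin

abbreviation T where
  "T \<equiv> terwilliger adj x"

abbreviation A where
  "A \<equiv> adj_matrix adj"

lemma blockwise:
  assumes "B \<in> T"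
  shows "\<exists>c. \<forall>s<n. \<forall>j<d (ty s). B *v b s j = (\<Sum>i<d (ty s). c (ty s) i j *s b s i)"
proof -
  let ?S = "{B. \<exists>c. \<forall>s<n. \<forall>j<d (ty s). B *v b s j = (\<Sum>i<d (ty s). c (ty s) i j *s b s i)}"
  have "A \<in> ?S"
    using act by (intro CollectI exI[of _ M]) simp
  moreover have "Estar adj x k \<in> ?S" for k
  proof -
    have "Estar adj x k *v b s j = (\<Sum>i<d (ty s). (if i = j \<and> k = r (ty s) + j then 1 else 0) *s b s i)"
      if "s < n" "j < d (ty s)" for s j
    proof -
      have "(\<Sum>i<d (ty s). (if i = j \<and> k = r (ty s) + j then 1 else 0) *s b s i) =
          (\<Sum>i<d (ty s). if i = j then (if k = r (ty s) + j then b s j else 0) else 0)"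
        by (rule sum.cong) auto
      then show ?thesis
        using that layered by simp
    qed
    then show ?thesis
      by (intro CollectI exI[of _ "\<lambda>l i j. if i = j \<and> k = r l + j then 1 else 0"]) simp
  qed
  ultimately have "T \<subseteq> ?S"
    unfolding terwilliger_def
    by (intro hull_minimal matrix_subalgebra_blockwise) auto
  then show ?thesis
    using assms by blast
qed

definition is_unit :: "complex ^ 'v ^ 'v \<Rightarrow> nat \<Rightarrow> nat \<Rightarrow> nat \<Rightarrow> bool" where
  "is_unit E l i j \<longleftrightarrow> E \<in> T \<and>
     (\<forall>s<n. \<forall>k<d (ty s). E *v b s k = (if ty s = l \<and> k = j then b s i else 0))"

lemma layer_act:
  assumes "s < n" "i < d (ty s)" "j < d (ty s)"
  shows "Estar adj x (r (ty s) + i) *v (A *v b s j) = M (ty s) i j *s b s i"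
proof -
  have "Estar adj x (r (ty s) + i) *v (A *v b s j) =
      (\<Sum>k<d (ty s). if k = i then M (ty s) i j *s b s i else 0)"
    unfolding act[OF assms(1,3)] matrix_vector_mult_sum
    by (rule sum.cong) (use assms layered in auto)
  then show ?thesis
    using assms by simp
qed

text \<open>\<open>E\<close> ends in vector number \<open>i\<close>; \<open>A\<close> followed by
  the projection to the next layer makes it \<open>M (ty s0) (Suc i) i\<close> times vector number
  \<open>Suc i\<close>, and other types are already killed by \<open>E\<close>.\<close>

lemma is_unit_raise:
  assumes E: "is_unit E (ty s0) i j" and s0: "s0 < n" "Suc i < d (ty s0)"
  shows "is_unit (cmat_scale (inverse (M (ty s0) (Suc i) i)) (Estar adj x (r (ty s0) + Suc i) ** (A ** E)))
    (ty s0) (Suc i) j"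
  unfolding is_unit_def
proof (intro conjI allI impI)
  have "r (ty s0) + Suc i \<le> gdiam adj"
    using fits[OF s0(1)] s0(2) by simp
  then show "cmat_scale (inverse (M (ty s0) (Suc i) i)) (Estar adj x (r (ty s0) + Suc i) ** (A ** E)) \<in> T"
    using E matrix_subalgebra_terwilliger
    by (auto simp: is_unit_def intro!: matrix_subalgebra_scale matrix_subalgebra_mult
        adj_matrix_in_terwilliger Estar_in_terwilliger)
  fix s k assume s: "s < n" "k < d (ty s)"
  show "cmat_scale (inverse (M (ty s0) (Suc i) i)) (Estar adj x (r (ty s0) + Suc i) ** (A ** E)) *v b s k =
      (if ty s = ty s0 \<and> k = j then b s (Suc i) else 0)"
    using E s s0 layer_act[of s "Suc i" i] raise[OF s0]
    by (auto simp: cmat_scale_mult_vec matrix_vector_mul_assoc[symmetric] is_unit_def vector_smult_assoc)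
qed

text \<open>The right factor admits one layer only. From \<open>A\<close> applied to its vectors,
  \<open>E\<close> retains the component at place \<open>j\<close> and kills every other type that
  meets this layer.\<close>

lemma is_unit_lower:
  assumes E: "is_unit E (ty s0) i j" and s0: "s0 < n" "Suc j < d (ty s0)"
  shows "is_unit (cmat_scale (inverse (M (ty s0) j (Suc j))) (E ** (A ** Estar adj x (r (ty s0) + Suc j))))
    (ty s0) i (Suc j)"
  unfolding is_unit_def
proof (intro conjI allI impI)
  have "r (ty s0) + Suc j \<le> gdiam adj"
    using fits[OF s0(1)] s0(2) by simp
  then show "cmat_scale (inverse (M (ty s0) j (Suc j))) (E ** (A ** Estar adj x (r (ty s0) + Suc j))) \<in> T"
    using E matrix_subalgebra_terwilliger
    by (auto simp: is_unit_def intro!: matrix_subalgebra_scale matrix_subalgebra_mult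
        adj_matrix_in_terwilliger Estar_in_terwilliger)
  fix s k assume s: "s < n" "k < d (ty s)"
  have EA: "E *v (A *v b s k) = (if ty s = ty s0 then M (ty s) j k *s b s i else 0)"
  proof -
    have "E *v (A *v b s k) = (\<Sum>m<d (ty s). if m = j then (if ty s = ty s0 then M (ty s) j k *s b s i else 0) else 0)"
      unfolding act[OF s] matrix_vector_mult_sum
      by (rule sum.cong) (use E s in \<open>auto simp: is_unit_def\<close>)
    also have "\<dots> = (if ty s = ty s0 then M (ty s) j k *s b s i else 0)"
      using s0 by auto
    finally show ?thesis .
  qed
  show "cmat_scale (inverse (M (ty s0) j (Suc j))) (E ** (A ** Estar adj x (r (ty s0) + Suc j))) *v b s k =
      (if ty s = ty s0 \<and> k = Suc j then b s i else 0)"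
    using EA s s0 lower[OF s0] layered[OF s]
    by (auto simp: cmat_scale_mult_vec matrix_vector_mul_assoc[symmetric] vector_smult_assoc)
qed

text \<open>The inner induction fills row 0 by \<open>is_unit_lower\<close>; the outer one descends
  from it by \<open>is_unit_raise\<close>.\<close>

lemma all_units:
  assumes E: "is_unit E (ty s0) 0 0" and s0: "s0 < n"
  shows "i < d (ty s0) \<Longrightarrow> j < d (ty s0) \<Longrightarrow> \<exists>E. is_unit E (ty s0) i j"
proof (induction i)
  case 0
  then show ?case
  proof (induction j)
    case (Suc j)
    then show ?case
      using is_unit_lower[OF _ s0] Suc_lessD by blast
  qed (use E in blast)
next
  case (Suc i)
  then show ?case
    using is_unit_raise[OF _ s0] Suc_lessD by blast
qed

lemma block_algebraI:
  assumes "\<And>s. s < n \<Longrightarrow> \<exists>E. is_unit E (ty s) 0 0"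
  shows "block_algebra n ty d b T"
proof unfold_locales
  show "matrix_subalgebra T"
    by (rule matrix_subalgebra_terwilliger)
  show "\<exists>c. \<forall>s<n. \<forall>j<d (ty s). B *v b s j = (\<Sum>i<d (ty s). c (ty s) i j *s b s i)" if "B \<in> T" for B
    using blockwise[OF that] .
  show "\<exists>E\<in>T. \<forall>s'<n. \<forall>l<d (ty s'). E *v b s' l = (if ty s' = ty s \<and> l = j then b s' i else 0)"
    if s: "s < n" and ij: "i < d (ty s)" "j < d (ty s)" for s i j
  proof -
    obtain E where "is_unit E (ty s) 0 0"
      using assms[OF s] by blast
    from all_units[OF this s ij] show ?thesis
      unfolding is_unit_def by blast
  qed
qed

section \<open>Endpoint, shape, bases and eigenspaces of the chains\<close>

lemma Estar_image_block:
  assumes s: "s < n"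
  shows "(*v) (Estar adj x k) ` block s =
    (if r (ty s) \<le> k \<and> k < r (ty s) + d (ty s) then vec.span {b s (k - r (ty s))} else {0})"
proof -
  let ?S = "(\<lambda>j. if k = r (ty s) + j then b s j else 0) ` {..<d (ty s)}"
  have "(*v) (Estar adj x k) ` block s = vec.span ((*v) (Estar adj x k) ` b s ` {..<d (ty s)})"
    by (simp add: vec.span_image)
  also have "(*v) (Estar adj x k) ` b s ` {..<d (ty s)} = ?S"
    unfolding image_image by (rule image_cong) (use layered s in auto)
  finally have eq: "(*v) (Estar adj x k) ` block s = vec.span ?S" .
  show ?thesis
  proof (cases "r (ty s) \<le> k \<and> k < r (ty s) + d (ty s)")
    case True
    then have "?S \<subseteq> {0, b s (k - r (ty s))}"
      by auto
    moreover have "b s (k - r (ty s)) \<in> ?S"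
      by (rule image_eqI[of _ _ "k - r (ty s)"]) (use True in auto)
    ultimately have "vec.span ?S \<subseteq> vec.span {0, b s (k - r (ty s))}"
      "vec.span {b s (k - r (ty s))} \<subseteq> vec.span ?S"
      by (intro vec.span_mono; simp)+
    then have "vec.span ?S = vec.span {b s (k - r (ty s))}"
      by simp
    then show ?thesis
      using True eq by simp
  next
    case False
    then have zero: "?S = {0}"
      using size_pos[OF s] by auto
    show ?thesis
      unfolding eq zero if_not_P[OF False] by simp
  qed
qed

lemma module_support_block:
  assumes s: "s < n"
  shows "module_support adj x (block s) = {r (ty s)..<r (ty s) + d (ty s)}"
proof -
  have "vec.span {b s (k - r (ty s))} \<noteq> {0}" if "r (ty s) \<le> k" "k < r (ty s) + d (ty s)" for k
  proof
    assume "vec.span {b s (k - r (ty s))} = {0}"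
    moreover have "b s (k - r (ty s)) \<in> vec.span {b s (k - r (ty s))}"
      by (rule vec.span_base) simp
    moreover have "k - r (ty s) < d (ty s)"
      using that by simp
    ultimately show False
      using nonzero[OF s, of "k - r (ty s)"] by simp
  qed
  then show ?thesis
    unfolding module_support_def Estar_image_block[OF s] using fits[OF s]
    by (intro equalityI subsetI) (simp_all split: if_splits)
qed

lemma endpoint_block: "s < n \<Longrightarrow> endpoint adj x (block s) = r (ty s)"
  unfolding endpoint_def using size_pos[of s] by (auto simp: module_support_block intro!: Min_eqI)

lemma module_diameter_block: "s < n \<Longrightarrow> module_diameter adj x (block s) = d (ty s) - 1"
  unfolding module_diameter_def by (simp add: module_support_block)

lemma dim_layer_block:
  assumes "s < n" "j < d (ty s)"
  shows "vec.dim ((*v) (Estar adj x (r (ty s) + j)) ` block s) = 1"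
  using assms nonzero[OF assms] by (simp add: Estar_image_block vec.dim_eq_card_independent)

lemma module_shape_block:
  assumes s: "s < n"
  shows "module_shape adj x (block s) = replicate (d (ty s)) 1"
proof -
  have "vec.dim ((*v) (Estar adj x i) ` block s) = 1" if "r (ty s) \<le> i" "i < r (ty s) + d (ty s)" for i
    using dim_layer_block[OF s, of "i - r (ty s)"] that by simp
  then show ?thesis
    unfolding module_shape_def endpoint_block[OF s] module_diameter_block[OF s]
    using size_pos[OF s] by (intro replicate_eqI) auto
qed

lemma dim_block: "s < n \<Longrightarrow> vec.dim (block s) = d (ty s)"
  using independent_block[of s] by (simp add: vec.dim_eq_card_independent card_image)

lemma pure_block:
  assumes "s < n" "j < d (ty s)"
  shows "pure adj x (r (ty s) + j) (b s j)"
proof -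
  have "b s j = Estar adj x (r (ty s) + j) *v b s j"
    using layered[OF assms] by simp
  then show ?thesis
    unfolding pure_def using nonzero[OF assms] by blast
qed

lemma pure_basis_block:
  assumes s: "s < n"
  shows "pure_basis adj x (block s) (map (b s) [0..<d (ty s)])"
proof -
  have 1: "sorted [r (ty s)..<r (ty s) + d (ty s)]"
    by simp
  have 2: "list_all2 (pure adj x) [r (ty s)..<r (ty s) + d (ty s)] (map (b s) [0..<d (ty s)])"
    using pure_block[OF s] by (simp add: list_all2_conv_all_nth)
  show ?thesis
    unfolding pure_basis_def using independent_block[OF s] 1 2
    by (intro conjI exI[of _ "[r (ty s)..<r (ty s) + d (ty s)]"]) (simp_all add: distinct_map atLeast0LessThan)
qed

lemma represents_block:
  assumes s: "s < n" and B: "B \<in> carrier_mat (d (ty s)) (d (ty s))"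
    "\<And>i j. i < d (ty s) \<Longrightarrow> j < d (ty s) \<Longrightarrow> B $$ (i, j) = M (ty s) i j"
  shows "represents B A (map (b s) [0..<d (ty s)])"
  unfolding represents_def using s B act by simp

lemma seed_vector_block:
  assumes s: "s < n" and "essential_part ys (b s 0) = cs"
  shows "seed_vector adj x (block s) ys cs (b s 0)"
  unfolding seed_vector_def endpoint_block[OF s]
  using assms pure_block[OF s, of 0] dim_layer_block[OF s, of 0] size_pos[OF s]
  by (simp add: Estar_image_block)

lemma eigenvector_iff:
  "A *v v = \<theta> *s v \<longleftrightarrow>
    (\<forall>s<n. \<forall>i<d (ty s). (\<Sum>j<d (ty s). M (ty s) i j * coord v s j) = \<theta> * coord v s i)"
proof -
  have "A *v v = (\<Sum>s<n. \<Sum>j<d (ty s). \<Sum>i<d (ty s). (M (ty s) i j * coord v s j) *s b s i)"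
    by (subst expand) (simp add: vec.sum vec.scale act vec.scale_sum_right mult.commute)
  also have "\<dots> = (\<Sum>s<n. \<Sum>i<d (ty s). (\<Sum>j<d (ty s). M (ty s) i j * coord v s j) *s b s i)"
    unfolding vec.scale_sum_left by (rule sum.cong[OF refl]) (rule sum.swap)
  finally have Av: "A *v v = (\<Sum>s<n. \<Sum>i<d (ty s). (\<Sum>j<d (ty s). M (ty s) i j * coord v s j) *s b s i)" .
  have tv: "\<theta> *s v = (\<Sum>s<n. \<Sum>i<d (ty s). (\<theta> * coord v s i) *s b s i)"
    by (subst expand) (simp add: vec.scale_sum_right)
  show ?thesis
  proof
    assume eq: "A *v v = \<theta> *s v"
    show "\<forall>s<n. \<forall>i<d (ty s). (\<Sum>j<d (ty s). M (ty s) i j * coord v s j) = \<theta> * coord v s i"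
    proof (intro allI impI)
      fix s i assume "s < n" "i < d (ty s)"
      then show "(\<Sum>j<d (ty s). M (ty s) i j * coord v s j) = \<theta> * coord v s i"
        using eq coord_combination[of s i "\<lambda>s i. \<Sum>j<d (ty s). M (ty s) i j * coord v s j"]
          coord_combination[of s i "\<lambda>s i. \<theta> * coord v s i"]
        unfolding Av tv by simp
    qed
  next
    assume "\<forall>s<n. \<forall>i<d (ty s). (\<Sum>j<d (ty s). M (ty s) i j * coord v s j) = \<theta> * coord v s i"
    then show "A *v v = \<theta> *s v"
      unfolding Av tv by simp
  qed
qed

text \<open>\<open>R\<close> marks the types that have \<open>\<theta>\<close> as an eigenvalue. By
  \<open>solve\<close> each chain of such a type contributes one line, spanned by the solution
  \<open>y\<close> normalised at index 0, and the other chains contribute nothing.\<close>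

lemma dim_eigenspace:
  assumes solve: "\<And>s z. s < n \<Longrightarrow>
      (\<forall>i<d (ty s). (\<Sum>j<d (ty s). M (ty s) i j * z j) = \<theta> * z i) \<longleftrightarrow>
      (\<forall>i<d (ty s). z i = (if R (ty s) then z 0 * y (ty s) i else 0))"
    and y0: "\<And>s. s < n \<Longrightarrow> y (ty s) 0 = 1"
  shows "vec.dim {v. A *v v = \<theta> *s v} = card {s. s < n \<and> R (ty s)}"
proof -
  let ?I = "{s. s < n \<and> R (ty s)}"
  define g where "g s = (\<Sum>i<d (ty s). y (ty s) i *s b s i)" for s
  have co: "coord (\<Sum>s\<in>?I. c s *s g s) s i = (if R (ty s) then c s * y (ty s) i else 0)"
    if "s < n" "i < d (ty s)" for c s i
  proof -
    have "(\<Sum>s\<in>?I. c s *s g s) = (\<Sum>s | s \<in> {..<n} \<and> R (ty s). c s *s g s)"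
      by simp
    also have "\<dots> = (\<Sum>s<n. if R (ty s) then c s *s g s else 0)"
      by (rule sum.inter_filter) simp
    also have "\<dots> = (\<Sum>s<n. \<Sum>i<d (ty s). (if R (ty s) then c s * y (ty s) i else 0) *s b s i)"
      by (rule sum.cong) (auto simp: g_def vec.scale_sum_right)
    finally show ?thesis
      using coord_combination[OF that, of "\<lambda>s i. if R (ty s) then c s * y (ty s) i else 0"] by simp
  qed
  have zero: "c s = 0" if "(\<Sum>s\<in>?I. c s *s g s) = 0" "s \<in> ?I" for c s
    using co[of s 0 c] that size_pos[of s] y0[of s] by (simp add: coord_def)
  have ind: "inj_on g ?I" "vec.independent (g ` ?I)"
    using independent_family[of ?I g] zero by auto
  have "vec.span (g ` ?I) = {v. A *v v = \<theta> *s v}"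
  proof (rule subset_antisym; rule subsetI)
    fix v assume "v \<in> vec.span (g ` ?I)"
    then obtain c where "v = (\<Sum>s\<in>?I. c s *s g s)"
      by (auto simp: span_family)
    then have "coord v s i = (if R (ty s) then coord v s 0 * y (ty s) i else 0)"
      if "s < n" "i < d (ty s)" for s i
      using co that size_pos[of s] y0[of s] by simp
    then show "v \<in> {v. A *v v = \<theta> *s v}"
      unfolding mem_Collect_eq eigenvector_iff using solve by blast
  next
    fix v assume "v \<in> {v. A *v v = \<theta> *s v}"
    then have co_v: "coord v s i = (if R (ty s) then coord v s 0 * y (ty s) i else 0)"
      if "s < n" "i < d (ty s)" for s i
      unfolding mem_Collect_eq eigenvector_iff using solve[of s "coord v s"] that by blast
    have "v = (\<Sum>s\<in>?I. coord v s 0 *s g s)"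
    proof (rule coord_eqI)
      fix s i assume s: "s < n" "i < d (ty s)"
      show "coord v s i = coord (\<Sum>s\<in>?I. coord v s 0 *s g s) s i"
        by (intro trans[OF co_v[OF s] co[OF s, of "\<lambda>s. coord v s 0", symmetric]])
    qed
    also have "\<dots> \<in> vec.span (g ` ?I)"
      by (intro vec.span_sum vec.span_scale vec.span_base imageI)
    finally show "v \<in> vec.span (g ` ?I)" .
  qed
  then show ?thesis
    using vec.dim_span_eq_card_independent[OF ind(2)] card_image[OF ind(1)] by simp
qed

end

section \<open>The six modules in coordinates\<close>

lemma all_less_2: "(\<forall>i<2. P (i :: nat)) \<longleftrightarrow> P 0 \<and> P 1"
  by (auto simp: less_2_cases_iff)

lemma all_less_4: "(\<forall>i<4. P (i :: nat)) \<longleftrightarrow> P 0 \<and> P 1 \<and> P 2 \<and> P 3"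
proof -
  have "i < 4 \<longleftrightarrow> i = 0 \<or> i = 1 \<or> i = 2 \<or> i = 3" for i :: nat
    by auto
  then show ?thesis
    by auto
qed

lemma all_less_6: "(\<forall>i<6. P (i :: nat)) \<longleftrightarrow> P 0 \<and> P 1 \<and> P 2 \<and> P 3 \<and> P 4 \<and> P 5"
proof -
  have "i < 6 \<longleftrightarrow> i = 0 \<or> i = 1 \<or> i = 2 \<or> i = 3 \<or> i = 4 \<or> i = 5" for i :: nat
    by auto
  then show ?thesis
    by auto
qed

lemma sum_less_2: "(\<Sum>i<2. f (i :: nat)) = f 0 + f 1"
  by (simp add: numeral_eq_Suc)

lemma sum_less_4: "(\<Sum>i<4. f (i :: nat)) = f 0 + f 1 + f 2 + f 3"
  by (simp add: numeral_eq_Suc)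

lemma sum_less_6: "(\<Sum>i<6. f (i :: nat)) = f 0 + f 1 + f 2 + f 3 + f 4 + f 5"
  by (simp add: numeral_eq_Suc)

lemma sum_less_20: "(\<Sum>i<20. f (i :: nat)) =
  f 0 + f 1 + f 2 + f 3 + f 4 + f 5 + f 6 + f 7 + f 8 + f 9 +
  f 10 + f 11 + f 12 + f 13 + f 14 + f 15 + f 16 + f 17 + f 18 + f 19"
  by (simp add: numeral_eq_Suc)

lemmas all_small = all_less_2 all_less_4 all_less_6
lemmas sum_small = sum_less_2 sum_less_4 sum_less_6

lemma hinner_layers:
  assumes "Estar adj x k *v u = u" "Estar adj x k' *v v = v" "k \<noteq> k'"
  shows "hinner u v = 0"
proof -
  have zero: "u $ y * cnj (v $ y) = 0" for y
    using Estar_mult_vec[of adj x k u y] Estar_mult_vec[of adj x k' v y] assms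
    by (cases "gdist adj x y = k") simp_all
  show ?thesis
    unfolding hinner_def by (intro sum.neutral ballI zero)
qed

text \<open>Listing values by label turns identities in the standard module into computations with
  lists of numbers.\<close>

definition lvec :: "'v::finite list \<Rightarrow> complex list \<Rightarrow> complex ^ 'v" where
  "lvec vs xs = (\<chi> y. xs ! (THE i. i < length vs \<and> vs ! i = y))"

locale labelled_graph =
  fixes adj :: "'v::finite \<Rightarrow> 'v \<Rightarrow> bool" and vs :: "'v list"
  assumes labelling: "labelling adj vs"
begin

lemma labels: "length vs = 20" "distinct vs" "set vs = UNIV"
  using labelling by (auto simp: labelling_def)

lemma lvec_nth: "i < 20 \<Longrightarrow> lvec vs xs $ (vs ! i) = xs ! i"
proof -
  assume "i < 20"
  then have "(THE j. j < length vs \<and> vs ! j = vs ! i) = i"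
    using labels by (auto simp: nth_eq_iff_index_eq)
  then show ?thesis
    by (simp add: lvec_def)
qed

lemma vec_eq_labels: "u = v \<longleftrightarrow> (\<forall>i<20. u $ (vs ! i) = v $ (vs ! i))"
proof -
  have "u $ y = v $ y" if "\<forall>i<20. u $ (vs ! i) = v $ (vs ! i)" for y
    using that labels by (metis UNIV_I in_set_conv_nth)
  then show ?thesis
    by (auto simp: Finite_Cartesian_Product.vec_eq_iff)
qed

lemma sum_labels: "(\<Sum>y\<in>UNIV. f y) = (\<Sum>i<20. f (vs ! i))"
proof -
  have "bij_betw ((!) vs) {..<20} UNIV"
    using bij_betw_nth[OF labels(2), of "{..<20}" UNIV] labels by simp
  then show ?thesis
    by (rule sum.reindex_bij_betw[symmetric])
qed

lemma hinner_lvec: "hinner (lvec vs xs) (lvec vs zs) = (\<Sum>i<20. xs ! i * cnj (zs ! i))"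
  unfolding hinner_def sum_labels by (simp add: lvec_nth)

lemma lvec_eq_0_iff: "lvec vs xs = 0 \<longleftrightarrow> (\<forall>i<20. xs ! i = 0)"
  unfolding vec_eq_labels by (simp add: lvec_nth)

lemma gdist_label: "i < 20 \<Longrightarrow> gdist adj (vs ! 0) (vs ! i) = layer ! i"
  using labelling by (simp add: labelling_def)

lemma adj_matrix_label:
  assumes "i < 20"
  shows "(adj_matrix adj *v v) $ (vs ! i) = (\<Sum>j\<leftarrow>nbr_table ! i. v $ (vs ! j))"
proof -
  have tab: "\<forall>i<20. distinct (nbr_table ! i) \<and> (\<forall>j\<in>set (nbr_table ! i). j < 20)"
    unfolding all_less_20 by (simp add: nbr_table_def)
  have "(adj_matrix adj *v v) $ (vs ! i) = (\<Sum>y\<in>UNIV. if adj (vs ! i) y then v $ y else 0)"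
    unfolding adj_matrix_def matrix_vector_mult_def by (auto intro!: sum.cong)
  also have "\<dots> = (\<Sum>y | adj (vs ! i) y. v $ y)"
    by (simp add: sum.If_cases)
  also have "{y. adj (vs ! i) y} = (!) vs ` set (nbr_table ! i)"
    using labelling assms by (simp add: labelling_def)
  also have "(\<Sum>y\<in>(!) vs ` set (nbr_table ! i). v $ y) = (\<Sum>j\<in>set (nbr_table ! i). v $ (vs ! j))"
    by (subst sum.reindex) (use tab assms labels in \<open>auto simp: inj_on_def nth_eq_iff_index_eq\<close>)
  also have "\<dots> = (\<Sum>j\<leftarrow>nbr_table ! i. v $ (vs ! j))"
    using tab assms by (simp add: sum_list_distinct_conv_sum_set)
  finally show ?thesis .
qed

lemma adj_matrix_lvec:
  assumes "\<forall>k<20. (\<Sum>j\<leftarrow>nbr_table ! k. xs ! j) = (\<Sum>i<m. c i * (zs i ! k))"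
  shows "adj_matrix adj *v lvec vs xs = (\<Sum>i<m. c i *s lvec vs (zs i))"
proof -
  have tab: "\<forall>i<20. \<forall>j\<in>set (nbr_table ! i). j < 20"
    unfolding all_less_20 by (simp add: nbr_table_def)
  have "(adj_matrix adj *v lvec vs xs) $ (vs ! k) = (\<Sum>i<m. c i *s lvec vs (zs i)) $ (vs ! k)"
    if k: "k < 20" for k
  proof -
    have "(adj_matrix adj *v lvec vs xs) $ (vs ! k) = (\<Sum>j\<leftarrow>nbr_table ! k. lvec vs xs $ (vs ! j))"
      by (rule adj_matrix_label[OF k])
    also have "\<dots> = (\<Sum>j\<leftarrow>nbr_table ! k. xs ! j)"
      by (intro arg_cong[of _ _ sum_list] map_cong) (use tab k in \<open>auto simp: lvec_nth\<close>)
    finally show ?thesis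
      using assms k by (simp add: lvec_nth)
  qed
  then show ?thesis
    by (simp add: vec_eq_labels)
qed

lemma Estar_lvec:
  assumes "\<forall>i<20. layer ! i \<noteq> m \<longrightarrow> xs ! i = 0"
  shows "Estar adj (vs ! 0) k *v lvec vs xs = (if k = m then lvec vs xs else 0)"
  using assms by (auto simp: vec_eq_labels Estar_mult_vec lvec_nth gdist_label)

lemma estar_lvec:
  assumes "\<forall>i<20. xs ! i = (if layer ! i = k then 1 else 0)"
  shows "estar adj (vs ! 0) k = lvec vs xs"
  using assms by (auto simp: vec_eq_labels lvec_nth gdist_label estar_def)

end

section \<open>The four tridiagonal matrices and their eigenvalues\<close>

definition block_type :: "nat \<Rightarrow> nat" where
  "block_type s = [0, 1, 1, 2, 3, 3] ! s"

definition block_size :: "nat \<Rightarrow> nat" where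
  "block_size l = [6, 4, 2, 2] ! l"

definition block_endpoint :: "nat \<Rightarrow> nat" where
  "block_endpoint l = [0, 1, 2, 2] ! l"

definition block_rows :: "nat \<Rightarrow> complex list list" where
  "block_rows l =
    [[[0, 3, 0, 0, 0, 0],
      [1, 0, 2, 0, 0, 0],
      [0, 1, 0, 2, 0, 0],
      [0, 0, 2, 0, 1, 0],
      [0, 0, 0, 2, 0, 1],
      [0, 0, 0, 0, 3, 0]],
     [[0, 2, 0, 0],
      [1, 0, 1, 0],
      [0, 1, 0, 2],
      [0, 0, 1, 0]],
     [[0, 4], [1, 0]],
     [[0, 1], [1, 0]]] ! l"

definition block_entry :: "nat \<Rightarrow> nat \<Rightarrow> nat \<Rightarrow> complex" where
  "block_entry l i j = block_rows l ! i ! j"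

definition block_eigenvalues :: "nat \<Rightarrow> complex set" where
  "block_eigenvalues l = [{3, 2, 1, - 1, - 2, - 3}, {2, 1, - 1, - 2}, {2, - 2}, {1, - 1}] ! l"

text \<open>Solving the tridiagonal eigenvalue equations from the top row downwards.\<close>

definition block_eigenvector :: "nat \<Rightarrow> complex \<Rightarrow> nat \<Rightarrow> complex" where
  "block_eigenvector l \<theta> i =
    [[1, \<theta> / 3, (\<theta>^2 - 3) / 6, (\<theta>^3 - 5 * \<theta>) / 12, (\<theta>^4 - 9 * \<theta>^2 + 12) / 12,
      (\<theta>^5 - 11 * \<theta>^3 + 22 * \<theta>) / 12],
     [1, \<theta> / 2, (\<theta>^2 - 2) / 2, (\<theta>^3 - 3 * \<theta>) / 4],
     [1, \<theta> / 4],
     [1, \<theta>]] ! l ! i"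

lemma block_eigenvector_0: "l < 4 \<Longrightarrow> block_eigenvector l \<theta> 0 = 1"
  using all_less_4[of "\<lambda>l. block_eigenvector l \<theta> 0 = 1"] by (simp add: block_eigenvector_def)

text \<open>All rows but the last determine the solution from \<open>z 0\<close>; the last row then
  says that \<open>z 0\<close> times the characteristic polynomial vanishes. The other three types
  are solved in the same way.\<close>

lemma block_eigen_equation_0:
  "(\<forall>i<6. (\<Sum>j<6. block_entry 0 i j * z j) = \<theta> * z i) \<longleftrightarrow>
   (\<forall>i<6. z i = (if \<theta> \<in> block_eigenvalues 0 then z 0 * block_eigenvector 0 \<theta> i else 0))"
  (is "?L \<longleftrightarrow> ?R")
proof
  have "?L \<longleftrightarrow> 3 * z 1 = \<theta> * z 0 \<and> z 0 + 2 * z 2 = \<theta> * z 1 \<and> z 1 + 2 * z 3 = \<theta> * z 2 \<and>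
      2 * z 2 + z 4 = \<theta> * z 3 \<and> 2 * z 3 + z 5 = \<theta> * z 4 \<and> 3 * z 4 = \<theta> * z 5"
    unfolding all_small sum_small by (simp add: block_entry_def block_rows_def)
  moreover assume ?L
  ultimately have eqs: "3 * z 1 = \<theta> * z 0" "z 0 + 2 * z 2 = \<theta> * z 1" "z 1 + 2 * z 3 = \<theta> * z 2"
    "2 * z 2 + z 4 = \<theta> * z 3" "2 * z 3 + z 5 = \<theta> * z 4" "3 * z 4 = \<theta> * z 5"
    by blast+
  have "z 1 = \<theta> * z 0 / 3"
    using eqs(1) by (simp add: field_simps)
  also have "\<dots> = z 0 * (\<theta> / 3)"
    by (simp add: field_simps eval_nat_numeral)
  finally have z1: "z 1 = z 0 * (\<theta> / 3)" .
  have "z 2 = (\<theta> * z 1 - z 0) / 2"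
    unfolding eqs(2)[symmetric] by simp
  also have "\<dots> = z 0 * ((\<theta>^2 - 3) / 6)"
    unfolding z1 by (simp add: field_simps eval_nat_numeral)
  finally have z2: "z 2 = z 0 * ((\<theta>^2 - 3) / 6)" .
  have "z 3 = (\<theta> * z 2 - z 1) / 2"
    unfolding eqs(3)[symmetric] by simp
  also have "\<dots> = z 0 * ((\<theta>^3 - 5 * \<theta>) / 12)"
    unfolding z1 z2 by (simp add: field_simps eval_nat_numeral)
  finally have z3: "z 3 = z 0 * ((\<theta>^3 - 5 * \<theta>) / 12)" .
  have "z 4 = \<theta> * z 3 - 2 * z 2"
    unfolding eqs(4)[symmetric] by simp
  also have "\<dots> = z 0 * ((\<theta>^4 - 9 * \<theta>^2 + 12) / 12)"
    unfolding z2 z3 by (simp add: field_simps eval_nat_numeral)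
  finally have z4: "z 4 = z 0 * ((\<theta>^4 - 9 * \<theta>^2 + 12) / 12)" .
  have "z 5 = \<theta> * z 4 - 2 * z 3"
    unfolding eqs(5)[symmetric] by simp
  also have "\<dots> = z 0 * ((\<theta>^5 - 11 * \<theta>^3 + 22 * \<theta>) / 12)"
    unfolding z3 z4 by (simp add: field_simps eval_nat_numeral)
  finally have z5: "z 5 = z 0 * ((\<theta>^5 - 11 * \<theta>^3 + 22 * \<theta>) / 12)" .
  \<comment> \<open>The factor 12 clears the denominators; expanded, the polynomial is \<theta>^6 -
    14 \<theta>^4 + 49 \<theta>^2 - 36.\<close>
  have "z 0 * ((\<theta> - 3) * (\<theta> - 2) * (\<theta> - 1) * (\<theta> + 1) * (\<theta> + 2) * (\<theta> + 3)) = 12 * (\<theta> * z 5 - 3 * z 4)"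
    unfolding z4 z5 by (simp add: field_simps eval_nat_numeral)
  also have "\<dots> = 0"
    using eqs(6) by simp
  finally have "\<theta> \<in> block_eigenvalues 0 \<or> z 0 = 0"
    by (auto simp: block_eigenvalues_def add_eq_0_iff2)
  then show ?R
    unfolding all_small z1 z2 z3 z4 z5 by (auto simp: block_eigenvector_def)
next
  assume ?R
  show ?L
  proof (cases "\<theta> \<in> block_eigenvalues 0")
    case True
    have "\<forall>i<6. z i = z 0 * block_eigenvector 0 \<theta> i"
      using \<open>?R\<close> unfolding if_P[OF True] .
    \<comment> \<open>With the scalar named, the formula for \<open>z i\<close> no longer mentions
      \<open>z 0\<close> on its right side, also for \<open>i = 0\<close>.\<close>
    then obtain a where z: "\<forall>i<6. z i = a * block_eigenvector 0 \<theta> i"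
      by blast
    from True show ?thesis
      unfolding all_small sum_small
      by (auto simp: z block_eigenvalues_def block_entry_def block_rows_def block_eigenvector_def)
  next
    case False
    then show ?thesis
      using \<open>?R\<close> by simp
  qed
qed

lemma block_eigen_equation_1:
  "(\<forall>i<4. (\<Sum>j<4. block_entry 1 i j * z j) = \<theta> * z i) \<longleftrightarrow>
   (\<forall>i<4. z i = (if \<theta> \<in> block_eigenvalues 1 then z 0 * block_eigenvector 1 \<theta> i else 0))"
  (is "?L \<longleftrightarrow> ?R")
proof
  have "?L \<longleftrightarrow> 2 * z 1 = \<theta> * z 0 \<and> z 0 + z 2 = \<theta> * z 1 \<and> z 1 + 2 * z 3 = \<theta> * z 2 \<and>
      z 2 = \<theta> * z 3"
    unfolding all_small sum_small by (simp add: block_entry_def block_rows_def)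
  moreover assume ?L
  ultimately have eqs: "2 * z 1 = \<theta> * z 0" "z 0 + z 2 = \<theta> * z 1" "z 1 + 2 * z 3 = \<theta> * z 2"
    "z 2 = \<theta> * z 3"
    by blast+
  have "z 1 = \<theta> * z 0 / 2"
    using eqs(1) by (simp add: field_simps)
  also have "\<dots> = z 0 * (\<theta> / 2)"
    by (simp add: field_simps eval_nat_numeral)
  finally have z1: "z 1 = z 0 * (\<theta> / 2)" .
  have "z 2 = \<theta> * z 1 - z 0"
    unfolding eqs(2)[symmetric] by simp
  also have "\<dots> = z 0 * ((\<theta>^2 - 2) / 2)"
    unfolding z1 by (simp add: field_simps eval_nat_numeral)
  finally have z2: "z 2 = z 0 * ((\<theta>^2 - 2) / 2)" .
  have "z 3 = (\<theta> * z 2 - z 1) / 2"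
    unfolding eqs(3)[symmetric] by simp
  also have "\<dots> = z 0 * ((\<theta>^3 - 3 * \<theta>) / 4)"
    unfolding z1 z2 by (simp add: field_simps eval_nat_numeral)
  finally have z3: "z 3 = z 0 * ((\<theta>^3 - 3 * \<theta>) / 4)" .
  have "z 0 * ((\<theta> - 2) * (\<theta> - 1) * (\<theta> + 1) * (\<theta> + 2)) = 4 * (\<theta> * z 3 - z 2)"
    unfolding z2 z3 by (simp add: field_simps eval_nat_numeral)
  also have "\<dots> = 0"
    using eqs(4) by simp
  finally have "\<theta> \<in> block_eigenvalues 1 \<or> z 0 = 0"
    by (auto simp: block_eigenvalues_def add_eq_0_iff2)
  then show ?R
    unfolding all_small z1 z2 z3 by (auto simp: block_eigenvector_def)
next
  assume ?R
  show ?L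
  proof (cases "\<theta> \<in> block_eigenvalues 1")
    case True
    have "\<forall>i<4. z i = z 0 * block_eigenvector 1 \<theta> i"
      using \<open>?R\<close> unfolding if_P[OF True] .
    then obtain a where z: "\<forall>i<4. z i = a * block_eigenvector 1 \<theta> i"
      by blast
    from True show ?thesis
      unfolding all_small sum_small
      by (auto simp: z block_eigenvalues_def block_entry_def block_rows_def block_eigenvector_def)
  next
    case False
    then show ?thesis
      using \<open>?R\<close> by simp
  qed
qed

lemma block_eigen_equation_2:
  "(\<forall>i<2. (\<Sum>j<2. block_entry 2 i j * z j) = \<theta> * z i) \<longleftrightarrow>
   (\<forall>i<2. z i = (if \<theta> \<in> block_eigenvalues 2 then z 0 * block_eigenvector 2 \<theta> i else 0))"
  (is "?L \<longleftrightarrow> ?R")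
proof
  have "?L \<longleftrightarrow> 4 * z 1 = \<theta> * z 0 \<and> z 0 = \<theta> * z 1"
    unfolding all_small sum_small by (simp add: block_entry_def block_rows_def)
  moreover assume ?L
  ultimately have eqs: "4 * z 1 = \<theta> * z 0" "z 0 = \<theta> * z 1"
    by blast+
  have "z 1 = \<theta> * z 0 / 4"
    using eqs(1) by (simp add: field_simps)
  also have "\<dots> = z 0 * (\<theta> / 4)"
    by (simp add: field_simps eval_nat_numeral)
  finally have z1: "z 1 = z 0 * (\<theta> / 4)" .
  have "z 0 * ((\<theta> - 2) * (\<theta> + 2)) = 4 * (\<theta> * z 1 - z 0)"
    unfolding z1 by (simp add: field_simps eval_nat_numeral)
  also have "\<dots> = 0"
    using eqs(2) by simp
  finally have "\<theta> \<in> block_eigenvalues 2 \<or> z 0 = 0"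
    by (auto simp: block_eigenvalues_def add_eq_0_iff2)
  then show ?R
    unfolding all_small z1 by (auto simp: block_eigenvector_def)
next
  assume ?R
  show ?L
  proof (cases "\<theta> \<in> block_eigenvalues 2")
    case True
    have "\<forall>i<2. z i = z 0 * block_eigenvector 2 \<theta> i"
      using \<open>?R\<close> unfolding if_P[OF True] .
    then obtain a where z: "\<forall>i<2. z i = a * block_eigenvector 2 \<theta> i"
      by blast
    from True show ?thesis
      unfolding all_small sum_small
      by (auto simp: z block_eigenvalues_def block_entry_def block_rows_def block_eigenvector_def)
  next
    case False
    then show ?thesis
      using \<open>?R\<close> by simp
  qed
qed

lemma block_eigen_equation_3:
  "(\<forall>i<2. (\<Sum>j<2. block_entry 3 i j * z j) = \<theta> * z i) \<longleftrightarrow>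
   (\<forall>i<2. z i = (if \<theta> \<in> block_eigenvalues 3 then z 0 * block_eigenvector 3 \<theta> i else 0))"
  (is "?L \<longleftrightarrow> ?R")
proof
  have "?L \<longleftrightarrow> z 1 = \<theta> * z 0 \<and> z 0 = \<theta> * z 1"
    unfolding all_small sum_small by (simp add: block_entry_def block_rows_def)
  moreover assume ?L
  ultimately have eqs: "z 1 = \<theta> * z 0" "z 0 = \<theta> * z 1"
    by blast+
  have "z 1 = \<theta> * z 0"
    using eqs(1) by (simp add: field_simps)
  also have "\<dots> = z 0 * (\<theta>)"
    by (simp add: field_simps eval_nat_numeral)
  finally have z1: "z 1 = z 0 * (\<theta>)" .
  have "z 0 * ((\<theta> - 1) * (\<theta> + 1)) = \<theta> * z 1 - z 0"
    unfolding z1 by (simp add: field_simps eval_nat_numeral)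
  also have "\<dots> = 0"
    using eqs(2) by simp
  finally have "\<theta> \<in> block_eigenvalues 3 \<or> z 0 = 0"
    by (auto simp: block_eigenvalues_def add_eq_0_iff2)
  then show ?R
    unfolding all_small z1 by (auto simp: block_eigenvector_def)
next
  assume ?R
  show ?L
  proof (cases "\<theta> \<in> block_eigenvalues 3")
    case True
    have "\<forall>i<2. z i = z 0 * block_eigenvector 3 \<theta> i"
      using \<open>?R\<close> unfolding if_P[OF True] .
    then obtain a where z: "\<forall>i<2. z i = a * block_eigenvector 3 \<theta> i"
      by blast
    from True show ?thesis
      unfolding all_small sum_small
      by (auto simp: z block_eigenvalues_def block_entry_def block_rows_def block_eigenvector_def)
  next
    case False
    then show ?thesis
      using \<open>?R\<close> by simp
  qed
qed

lemma block_eigen_equation: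
  assumes "l < 4"
  shows "(\<forall>i<block_size l. (\<Sum>j<block_size l. block_entry l i j * z j) = \<theta> * z i) \<longleftrightarrow>
    (\<forall>i<block_size l. z i = (if \<theta> \<in> block_eigenvalues l then z 0 * block_eigenvector l \<theta> i else 0))"
proof -
  have "l = 0 \<or> l = 1 \<or> l = 2 \<or> l = 3"
    using assms by auto
  then show ?thesis
    using block_eigen_equation_0[of z \<theta>] block_eigen_equation_1[of z \<theta>]
      block_eigen_equation_2[of z \<theta>] block_eigen_equation_3[of z \<theta>]
    by (elim disjE) (simp_all add: block_size_def)
qed

text \<open>This puts \<open>eigenvalue\<close> into the form of the block equations, so that one
  solution serves both the listed matrices and the eigenspaces of \<open>A\<close>.\<close>

lemma eigenvalue_iff_coordinates:
  assumes B: "B \<in> carrier_mat m m"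
  shows "eigenvalue B \<theta> \<longleftrightarrow>
    (\<exists>z. (\<exists>i<m. z i \<noteq> 0) \<and> (\<forall>i<m. (\<Sum>j<m. B $$ (i, j) * z j) = \<theta> * z i))"
proof
  assume "eigenvalue B \<theta>"
  then obtain v where v: "v \<in> carrier_vec m" "v \<noteq> 0\<^sub>v m" "B *\<^sub>v v = \<theta> \<cdot>\<^sub>v v"
    using B by (auto simp: eigenvalue_def eigenvector_def)
  have "\<exists>i<m. vec_index v i \<noteq> 0"
    using v(1,2) by (metis carrier_vecD eq_vecI index_zero_vec)
  moreover have "(\<Sum>j<m. B $$ (i, j) * vec_index v j) = \<theta> * vec_index v i" if "i < m" for i
    using arg_cong[OF v(3), of "\<lambda>w. vec_index w i"] that B v(1)
    by (simp add: scalar_prod_def atLeast0LessThan)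
  ultimately show "\<exists>z. (\<exists>i<m. z i \<noteq> 0) \<and> (\<forall>i<m. (\<Sum>j<m. B $$ (i, j) * z j) = \<theta> * z i)"
    by (intro exI[of _ "vec_index v"]) auto
next
  assume "\<exists>z. (\<exists>i<m. z i \<noteq> 0) \<and> (\<forall>i<m. (\<Sum>j<m. B $$ (i, j) * z j) = \<theta> * z i)"
  then obtain z k where k: "k < m" "z k \<noteq> 0" and z: "\<forall>i<m. (\<Sum>j<m. B $$ (i, j) * z j) = \<theta> * z i"
    by auto
  let ?v = "Matrix.vec m z"
  have "vec_index ?v k \<noteq> vec_index (0\<^sub>v m) k"
    using k by simp
  then have "?v \<noteq> 0\<^sub>v m"
    by metis
  moreover have "B *\<^sub>v ?v = \<theta> \<cdot>\<^sub>v ?v"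
    by (rule eq_vecI) (use B z in \<open>auto simp: scalar_prod_def atLeast0LessThan\<close>)
  ultimately show "eigenvalue B \<theta>"
    using B by (auto simp: eigenvalue_def eigenvector_def intro!: exI[of _ ?v])
qed

lemma block_matrix:
  assumes "l < 4"
  shows "mat_of_rows_list (block_size l) (block_rows l) \<in> carrier_mat (block_size l) (block_size l)"
    and "i < block_size l \<Longrightarrow> j < block_size l \<Longrightarrow>
      mat_of_rows_list (block_size l) (block_rows l) $$ (i, j) = block_entry l i j"
proof -
  have "l = 0 \<or> l = 1 \<or> l = 2 \<or> l = 3"
    using assms by auto
  then have len: "length (block_rows l) = block_size l"
    by (auto simp: block_rows_def block_size_def)
  then show "mat_of_rows_list (block_size l) (block_rows l) \<in> carrier_mat (block_size l) (block_size l)"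
    by (simp add: mat_of_rows_list_def)
  show "i < block_size l \<Longrightarrow> j < block_size l \<Longrightarrow>
      mat_of_rows_list (block_size l) (block_rows l) $$ (i, j) = block_entry l i j"
    using len by (simp add: mat_of_rows_list_def block_entry_def)
qed

lemma block_matrix_eigenvalues:
  assumes l: "l < 4"
  shows "{\<theta>. eigenvalue (mat_of_rows_list (block_size l) (block_rows l)) \<theta>} = block_eigenvalues l"
proof -
  have pos: "0 < block_size l"
    using l all_less_4[of "\<lambda>l. 0 < block_size l"] by (simp add: block_size_def)
  have "eigenvalue (mat_of_rows_list (block_size l) (block_rows l)) \<theta> \<longleftrightarrow> \<theta> \<in> block_eigenvalues l" for \<theta>
  proof -
    have "eigenvalue (mat_of_rows_list (block_size l) (block_rows l)) \<theta> \<longleftrightarrow>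
        (\<exists>z. (\<exists>i<block_size l. z i \<noteq> 0) \<and>
          (\<forall>i<block_size l. (\<Sum>j<block_size l. block_entry l i j * z j) = \<theta> * z i))"
      unfolding eigenvalue_iff_coordinates[OF block_matrix(1)[OF l]] using block_matrix(2)[OF l] by simp
    also have "\<dots> \<longleftrightarrow> (\<exists>z. (\<exists>i<block_size l. z i \<noteq> 0) \<and> (\<forall>i<block_size l. z i =
        (if \<theta> \<in> block_eigenvalues l then z 0 * block_eigenvector l \<theta> i else 0)))"
      unfolding block_eigen_equation[OF l] ..
    also have "\<dots> \<longleftrightarrow> \<theta> \<in> block_eigenvalues l"
    proof (cases "\<theta> \<in> block_eigenvalues l")
      case True
      then show ?thesis
        using pos block_eigenvector_0[OF l, of \<theta>]
        by (auto intro!: exI[of _ "block_eigenvector l \<theta>"] exI[of _ 0])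
    qed auto
    finally show ?thesis .
  qed
  then show ?thesis
    by blast
qed

text \<open>The portion of the theorem that depends on the two orders, kept in the same wording so
  that unfolding it yields the statement.\<close>

definition desargues_decomposition ::
    "('v::finite \<Rightarrow> 'v \<Rightarrow> bool) \<Rightarrow> 'v \<Rightarrow> 'v list \<Rightarrow> 'v list \<Rightarrow> bool" where
  "desargues_decomposition adj x zs ys \<longleftrightarrow>
(\<exists>W0 W1a W1b W2a W2b W2c.
          orthogonal_decomposition (terwilliger adj x) [W0, W1a, W1b, W2a, W2b, W2c] \<and>
          (\<forall>i<6. \<forall>j<6.
             module_iso (terwilliger adj x) ([W0, W1a, W1b, W2a, W2b, W2c] ! i) ([W0, W1a, W1b, W2a, W2b, W2c] ! j)
             \<longleftrightarrow> [1, 2, 2, 3, 4, 4 :: nat] ! i = [1, 2, 2, 3, 4, 4] ! j) \<and>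
          (endpoint adj x W0 = 0 \<and> module_multiplicity (terwilliger adj x) W0 = 1 \<and> vec.dim W0 = 6 \<and>
           module_diameter adj x W0 = 5 \<and> module_shape adj x W0 = [1, 1, 1, 1, 1, 1] \<and>
           pure_basis adj x W0 (map (estar adj x) [0..<6]) \<and>
           (let B = mat_of_rows_list 6
                  [[0, 3, 0, 0, 0, 0],
                   [1, 0, 2, 0, 0, 0],
                   [0, 1, 0, 2, 0, 0],
                   [0, 0, 2, 0, 1, 0],
                   [0, 0, 0, 2, 0, 1],
                   [0, 0, 0, 0, 3, 0]]
            in represents B (adj_matrix adj) (map (estar adj x) [0..<6]) \<and>
               {\<theta>. eigenvalue B \<theta>} = {3, 2, 1, - 1, - 2, - 3})) \<and>
          (\<forall>(W, cs) \<in> {(W1a, [1, - 1, 0]), (W1b, [1, 1, - 2])}.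
             endpoint adj x W = 1 \<and> module_multiplicity (terwilliger adj x) W = 2 \<and> vec.dim W = 4 \<and>
             module_diameter adj x W = 3 \<and> module_shape adj x W = [1, 1, 1, 1] \<and>
             (\<exists>\<nu>. seed_vector adj x W zs cs \<nu> \<and>
                adj_matrix adj *v \<nu> = Estar adj x 2 *v (adj_matrix adj *v \<nu>) \<and>
                (let vs = [\<nu>, adj_matrix adj *v \<nu>, Estar adj x 3 *v (adj_matrix adj *v (adj_matrix adj *v \<nu>)),
                           Estar adj x 4 *v (adj_matrix adj *v (adj_matrix adj *v (adj_matrix adj *v \<nu>)))];
                     B = mat_of_rows_list 4
                       [[0, 2, 0, 0],
                        [1, 0, 1, 0],
                        [0, 1, 0, 2],
                        [0, 0, 1, 0]]
                 in pure_basis adj x W vs \<and> represents B (adj_matrix adj) vs \<and>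
                    {\<theta>. eigenvalue B \<theta>} = {2, 1, - 1, - 2}))) \<and>
          (endpoint adj x W2a = 2 \<and> module_multiplicity (terwilliger adj x) W2a = 1 \<and> vec.dim W2a = 2 \<and>
           module_diameter adj x W2a = 1 \<and> module_shape adj x W2a = [1, 1] \<and>
           (\<exists>\<nu>. seed_vector adj x W2a ys [1, - 1, 1, - 1, 1, - 1] \<nu> \<and>
              adj_matrix adj *v \<nu> = Estar adj x 3 *v (adj_matrix adj *v \<nu>) \<and>
              (let vs = [\<nu>, adj_matrix adj *v \<nu>];
                   B = mat_of_rows_list 2 [[0, 4], [1, 0]]
               in pure_basis adj x W2a vs \<and> represents B (adj_matrix adj) vs \<and>
                  {\<theta>. eigenvalue B \<theta>} = {2, - 2}))) \<and>
          (\<forall>(W, cs) \<in> {(W2b, [2, - 2, - 1, 1, - 1, 1]), (W2c, [0, 0, 1, - 1, - 1, 1])}.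
             endpoint adj x W = 2 \<and> module_multiplicity (terwilliger adj x) W = 2 \<and> vec.dim W = 2 \<and>
             module_diameter adj x W = 1 \<and> module_shape adj x W = [1, 1] \<and>
             (\<exists>\<nu>. seed_vector adj x W ys cs \<nu> \<and>
                adj_matrix adj *v \<nu> = Estar adj x 3 *v (adj_matrix adj *v \<nu>) \<and>
                (let vs = [\<nu>, adj_matrix adj *v \<nu>];
                     B = mat_of_rows_list 2 [[0, 1], [1, 0]]
                 in pure_basis adj x W vs \<and> represents B (adj_matrix adj) vs \<and>
                    {\<theta>. eigenvalue B \<theta>} = {1, - 1}))))"

section \<open>The six chains as lists of label coordinates\<close>

definition const_blocks :: "complex list list" where
  "const_blocks =
    [[1, 0, 0, 0, 0, 0, 0, 0, 0, 0, 0, 0, 0, 0, 0, 0, 0, 0, 0, 0],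
     [0, 1, 1, 1, 0, 0, 0, 0, 0, 0, 0, 0, 0, 0, 0, 0, 0, 0, 0, 0],
     [0, 0, 0, 0, 1, 1, 1, 1, 1, 1, 0, 0, 0, 0, 0, 0, 0, 0, 0, 0],
     [0, 0, 0, 0, 0, 0, 0, 0, 0, 0, 1, 1, 1, 1, 1, 1, 0, 0, 0, 0],
     [0, 0, 0, 0, 0, 0, 0, 0, 0, 0, 0, 0, 0, 0, 0, 0, 1, 1, 1, 0],
     [0, 0, 0, 0, 0, 0, 0, 0, 0, 0, 0, 0, 0, 0, 0, 0, 0, 0, 0, 1]]"

text \<open>
  The chains generated by the values \<open>a, b, c\<close> with sum 0 on \<open>u\<^sub>1, u\<^sub>2, u\<^sub>3\<close> (even), respectively by
  opposite values on \<open>p\<^sub>k\<close> and \<open>q\<^sub>k\<close> (odd). The two even ones are kept symbolic because the order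
  of the first subconstituent is not tied to that of the second.
\<close>

definition even_blocks :: "complex \<Rightarrow> complex \<Rightarrow> complex \<Rightarrow> complex list list" where
  "even_blocks a b c =
    [[0, a, b, c, 0, 0, 0, 0, 0, 0, 0, 0, 0, 0, 0, 0, 0, 0, 0, 0],
     [0, 0, 0, 0, a, a, b, b, c, c, 0, 0, 0, 0, 0, 0, 0, 0, 0, 0],
     [0, 0, 0, 0, 0, 0, 0, 0, 0, 0, - a, - a, - b, - b, - c, - c, 0, 0, 0, 0],
     [0, 0, 0, 0, 0, 0, 0, 0, 0, 0, 0, 0, 0, 0, 0, 0, - 2 * a, - 2 * b, - 2 * c, 0]]"

definition odd_blocks :: "complex \<Rightarrow> complex \<Rightarrow> complex \<Rightarrow> complex list list" where
  "odd_blocks a b c =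
    [[0, 0, 0, 0, a, - a, b, - b, c, - c, 0, 0, 0, 0, 0, 0, 0, 0, 0, 0],
     [0, 0, 0, 0, 0, 0, 0, 0, 0, 0, b + c, - b - c, a + c, - a - c, a + b, - a - b, 0, 0, 0, 0]]"

lemma nth_list_2:
  "[x0, x1] ! 0 = x0"
  "[x0, x1] ! 1 = x1"
  by simp_all

lemma nth_list_4:
  "[x0, x1, x2, x3] ! 0 = x0"
  "[x0, x1, x2, x3] ! 1 = x1"
  "[x0, x1, x2, x3] ! 2 = x2"
  "[x0, x1, x2, x3] ! 3 = x3"
  by simp_all

lemma nth_list_6:
  "[x0, x1, x2, x3, x4, x5] ! 0 = x0"
  "[x0, x1, x2, x3, x4, x5] ! 1 = x1"
  "[x0, x1, x2, x3, x4, x5] ! 2 = x2"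
  "[x0, x1, x2, x3, x4, x5] ! 3 = x3"
  "[x0, x1, x2, x3, x4, x5] ! 4 = x4"
  "[x0, x1, x2, x3, x4, x5] ! 5 = x5"
  by simp_all

lemma nth_list_20:
  "[x0, x1, x2, x3, x4, x5, x6, x7, x8, x9, x10, x11, x12, x13, x14, x15, x16, x17, x18, x19] ! 0 = x0"
  "[x0, x1, x2, x3, x4, x5, x6, x7, x8, x9, x10, x11, x12, x13, x14, x15, x16, x17, x18, x19] ! 1 = x1"
  "[x0, x1, x2, x3, x4, x5, x6, x7, x8, x9, x10, x11, x12, x13, x14, x15, x16, x17, x18, x19] ! 2 = x2"
  "[x0, x1, x2, x3, x4, x5, x6, x7, x8, x9, x10, x11, x12, x13, x14, x15, x16, x17, x18, x19] ! 3 = x3"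
  "[x0, x1, x2, x3, x4, x5, x6, x7, x8, x9, x10, x11, x12, x13, x14, x15, x16, x17, x18, x19] ! 4 = x4"
  "[x0, x1, x2, x3, x4, x5, x6, x7, x8, x9, x10, x11, x12, x13, x14, x15, x16, x17, x18, x19] ! 5 = x5"
  "[x0, x1, x2, x3, x4, x5, x6, x7, x8, x9, x10, x11, x12, x13, x14, x15, x16, x17, x18, x19] ! 6 = x6"
  "[x0, x1, x2, x3, x4, x5, x6, x7, x8, x9, x10, x11, x12, x13, x14, x15, x16, x17, x18, x19] ! 7 = x7"
  "[x0, x1, x2, x3, x4, x5, x6, x7, x8, x9, x10, x11, x12, x13, x14, x15, x16, x17, x18, x19] ! 8 = x8"
  "[x0, x1, x2, x3, x4, x5, x6, x7, x8, x9, x10, x11, x12, x13, x14, x15, x16, x17, x18, x19] ! 9 = x9"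
  "[x0, x1, x2, x3, x4, x5, x6, x7, x8, x9, x10, x11, x12, x13, x14, x15, x16, x17, x18, x19] ! 10 = x10"
  "[x0, x1, x2, x3, x4, x5, x6, x7, x8, x9, x10, x11, x12, x13, x14, x15, x16, x17, x18, x19] ! 11 = x11"
  "[x0, x1, x2, x3, x4, x5, x6, x7, x8, x9, x10, x11, x12, x13, x14, x15, x16, x17, x18, x19] ! 12 = x12"
  "[x0, x1, x2, x3, x4, x5, x6, x7, x8, x9, x10, x11, x12, x13, x14, x15, x16, x17, x18, x19] ! 13 = x13"
  "[x0, x1, x2, x3, x4, x5, x6, x7, x8, x9, x10, x11, x12, x13, x14, x15, x16, x17, x18, x19] ! 14 = x14"
  "[x0, x1, x2, x3, x4, x5, x6, x7, x8, x9, x10, x11, x12, x13, x14, x15, x16, x17, x18, x19] ! 15 = x15"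
  "[x0, x1, x2, x3, x4, x5, x6, x7, x8, x9, x10, x11, x12, x13, x14, x15, x16, x17, x18, x19] ! 16 = x16"
  "[x0, x1, x2, x3, x4, x5, x6, x7, x8, x9, x10, x11, x12, x13, x14, x15, x16, x17, x18, x19] ! 17 = x17"
  "[x0, x1, x2, x3, x4, x5, x6, x7, x8, x9, x10, x11, x12, x13, x14, x15, x16, x17, x18, x19] ! 18 = x18"
  "[x0, x1, x2, x3, x4, x5, x6, x7, x8, x9, x10, x11, x12, x13, x14, x15, x16, x17, x18, x19] ! 19 = x19"
  by simp_all

lemmas nth_list = nth_list_2 nth_list_4 nth_list_6 nth_list_20

lemma block_type_nth:
  "block_type 0 = 0" "block_type 1 = 1" "block_type 2 = 1" "block_type 3 = 2" "block_type 4 = 3" "block_type 5 = 3"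
  by (simp_all add: block_type_def)

lemma block_size_nth: "block_size 0 = 6" "block_size 1 = 4" "block_size 2 = 2" "block_size 3 = 2"
  by (simp_all add: block_size_def)

lemma block_endpoint_nth:
  "block_endpoint 0 = 0" "block_endpoint 1 = 1" "block_endpoint 2 = 2" "block_endpoint 3 = 2"
  by (simp_all add: block_endpoint_def)

lemmas block_shapes = all_less_6 all_less_4 all_less_2 block_type_nth block_size_nth block_endpoint_nth

text \<open>The two triples are the values of the type II seeds at u_1, u_2, u_3. Sum 0 keeps the
  chains away from layers 0 and 5, and turns the neighbour sum b + c at P_1 and Q_1 into -a.\<close>

locale seeded_graph = desargues adj + labelled_graph adj vs
  for adj :: "'v::finite \<Rightarrow> 'v \<Rightarrow> bool" and vs :: "'v list" +
  fixes a1 a2 a3 c1 c2 c3 :: complex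
  assumes sums: "a1 + a2 + a3 = 0" "c1 + c2 + c3 = 0"
    and real: "cnj a1 = a1" "cnj a2 = a2" "cnj a3 = a3" "cnj c1 = c1" "cnj c2 = c2" "cnj c3 = c3"
    and perp: "a1 * c1 + a2 * c2 + a3 * c3 = 0"
    and nonzero: "a1 \<noteq> 0 \<or> a2 \<noteq> 0 \<or> a3 \<noteq> 0" "c1 \<noteq> 0 \<or> c2 \<noteq> 0 \<or> c3 \<noteq> 0"
begin

text \<open>The triples (1, 1, 1), (2, -1, -1), (0, 1, -1) are orthogonal eigenvectors of I + J,
  with eigenvalues 4, 1, 1.\<close>

definition coords :: "nat \<Rightarrow> complex list list" where
  "coords s = [const_blocks, even_blocks a1 a2 a3, even_blocks c1 c2 c3,
     odd_blocks 1 1 1, odd_blocks 2 (- 1) (- 1), odd_blocks 0 1 (- 1)] ! s"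

lemma coords_nth:
  "coords 0 = const_blocks" "coords 1 = even_blocks a1 a2 a3" "coords 2 = even_blocks c1 c2 c3"
  "coords 3 = odd_blocks 1 1 1" "coords 4 = odd_blocks 2 (- 1) (- 1)" "coords 5 = odd_blocks 0 1 (- 1)"
  by (simp_all add: coords_def)

abbreviation bv :: "nat \<Rightarrow> nat \<Rightarrow> complex ^ 'v" where
  "bv s i \<equiv> lvec vs (coords s ! i)"

lemma bv_layered:
  assumes "s < 6" "j < block_size (block_type s)"
  shows "Estar adj (vs ! 0) k *v bv s j = (if k = block_endpoint (block_type s) + j then bv s j else 0)"
proof (rule Estar_lvec)
  have "\<forall>s<6. \<forall>j<block_size (block_type s). \<forall>i<20.
      layer ! i \<noteq> block_endpoint (block_type s) + j \<longrightarrow> coords s ! j ! i = 0"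
    unfolding block_shapes coords_nth const_blocks_def even_blocks_def odd_blocks_def layer_def
      all_less_20 list.pred_inject nth_list by simp
  then show "\<forall>i<20. layer ! i \<noteq> block_endpoint (block_type s) + j \<longrightarrow> coords s ! j ! i = 0"
    using assms by blast
qed

lemma bv_nonzero:
  assumes "s < 6" "j < block_size (block_type s)"
  shows "bv s j \<noteq> 0"
proof -
  have "\<forall>s<6. \<forall>j<block_size (block_type s). \<not> (\<forall>i<20. coords s ! j ! i = 0)"
    unfolding block_shapes coords_nth const_blocks_def even_blocks_def odd_blocks_def
      all_less_20 list.pred_inject nth_list using nonzero by simp
  then show ?thesis
    unfolding lvec_eq_0_iff using assms by blast
qed

lemma bv_act:
  assumes "s < 6" "j < block_size (block_type s)"
  shows "adj_matrix adj *v bv s j =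
    (\<Sum>i<block_size (block_type s). block_entry (block_type s) i j *s bv s i)"
proof (rule adj_matrix_lvec)
  \<comment> \<open>With the third value eliminated, the required equations become identities in the
    two remaining values.\<close>
  have a3: "a3 = - a1 - a2" and c3: "c3 = - c1 - c2"
    using sums by (simp_all add: eq_neg_iff_add_eq_0 algebra_simps)
  have "\<forall>s<6. \<forall>j<block_size (block_type s). \<forall>k<20. (\<Sum>m\<leftarrow>nbr_table ! k. coords s ! j ! m) =
      (\<Sum>i<block_size (block_type s). block_entry (block_type s) i j * (coords s ! i ! k))"
    unfolding block_shapes coords_nth const_blocks_def even_blocks_def odd_blocks_def nbr_table_def
      block_entry_def block_rows_def all_less_20 list.pred_inject sum_small nth_list list.map
      sum_list.Cons sum_list.Nil unfolding a3 c3 by simp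
  then show "\<forall>k<20. (\<Sum>m\<leftarrow>nbr_table ! k. coords s ! j ! m) =
      (\<Sum>i<block_size (block_type s). block_entry (block_type s) i j * (coords s ! i ! k))"
    using assms by blast
qed

text \<open>Different layers have disjoint supports. Inside a layer, an even chain against the
  constant one gives a multiple of \<open>sums\<close>, two even ones a multiple of
  \<open>perp\<close>; odd against even or constant cancels in pairs.\<close>

lemma bv_orthogonal:
  assumes s: "s < 6" "i < block_size (block_type s)" and s': "s' < 6" "j < block_size (block_type s')"
    and ne: "(s, i) \<noteq> (s', j)"
  shows "hinner (bv s i) (bv s' j) = 0"
proof (cases "block_endpoint (block_type s) + i = block_endpoint (block_type s') + j")
  case False
  then show ?thesis
    using hinner_layers[of adj "vs ! 0" "block_endpoint (block_type s) + i" "bv s i"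
        "block_endpoint (block_type s') + j" "bv s' j"] bv_layered[OF s] bv_layered[OF s'] by simp
next
  case True
  \<comment> \<open>The multiples of these relations that occur in layers 2 to 4.\<close>
  have multiples: "2 * w + (2 * z + 2 * y) = 0 \<and> - (2 * z) - 2 * y = 2 * w \<and> - (2 * y) - 2 * z = 2 * w \<and>
      4 * y + 4 * z + 4 * w = 0" if "y + z + w = 0" for y z w :: complex
  proof -
    have "w = - y - z"
      using that by (simp add: eq_neg_iff_add_eq_0 algebra_simps)
    then show ?thesis
      by simp
  qed
  have "\<forall>s<6. \<forall>s'<6. \<forall>i<block_size (block_type s). \<forall>j<block_size (block_type s').
      s < s' \<longrightarrow> block_endpoint (block_type s) + i = block_endpoint (block_type s') + j \<longrightarrow>
      (\<Sum>k<20. coords s ! i ! k * cnj (coords s' ! j ! k)) = 0"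
    unfolding block_shapes
    by (simp del: One_nat_def, unfold coords_nth const_blocks_def even_blocks_def odd_blocks_def
        sum_less_20 nth_list, simp,
      simp add: real sums perp multiples[OF sums(1)] multiples[OF sums(2)] multiples[OF perp])
  then have *: "hinner (bv s i) (bv s' j) = 0"
    if "s < 6" "i < block_size (block_type s)" "s' < 6" "j < block_size (block_type s')" "s < s'"
      "block_endpoint (block_type s) + i = block_endpoint (block_type s') + j" for s i s' j
    using that unfolding hinner_lvec by blast
  have "s < s' \<or> s' < s"
    by (cases "s = s'") (use True ne in auto)
  then show ?thesis
    using *[OF s s'] *[OF s' s] True hinner_eq_0_commute by metis
qed

sublocale ladder_blocks 6 block_type block_size bv adj "vs ! 0" block_endpoint block_entry
proof unfold_locales
  show "(\<Sum>s<6. block_size (block_type s)) = CARD('v)"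
    using desargues by (simp add: sum_small block_type_def block_size_def desargues_graph_def)
  have tab: "\<forall>s<6. 0 < block_size (block_type s) \<and>
      block_endpoint (block_type s) + block_size (block_type s) \<le> Suc 5 \<and>
      (\<forall>i<block_size (block_type s). Suc i < block_size (block_type s) \<longrightarrow>
        block_entry (block_type s) (Suc i) i \<noteq> 0 \<and> block_entry (block_type s) i (Suc i) \<noteq> 0)"
    unfolding block_shapes by (simp add: block_entry_def block_rows_def)
  show "0 < block_size (block_type s)" if "s < 6" for s
    using tab that by blast
  show "block_endpoint (block_type s) + block_size (block_type s) \<le> Suc (gdiam adj)" if "s < 6" for s
    using tab that unfolding gdiam by blast
  show "block_entry (block_type s) (Suc i) i \<noteq> 0" "block_entry (block_type s) i (Suc i) \<noteq> 0"
    if "s < 6" "Suc i < block_size (block_type s)" for s i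
    using tab that Suc_lessD by blast+
qed (fact bv_orthogonal bv_nonzero bv_act bv_layered)+

text \<open>Layer 0 meets type I only. Layers 1 and 2 meet also the types that start there;
  subtracting the diagonal units of the earlier types, which are available by then, leaves the new
  seeds.\<close>

lemma corner_units:
  assumes "s < 6"
  shows "\<exists>E. is_unit E (block_type s) 0 0"
proof -
  have Es: "Estar adj (vs ! 0) k \<in> T" if "k \<le> 5" for k
    using that by (intro Estar_in_terwilliger) (simp add: gdiam)
  note alg = matrix_subalgebra_terwilliger[of adj "vs ! 0"]
  have "\<forall>s<6. \<forall>k<block_size (block_type s).
      (if 0 = block_endpoint (block_type s) + k then bv s k else 0) =
      (if block_type s = 0 \<and> k = 0 then bv s 0 else 0)"
    unfolding block_shapes by simp
  then have unit0: "is_unit (Estar adj (vs ! 0) 0) 0 0 0"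
    using Es[of 0] layered unfolding is_unit_def by simp
  obtain E11 E22 where E: "is_unit E11 0 1 1" "is_unit E22 0 2 2"
    using all_units[of "Estar adj (vs ! 0) 0" 0 1 1, unfolded block_type_nth block_size_nth]
      all_units[of "Estar adj (vs ! 0) 0" 0 2 2, unfolded block_type_nth block_size_nth] unit0 by auto
  have "\<forall>s<6. \<forall>k<block_size (block_type s).
      (if 1 = block_endpoint (block_type s) + k then bv s k else 0) -
      (if block_type s = 0 \<and> k = 1 then bv s 1 else 0) =
      (if block_type s = 1 \<and> k = 0 then bv s 0 else 0)"
    unfolding block_shapes by simp
  then have unit1: "is_unit (Estar adj (vs ! 0) 1 - E11) 1 0 0"
    using Es[of 1] E(1) layered alg unfolding is_unit_def
    by (simp add: matrix_subalgebra_diff matrix_vector_mult_diff_rdistrib)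
  obtain F11 where F: "is_unit F11 1 1 1"
    using all_units[of "Estar adj (vs ! 0) 1 - E11" 1 1 1, unfolded block_type_nth block_size_nth]
      unit1 by auto
  \<comment> \<open>The projection onto the seeds of types III and IV together.\<close>
  define G where "G = Estar adj (vs ! 0) 2 - E22 - F11"
  have "\<forall>s<6. \<forall>k<block_size (block_type s).
      (if 2 = block_endpoint (block_type s) + k then bv s k else 0) -
      (if block_type s = 0 \<and> k = 2 then bv s 2 else 0) -
      (if block_type s = 1 \<and> k = 1 then bv s 1 else 0) =
      (if block_type s \<ge> 2 \<and> k = 0 then bv s 0 else 0)"
    unfolding block_shapes by simp
  then have G: "G \<in> T" "\<And>s k. s < 6 \<Longrightarrow> k < block_size (block_type s) \<Longrightarrow>
      G *v bv s k = (if block_type s \<ge> 2 \<and> k = 0 then bv s 0 else 0)"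
    using Es[of 2] E(2) F layered alg unfolding is_unit_def G_def
    by (simp_all add: matrix_subalgebra_diff matrix_vector_mult_diff_rdistrib)
  \<comment> \<open>\<open>H\<close> is 4 on the seed of type III and 1 on the seeds of type IV, which separates them.\<close>
  define H where "H = G ** (A ** (Estar adj (vs ! 0) 3 ** (A ** G)))"
  have HT: "H \<in> T"
    unfolding H_def using G(1) Es alg
    by (intro matrix_subalgebra_mult adj_matrix_in_terwilliger) simp_all
  have H: "H *v bv s k = (if block_type s \<ge> 2 \<and> k = 0 then (if block_type s = 2 then 4 else 1) *s bv s 0 else 0)"
    if s: "s < 6" and k: "k < block_size (block_type s)" for s k
  proof (cases "block_type s \<ge> 2 \<and> k = 0")
    case True
    have "\<forall>s<6. block_type s \<ge> 2 \<longrightarrow> block_size (block_type s) = 2 \<and> block_endpoint (block_type s) = 2 \<and>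
        block_entry (block_type s) 1 0 = 1 \<and> block_entry (block_type s) 0 0 = 0 \<and> block_entry (block_type s) 1 1 = 0 \<and>
        block_entry (block_type s) 0 1 = (if block_type s = 2 then 4 else 1)"
      unfolding block_shapes by (simp add: block_entry_def block_rows_def)
    then have t: "block_size (block_type s) = 2" "block_endpoint (block_type s) = 2"
      "block_entry (block_type s) 1 0 = 1" "block_entry (block_type s) 0 0 = 0"
      "block_entry (block_type s) 1 1 = 0"
      "block_entry (block_type s) 0 1 = (if block_type s = 2 then 4 else 1)"
      using True s by blast+
    have "A *v bv s 0 = bv s 1" "A *v bv s 1 = (if block_type s = 2 then 4 else 1) *s bv s 0"
      using act[OF s, of 0] act[OF s, of 1] by (simp_all only: t sum_less_2) simp_all
    moreover have "Estar adj (vs ! 0) 3 *v bv s 1 = bv s 1"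
      using layered[OF s, of 1 3] by (simp add: t)
    moreover have "G *v bv s 0 = bv s 0"
      using G(2)[OF s, of 0] True t by simp
    ultimately show ?thesis
      using True unfolding H_def by (simp add: matrix_vector_mul_assoc[symmetric] vec.scale)
  next
    case False
    then show ?thesis
      using G(2)[OF s k] unfolding H_def by (auto simp: matrix_vector_mul_assoc[symmetric])
  qed
  \<comment> \<open>\<open>H - G\<close> is 4 - 1 = 3 on the seed of type III and 0 on those of type
    IV.\<close>
  let ?E2 = "cmat_scale (1 / 3) (H - G)"
  have unit2: "is_unit ?E2 2 0 0"
    unfolding is_unit_def
  proof (intro conjI allI impI)
    show "?E2 \<in> T"
      using HT G(1) alg by (intro matrix_subalgebra_scale matrix_subalgebra_diff)
    show "?E2 *v bv s k = (if block_type s = 2 \<and> k = 0 then bv s 0 else 0)"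
      if "s < 6" "k < block_size (block_type s)" for s k
    proof -
      have "(4 / 3) *s bv s 0 - (1 / 3) *s bv s 0 = bv s 0"
        by (simp add: Finite_Cartesian_Product.vec_eq_iff)
      then show ?thesis
        using that by (auto simp: cmat_scale_mult_vec matrix_vector_mult_diff_rdistrib H G(2) vector_smult_assoc)
    qed
  qed
  have unit3: "is_unit (G - ?E2) 3 0 0"
    unfolding is_unit_def
  proof (intro conjI allI impI)
    show "G - ?E2 \<in> T"
      using unit2 G(1) alg by (auto simp: is_unit_def intro: matrix_subalgebra_diff)
    show "(G - ?E2) *v bv s k = (if block_type s = 3 \<and> k = 0 then bv s 0 else 0)"
      if s: "s < 6" "k < block_size (block_type s)" for s k
    proof -
      have "\<forall>s<6. block_type s \<ge> 2 \<longleftrightarrow> block_type s = 2 \<or> block_type s = 3"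
        unfolding all_less_6 by (simp add: block_type_def)
      then have *: "block_type s \<ge> 2 \<longleftrightarrow> block_type s = 2 \<or> block_type s = 3"
        using s by blast
      have E2: "?E2 *v bv s k = (if block_type s = 2 \<and> k = 0 then bv s 0 else 0)"
        using unit2 s unfolding is_unit_def by blast
      show ?thesis
        unfolding matrix_vector_mult_diff_rdistrib E2 G(2)[OF s] * by auto
    qed
  qed
  have "\<forall>s<6. block_type s = 0 \<or> block_type s = 1 \<or> block_type s = 2 \<or> block_type s = 3"
    unfolding all_less_6 by (simp add: block_type_def)
  then have "block_type s = 0 \<or> block_type s = 1 \<or> block_type s = 2 \<or> block_type s = 3"
    using assms by blast
  then show ?thesis
    using unit0 unit1 unit2 unit3 by metis
qed

sublocale block_algebra 6 block_type block_size bv "terwilliger adj (vs ! 0)"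
  by (rule block_algebraI[OF corner_units])

lemma multiplicity:
  assumes "s < 6"
  shows "module_multiplicity T (block s) = [1, 2, 1, 2] ! block_type s"
proof -
  have count: "card {s'. s' < 6 \<and> P s'} = (\<Sum>s'<6. if P s' then 1 else 0)" for P :: "nat \<Rightarrow> bool"
    by (simp add: sum.If_cases Int_def)
  have "\<forall>s<6. card {s'. s' < 6 \<and> block_type s' = block_type s} = [1, 2, 1, 2] ! block_type s"
    unfolding count sum_small block_shapes by simp
  then show ?thesis
    using module_multiplicity_block[OF assms] assms by simp
qed

lemma matrix_of_block:
  assumes "s < 6" "block_type s = l"
  shows "represents (mat_of_rows_list (block_size l) (block_rows l)) A (map (bv s) [0..<block_size l])"
    and "{\<theta>. eigenvalue (mat_of_rows_list (block_size l) (block_rows l)) \<theta>} = block_eigenvalues l"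
proof -
  have "\<forall>s<6. block_type s < 4"
    unfolding block_shapes by simp
  then have l: "block_type s < 4" "l < 4"
    using assms by auto
  show "represents (mat_of_rows_list (block_size l) (block_rows l)) A (map (bv s) [0..<block_size l])"
    using represents_block[OF assms(1) block_matrix[OF l(1)]] assms(2) by simp
  show "{\<theta>. eigenvalue (mat_of_rows_list (block_size l) (block_rows l)) \<theta>} = block_eigenvalues l"
    by (rule block_matrix_eigenvalues[OF l(2)])
qed

lemma estar_bv:
  assumes "k < 6"
  shows "bv 0 k = estar adj (vs ! 0) k"
proof -
  have "\<forall>k<6. \<forall>i<20. coords 0 ! k ! i = (if layer ! i = k then 1 else 0)"
    unfolding all_less_6 all_less_20 coords_nth const_blocks_def layer_def list.pred_inject nth_list by simp
  then show ?thesis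
    using estar_lvec assms by metis
qed

lemma type_I:
  "endpoint adj (vs ! 0) (block 0) = 0 \<and> module_multiplicity T (block 0) = 1 \<and> vec.dim (block 0) = 6 \<and>
   module_diameter adj (vs ! 0) (block 0) = 5 \<and>
   module_shape adj (vs ! 0) (block 0) = [1, 1, 1, 1, 1, 1] \<and>
   pure_basis adj (vs ! 0) (block 0) (map (estar adj (vs ! 0)) [0..<6]) \<and>
   (let B = mat_of_rows_list 6
        [[0, 3, 0, 0, 0, 0],
         [1, 0, 2, 0, 0, 0],
         [0, 1, 0, 2, 0, 0],
         [0, 0, 2, 0, 1, 0],
         [0, 0, 0, 2, 0, 1],
         [0, 0, 0, 0, 3, 0]]
    in represents B A (map (estar adj (vs ! 0)) [0..<6]) \<and>
       {\<theta>. eigenvalue B \<theta>} = {3, 2, 1, - 1, - 2, - 3})"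
proof -
  have map: "map (bv 0) [0..<6] = map (estar adj (vs ! 0)) [0..<6]"
    by (rule map_cong) (simp_all add: estar_bv)
  have t: "block_type 0 = 0" "block_size 0 = 6" "block_endpoint 0 = 0"
    by (simp_all only: block_shapes)
  have "block_rows 0 = [[0, 3, 0, 0, 0, 0], [1, 0, 2, 0, 0, 0], [0, 1, 0, 2, 0, 0],
      [0, 0, 2, 0, 1, 0], [0, 0, 0, 2, 0, 1], [0, 0, 0, 0, 3, 0]]"
    "block_eigenvalues 0 = {3, 2, 1, - 1, - 2, - 3}"
    by (simp_all add: block_rows_def block_eigenvalues_def)
  then show ?thesis
    using endpoint_block[of 0] multiplicity[of 0] dim_block[of 0] module_diameter_block[of 0]
      module_shape_block[of 0] pure_basis_block[of 0] matrix_of_block[of 0 0] map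
    by (simp add: t Let_def numeral_eq_Suc)
qed

lemma type_II:
  assumes s: "s < 6" and l: "block_type s = 1" and ess: "essential_part zs (bv s 0) = cs"
  shows "endpoint adj (vs ! 0) (block s) = 1 \<and> module_multiplicity T (block s) = 2 \<and>
    vec.dim (block s) = 4 \<and> module_diameter adj (vs ! 0) (block s) = 3 \<and>
    module_shape adj (vs ! 0) (block s) = [1, 1, 1, 1] \<and>
    (\<exists>\<nu>. seed_vector adj (vs ! 0) (block s) zs cs \<nu> \<and>
      A *v \<nu> = Estar adj (vs ! 0) 2 *v (A *v \<nu>) \<and>
      (let us = [\<nu>, A *v \<nu>, Estar adj (vs ! 0) 3 *v (A *v (A *v \<nu>)),
                 Estar adj (vs ! 0) 4 *v (A *v (A *v (A *v \<nu>)))];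
           B = mat_of_rows_list 4
             [[0, 2, 0, 0],
              [1, 0, 1, 0],
              [0, 1, 0, 2],
              [0, 0, 1, 0]]
       in pure_basis adj (vs ! 0) (block s) us \<and> represents B A us \<and>
          {\<theta>. eigenvalue B \<theta>} = {2, 1, - 1, - 2}))"
proof -
  have t: "block_size 1 = 4" "block_endpoint 1 = 1"
    by (simp_all only: block_shapes)
  have rows: "block_rows 1 = [[0, 2, 0, 0], [1, 0, 1, 0], [0, 1, 0, 2], [0, 0, 1, 0]]"
    "block_eigenvalues 1 = {2, 1, - 1, - 2}"
    by (simp_all add: block_rows_def block_eigenvalues_def)
  have A: "A *v bv s j = (\<Sum>i<4. block_entry 1 i j *s bv s i)" if "j < 4" for j
    using act[OF s, of j] that by (simp only: l t)
  have A0: "A *v bv s 0 = bv s 1"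
    using A[of 0] unfolding sum_small block_entry_def rows nth_list by simp
  have A1: "A *v bv s 1 = 2 *s bv s 0 + bv s 2"
    using A[of 1] unfolding sum_small block_entry_def rows nth_list by simp
  have A2: "A *v bv s 2 = bv s 1 + bv s 3"
    using A[of 2] unfolding sum_small block_entry_def rows nth_list by simp
  have E: "Estar adj (vs ! 0) k *v bv s j = (if k = 1 + j then bv s j else 0)" if "j < 4" for k j
    using layered[OF s, of j k] that by (simp only: l t)
  have E2: "Estar adj (vs ! 0) 2 *v bv s 1 = bv s 1"
    using E[of 1 2] by simp
  have E3: "Estar adj (vs ! 0) 3 *v (A *v (A *v bv s 0)) = bv s 2"
    unfolding A0 A1 using E[of 0 3] E[of 2 3] by (simp add: vec.add vec.scale)
  have AAA: "A *v (A *v (A *v bv s 0)) = 2 *s bv s 1 + (bv s 1 + bv s 3)"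
    unfolding A0 A1 by (simp only: vec.add vec.scale A0 A2)
  have E4: "Estar adj (vs ! 0) 4 *v (A *v (A *v (A *v bv s 0))) = bv s 3"
    unfolding AAA using E[of 1 4] E[of 3 4] by (simp add: vec.add vec.scale)
  have "[0..<4] = [0, 1, 2, 3]"
    by (simp add: upt_rec)
  then have map: "map (bv s) [0..<4] = [bv s 0, A *v bv s 0, Estar adj (vs ! 0) 3 *v (A *v (A *v bv s 0)),
      Estar adj (vs ! 0) 4 *v (A *v (A *v (A *v bv s 0)))]"
    unfolding E3 E4 unfolding A0 by simp
  have "seed_vector adj (vs ! 0) (block s) zs cs (bv s 0)"
    by (rule seed_vector_block[OF s ess])
  moreover have "A *v bv s 0 = Estar adj (vs ! 0) 2 *v (A *v bv s 0)"
    unfolding A0 E2 ..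
  moreover have "pure_basis adj (vs ! 0) (block s) (map (bv s) [0..<4])"
    using pure_basis_block[OF s] unfolding l t .
  moreover note matrix_of_block[OF s l, unfolded t rows]
  moreover have "endpoint adj (vs ! 0) (block s) = 1" "vec.dim (block s) = 4"
    using endpoint_block[OF s] dim_block[OF s] unfolding l t by simp_all
  moreover have "module_multiplicity T (block s) = 2"
    using multiplicity[OF s] unfolding l by simp
  moreover have "module_diameter adj (vs ! 0) (block s) = 3" "module_shape adj (vs ! 0) (block s) = [1, 1, 1, 1]"
    using module_diameter_block[OF s] module_shape_block[OF s] unfolding l t by (simp_all add: numeral_eq_Suc)
  ultimately show ?thesis
    unfolding Let_def map by blast
qed

lemma type_III_IV:
  assumes s: "s < 6" and l: "block_type s = l" "l = 2 \<or> l = 3"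
    and ess: "essential_part ys (bv s 0) = cs"
  shows "endpoint adj (vs ! 0) (block s) = 2 \<and> module_multiplicity T (block s) = [1, 2, 1, 2] ! l \<and>
    vec.dim (block s) = 2 \<and> module_diameter adj (vs ! 0) (block s) = 1 \<and>
    module_shape adj (vs ! 0) (block s) = [1, 1] \<and>
    (\<exists>\<nu>. seed_vector adj (vs ! 0) (block s) ys cs \<nu> \<and>
      A *v \<nu> = Estar adj (vs ! 0) 3 *v (A *v \<nu>) \<and>
      (let us = [\<nu>, A *v \<nu>]; B = mat_of_rows_list 2 (block_rows l)
       in pure_basis adj (vs ! 0) (block s) us \<and> represents B A us \<and>
          {\<theta>. eigenvalue B \<theta>} = block_eigenvalues l))"
proof -
  have t: "block_size l = 2" "block_endpoint l = 2"
    using l(2) by (auto simp: block_size_nth block_endpoint_nth)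
  have entries: "block_entry l 0 0 = 0" "block_entry l 1 0 = 1"
    using l(2) by (auto simp: block_entry_def block_rows_def)
  have A0: "A *v bv s 0 = bv s 1"
    using act[OF s, of 0] unfolding l(1) t sum_small entries by simp
  have E3: "Estar adj (vs ! 0) 3 *v bv s 1 = bv s 1"
    using layered[OF s, of 1 3] unfolding l(1) t by simp
  have "[0..<2] = [0, 1]"
    by (simp add: upt_rec)
  then have map: "map (bv s) [0..<2] = [bv s 0, A *v bv s 0]"
    unfolding A0 by simp
  have "seed_vector adj (vs ! 0) (block s) ys cs (bv s 0)"
    by (rule seed_vector_block[OF s ess])
  moreover have "A *v bv s 0 = Estar adj (vs ! 0) 3 *v (A *v bv s 0)"
    unfolding A0 E3 ..
  moreover have "pure_basis adj (vs ! 0) (block s) (map (bv s) [0..<2])"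
    using pure_basis_block[OF s] unfolding l(1) t .
  moreover note matrix_of_block[OF s l(1), unfolded t]
  moreover have "endpoint adj (vs ! 0) (block s) = 2" "vec.dim (block s) = 2"
    using endpoint_block[OF s] dim_block[OF s] unfolding l(1) t by simp_all
  moreover have "module_multiplicity T (block s) = [1, 2, 1, 2] ! l"
    using multiplicity[OF s] unfolding l(1) by simp
  moreover have "module_diameter adj (vs ! 0) (block s) = 1" "module_shape adj (vs ! 0) (block s) = [1, 1]"
    using module_diameter_block[OF s] module_shape_block[OF s] unfolding l(1) t by (simp_all add: numeral_eq_Suc)
  ultimately show ?thesis
    unfolding Let_def map by blast
qed

text \<open>The types I to IV have 1, 2, 1, 2 chains. For instance 2 occurs in I, II and III, giving
  1 + 2 + 1 = 4, and 1 in I, II and IV, giving 1 + 2 + 2 = 5.\<close>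

lemma spectrum:
  "spectrum_mult A = {(3, 1), (2, 4), (1, 5), (- 1, 5), (- 2, 4), (- 3, 1)}"
proof -
  define N where "N \<theta> = (\<Sum>s<6. if \<theta> \<in> block_eigenvalues (block_type s) then 1 else 0 :: nat)" for \<theta>
  have dim: "vec.dim {v. A *v v = \<theta> *s v} = N \<theta>" for \<theta>
  proof -
    have "\<forall>s<6. block_type s < 4"
      unfolding block_shapes by simp
    then have lt: "block_type s < 4" if "s < 6" for s
      using that by blast
    have "vec.dim {v. A *v v = \<theta> *s v} = card {s. s < 6 \<and> \<theta> \<in> block_eigenvalues (block_type s)}"
      by (rule dim_eigenspace[where y = "\<lambda>l. block_eigenvector l \<theta>"])
        (use block_eigen_equation block_eigenvector_0 lt in auto)
    also have "\<dots> = N \<theta>"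
      unfolding N_def by (simp add: sum.If_cases Int_def)
    finally show ?thesis .
  qed
  have "(\<exists>v. v \<noteq> 0 \<and> A *v v = \<theta> *s v) \<longleftrightarrow> N \<theta> \<noteq> 0" for \<theta>
    unfolding dim[symmetric] vec.dim_eq_0 by auto
  then have "spectrum_mult A = {(\<theta>, N \<theta>) | \<theta>. N \<theta> \<noteq> 0}"
    unfolding spectrum_mult_def dim by simp
  moreover have N: "N \<theta> = (if \<theta> \<in> {3, 2, 1, - 1, - 2, - 3} then 1 else 0) +
      2 * (if \<theta> \<in> {2, 1, - 1, - 2} then 1 else 0) + (if \<theta> \<in> {2, - 2} then 1 else 0) +
      2 * (if \<theta> \<in> {1, - 1} then 1 else 0)" for \<theta>
    unfolding N_def sum_small block_type_nth by (simp add: block_eigenvalues_def)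
  moreover have "{(\<theta>, N \<theta>) | \<theta>. N \<theta> \<noteq> 0} = (\<lambda>\<theta>. (\<theta>, N \<theta>)) ` {3, 2, 1, - 1, - 2, - 3}"
    unfolding N by (auto split: if_splits)
  moreover have "N 3 = 1" "N 2 = 4" "N 1 = 5" "N (- 1) = 5" "N (- 2) = 4" "N (- 3) = 1"
    unfolding N by simp_all
  ultimately show ?thesis
    by simp
qed

lemma dim_terwilliger: "cmat.dim T = 60"
proof -
  have "{..<6} = {0, 1, 2, 3, 4, 5 :: nat}"
    by auto
  then have "block_type ` {..<6} = {0, 1, 2, 3}"
    by (simp only: image_insert image_empty block_type_nth) auto
  then show ?thesis
    unfolding dim_algebra by (simp add: block_size_nth del: One_nat_def)
qed

text \<open>The order \<open>zs\<close> enters only through the essential parts of the two type II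
  seeds.\<close>

lemma decomposition:
  assumes zs: "essential_part zs (bv 1 0) = [1, - 1, 0]" "essential_part zs (bv 2 0) = [1, 1, - 2]"
    and ys: "ys = [vs ! 4, vs ! 5, vs ! 6, vs ! 7, vs ! 8, vs ! 9]"
  shows "desargues_decomposition adj (vs ! 0) zs ys"
proof -
  let ?Ws = "[block 0, block 1, block 2, block 3, block 4, block 5]"
  have upt: "[0..<6] = [0, 1, 2, 3, 4, 5]"
    by (simp add: upt_rec)
  have Ws: "map block [0..<6] = ?Ws"
    unfolding upt by simp
  have dec: "orthogonal_decomposition T ?Ws"
    using orthogonal_decomposition_blocks unfolding Ws .
  have iso: "\<forall>i<6. \<forall>j<6. module_iso T (?Ws ! i) (?Ws ! j) \<longleftrightarrow>
      [1, 2, 2, 3, 4, 4 :: nat] ! i = [1, 2, 2, 3, 4, 4] ! j"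
  proof (intro allI impI)
    fix i j :: nat assume ij: "i < 6" "j < 6"
    have "?Ws ! i = block i" "?Ws ! j = block j"
      unfolding Ws[symmetric] using ij by simp_all
    moreover have "\<forall>i<6. \<forall>j<6. block_type i = block_type j \<longleftrightarrow>
      [1, 2, 2, 3, 4, 4 :: nat] ! i = [1, 2, 2, 3, 4, 4] ! j"
      unfolding block_shapes nth_list by simp
    ultimately show "module_iso T (?Ws ! i) (?Ws ! j) \<longleftrightarrow>
        [1, 2, 2, 3, 4, 4 :: nat] ! i = [1, 2, 2, 3, 4, 4] ! j"
      using block_iso_iff[OF ij] ij by metis
  qed
  have ess: "essential_part ys (bv 3 0) = [1, - 1, 1, - 1, 1, - 1]"
    "essential_part ys (bv 4 0) = [2, - 2, - 1, 1, - 1, 1]"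
    "essential_part ys (bv 5 0) = [0, 0, 1, - 1, - 1, 1]"
    unfolding ys essential_part_def coords_nth odd_blocks_def list.map nth_list by (simp_all add: lvec_nth)
  have small: "1 < (6 :: nat)" "2 < (6 :: nat)" "3 < (6 :: nat)" "4 < (6 :: nat)" "5 < (6 :: nat)"
    by simp_all
  have types: "block_type 1 = 1" "block_type 2 = 1" "block_type 3 = 2" "block_type 4 = 3" "block_type 5 = 3"
    by (fact block_type_nth)+
  have rows: "block_rows 2 = [[0, 4], [1, 0]]" "block_rows 3 = [[0, 1], [1, 0]]"
    "block_eigenvalues 2 = {2, - 2}" "block_eigenvalues 3 = {1, - 1}" "[1, 2, 1, 2] ! 2 = (1 :: nat)"
    "[1, 2, 1, 2] ! 3 = (2 :: nat)"
    by (simp_all add: block_rows_def block_eigenvalues_def)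
  note II = type_II[OF small(1) types(1) zs(1)] type_II[OF small(2) types(2) zs(2)]
  note III = type_III_IV[OF small(3) types(3) disjI1[OF refl] ess(1), unfolded rows]
  note IV = type_III_IV[OF small(4) types(4) disjI2[OF refl] ess(2), unfolded rows]
    type_III_IV[OF small(5) types(5) disjI2[OF refl] ess(3), unfolded rows]
  show ?thesis
    unfolding desargues_decomposition_def
    by (rule exI[of _ "block 0"], rule exI[of _ "block 1"], rule exI[of _ "block 2"],
        rule exI[of _ "block 3"], rule exI[of _ "block 4"], rule exI[of _ "block 5"],
        intro conjI[OF dec] conjI[OF iso] conjI[OF type_I])
      (simp only: ball_simps split_paired_all prod.case II III IV simp_thms)
qed

end

section \<open>Arbitrary orders of the first layer\<close>

lemma sphere_1_labels:
  assumes "labelling adj vs"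
  shows "sphere_at adj 1 (vs ! 0) = {vs ! 1, vs ! 2, vs ! 3}"
proof -
  interpret labelled_graph adj vs
    by unfold_locales (rule assms)
  have "\<forall>i<20. layer ! i = 1 \<longleftrightarrow> i = 1 \<or> i = 2 \<or> i = 3"
    unfolding all_less_20 list.pred_inject layer_def nth_list by simp
  then have "gdist adj (vs ! 0) (vs ! i) = 1 \<longleftrightarrow> i = 1 \<or> i = 2 \<or> i = 3" if "i < 20" for i
    using gdist_label[OF that] that by simp
  moreover have "\<exists>i<20. y = vs ! i" for y
    using labels by (metis UNIV_I in_set_conv_nth)
  ultimately show ?thesis
    unfolding sphere_at_def by (auto, metis)
qed

lemma ordering_of_three:
  assumes "length zs = 3" "ordering_of zs {a, b, c}"
  shows "zs \<in> {[a, b, c], [a, c, b], [b, a, c], [b, c, a], [c, a, b], [c, b, a]}"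
proof -
  obtain u v w where zs: "zs = [u, v, w]"
    using assms(1) by (auto simp: length_Suc_conv numeral_eq_Suc)
  then have eq: "{u, v, w} = {a, b, c}" and ne: "u \<noteq> v" "u \<noteq> w" "v \<noteq> w"
    using assms(2) by (simp_all add: ordering_of_def)
  from eq have "u = a \<or> u = b \<or> u = c" "v = a \<or> v = b \<or> v = c" "w = a \<or> w = b \<or> w = c"
    by blast+
  then show ?thesis
    using ne unfolding zs by auto
qed

text \<open>\<open>zs\<close> is one of six permutations of the labels 1, 2, 3. The parameters in
  each case are (1, -1, 0) and (1, 1, -2) rearranged from the order \<open>zs\<close> into label
  order.\<close>

lemma desargues_decomposition_labelled:
  assumes "desargues_graph adj" "labelling adj vs" "length zs = 3" "ordering_of zs (sphere_at adj 1 (vs ! 0))"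
  shows "desargues_decomposition adj (vs ! 0) zs [vs ! 4, vs ! 5, vs ! 6, vs ! 7, vs ! 8, vs ! 9]"
proof -
  interpret labelled_graph adj vs
    by unfold_locales (rule assms)
  have *: "desargues_decomposition adj (vs ! 0) zs [vs ! 4, vs ! 5, vs ! 6, vs ! 7, vs ! 8, vs ! 9]"
    if "a1 + a2 + a3 = 0" "c1 + c2 + c3 = 0"
      "cnj a1 = a1" "cnj a2 = a2" "cnj a3 = a3" "cnj c1 = c1" "cnj c2 = c2" "cnj c3 = c3"
      "a1 * c1 + a2 * c2 + a3 * c3 = 0" "a1 \<noteq> 0 \<or> a2 \<noteq> 0 \<or> a3 \<noteq> 0" "c1 \<noteq> 0 \<or> c2 \<noteq> 0 \<or> c3 \<noteq> 0"
      "essential_part zs (lvec vs (even_blocks a1 a2 a3 ! 0)) = [1, - 1, 0]"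
      "essential_part zs (lvec vs (even_blocks c1 c2 c3 ! 0)) = [1, 1, - 2]"
    for a1 a2 a3 c1 c2 c3
  proof -
    interpret seeded_graph adj vs a1 a2 a3 c1 c2 c3
      by unfold_locales (use assms that in auto)
    show ?thesis
      using decomposition[OF _ _ refl] that(12,13) unfolding coords_nth by blast
  qed
  have "zs \<in> {[vs ! 1, vs ! 2, vs ! 3], [vs ! 1, vs ! 3, vs ! 2], [vs ! 2, vs ! 1, vs ! 3],
      [vs ! 2, vs ! 3, vs ! 1], [vs ! 3, vs ! 1, vs ! 2], [vs ! 3, vs ! 2, vs ! 1]}"
    using assms(3,4) unfolding sphere_1_labels[OF assms(2)] by (rule ordering_of_three)
  then consider "zs = [vs ! 1, vs ! 2, vs ! 3]" | "zs = [vs ! 1, vs ! 3, vs ! 2]"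
    | "zs = [vs ! 2, vs ! 1, vs ! 3]" | "zs = [vs ! 2, vs ! 3, vs ! 1]"
    | "zs = [vs ! 3, vs ! 1, vs ! 2]" | "zs = [vs ! 3, vs ! 2, vs ! 1]"
    unfolding insert_iff empty_iff by blast
  then show ?thesis
  proof cases
    case 1
    show ?thesis
      by (rule *[of 1 "- 1" 0 1 1 "- 2"]) (simp_all add: 1 essential_part_def even_blocks_def lvec_nth)
  next
    case 2
    show ?thesis
      by (rule *[of 1 0 "- 1" 1 "- 2" 1]) (simp_all add: 2 essential_part_def even_blocks_def lvec_nth)
  next
    case 3
    show ?thesis
      by (rule *[of "- 1" 1 0 1 1 "- 2"]) (simp_all add: 3 essential_part_def even_blocks_def lvec_nth)
  next
    case 4
    show ?thesis
      by (rule *[of 0 1 "- 1" "- 2" 1 1]) (simp_all add: 4 essential_part_def even_blocks_def lvec_nth)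
  next
    case 5
    show ?thesis
      by (rule *[of "- 1" 0 1 1 "- 2" 1]) (simp_all add: 5 essential_part_def even_blocks_def lvec_nth)
  next
    case 6
    show ?thesis
      by (rule *[of 0 "- 1" 1 "- 2" 1 1]) (simp_all add: 6 essential_part_def even_blocks_def lvec_nth)
  qed
qed

theorem mainTheorem10:
  fixes adj :: "'v::finite \<Rightarrow> 'v \<Rightarrow> bool" and x :: 'v
  assumes "desargues_graph adj"
  defines "A \<equiv> adj_matrix adj"
  defines "T \<equiv> terwilliger adj x"
  shows
    "spectrum_mult A = {(3, 1), (2, 4), (1, 5), (- 1, 5), (- 2, 4), (- 3, 1)} \<and>
     (\<exists>zs. length zs = 3 \<and> ordering_of zs (sphere_at adj 1 x)) \<and>
     (\<exists>ys. admissible_order2 adj x ys) \<and>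
     (\<forall>zs ys. length zs = 3 \<and> ordering_of zs (sphere_at adj 1 x) \<and> admissible_order2 adj x ys \<longrightarrow>
       (\<exists>W0 W1a W1b W2a W2b W2c.
          orthogonal_decomposition T [W0, W1a, W1b, W2a, W2b, W2c] \<and>
          (\<forall>i<6. \<forall>j<6.
             module_iso T ([W0, W1a, W1b, W2a, W2b, W2c] ! i) ([W0, W1a, W1b, W2a, W2b, W2c] ! j)
             \<longleftrightarrow> [1, 2, 2, 3, 4, 4 :: nat] ! i = [1, 2, 2, 3, 4, 4] ! j) \<and>
          (endpoint adj x W0 = 0 \<and> module_multiplicity T W0 = 1 \<and> vec.dim W0 = 6 \<and>
           module_diameter adj x W0 = 5 \<and> module_shape adj x W0 = [1, 1, 1, 1, 1, 1] \<and>
           pure_basis adj x W0 (map (estar adj x) [0..<6]) \<and>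
           (let B = mat_of_rows_list 6
                  [[0, 3, 0, 0, 0, 0],
                   [1, 0, 2, 0, 0, 0],
                   [0, 1, 0, 2, 0, 0],
                   [0, 0, 2, 0, 1, 0],
                   [0, 0, 0, 2, 0, 1],
                   [0, 0, 0, 0, 3, 0]]
            in represents B A (map (estar adj x) [0..<6]) \<and>
               {\<theta>. eigenvalue B \<theta>} = {3, 2, 1, - 1, - 2, - 3})) \<and>
          (\<forall>(W, cs) \<in> {(W1a, [1, - 1, 0]), (W1b, [1, 1, - 2])}.
             endpoint adj x W = 1 \<and> module_multiplicity T W = 2 \<and> vec.dim W = 4 \<and>
             module_diameter adj x W = 3 \<and> module_shape adj x W = [1, 1, 1, 1] \<and>
             (\<exists>\<nu>. seed_vector adj x W zs cs \<nu> \<and>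
                A *v \<nu> = Estar adj x 2 *v (A *v \<nu>) \<and>
                (let vs = [\<nu>, A *v \<nu>, Estar adj x 3 *v (A *v (A *v \<nu>)),
                           Estar adj x 4 *v (A *v (A *v (A *v \<nu>)))];
                     B = mat_of_rows_list 4
                       [[0, 2, 0, 0],
                        [1, 0, 1, 0],
                        [0, 1, 0, 2],
                        [0, 0, 1, 0]]
                 in pure_basis adj x W vs \<and> represents B A vs \<and>
                    {\<theta>. eigenvalue B \<theta>} = {2, 1, - 1, - 2}))) \<and>
          (endpoint adj x W2a = 2 \<and> module_multiplicity T W2a = 1 \<and> vec.dim W2a = 2 \<and>
           module_diameter adj x W2a = 1 \<and> module_shape adj x W2a = [1, 1] \<and>
           (\<exists>\<nu>. seed_vector adj x W2a ys [1, - 1, 1, - 1, 1, - 1] \<nu> \<and>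
              A *v \<nu> = Estar adj x 3 *v (A *v \<nu>) \<and>
              (let vs = [\<nu>, A *v \<nu>];
                   B = mat_of_rows_list 2 [[0, 4], [1, 0]]
               in pure_basis adj x W2a vs \<and> represents B A vs \<and>
                  {\<theta>. eigenvalue B \<theta>} = {2, - 2}))) \<and>
          (\<forall>(W, cs) \<in> {(W2b, [2, - 2, - 1, 1, - 1, 1]), (W2c, [0, 0, 1, - 1, - 1, 1])}.
             endpoint adj x W = 2 \<and> module_multiplicity T W = 2 \<and> vec.dim W = 2 \<and>
             module_diameter adj x W = 1 \<and> module_shape adj x W = [1, 1] \<and>
             (\<exists>\<nu>. seed_vector adj x W ys cs \<nu> \<and>
                A *v \<nu> = Estar adj x 3 *v (A *v \<nu>) \<and>
                (let vs = [\<nu>, A *v \<nu>];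
                     B = mat_of_rows_list 2 [[0, 1], [1, 0]]
                 in pure_basis adj x W vs \<and> represents B A vs \<and>
                    {\<theta>. eigenvalue B \<theta>} = {1, - 1}))))) \<and>
     cmat.dim T = 6 ^ 2 + 4 ^ 2 + 2 ^ 2 + 2 ^ 2 \<and>
     (6 ^ 2 + 4 ^ 2 + 2 ^ 2 + 2 ^ 2 :: nat) = 60"
proof -
  interpret desargues adj
    by unfold_locales (rule assms)
  obtain ys0 where ys0: "admissible_order2 adj x ys0"
    using ex_admissible by blast
  obtain u1 u2 u3 ws where lab: "labelling adj ([x, u1, u2, u3] @ ys0 @ ws)"
    using admissible_labelling[OF ys0] by blast
  let ?vs = "[x, u1, u2, u3] @ ys0 @ ws"
  \<comment> \<open>The spectrum and the dimension of \<open>T\<close> involve no orders, so a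
    single labelling with the seeds in label order settles both.\<close>
  interpret seeded_graph adj ?vs 1 "- 1" 0 1 1 "- 2"
    by unfold_locales (use lab in auto)
  have x: "?vs ! 0 = x"
    by simp
  have sphere: "sphere_at adj 1 x = {u1, u2, u3}"
    using sphere_1_labels[OF lab] by (simp add: numeral_eq_Suc)
  have "distinct [u1, u2, u3]"
    using labels(2) by auto
  then have "length [u1, u2, u3] = 3 \<and> ordering_of [u1, u2, u3] (sphere_at adj 1 x)"
    unfolding sphere ordering_of_def by simp
  then have ex: "\<exists>zs. length zs = 3 \<and> ordering_of zs (sphere_at adj 1 x)"
    by blast
  have dec: "desargues_decomposition adj x zs ys"
    if zs: "length zs = 3" "ordering_of zs (sphere_at adj 1 x)" and ys: "admissible_order2 adj x ys" for zs ys
  proof -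
    \<comment> \<open>A new labelling is taken for each \<open>ys\<close>; the order
      \<open>zs\<close> is then some permutation of \<open>v1\<close>, \<open>v2\<close>,
      \<open>v3\<close>.\<close>
    obtain v1 v2 v3 ws where lab: "labelling adj ([x, v1, v2, v3] @ ys @ ws)"
      using admissible_labelling[OF ys] by blast
    have "length ys = 6"
      using ys by (simp add: admissible_order2_def)
    then obtain y1 y2 y3 y4 y5 y6 where "ys = [y1, y2, y3, y4, y5, y6]"
      by (auto simp: length_Suc_conv numeral_eq_Suc)
    then show ?thesis
      using desargues_decomposition_labelled[OF assms(1) lab zs(1)] zs(2) by simp
  qed
  then have all_dec: "\<forall>zs ys. length zs = 3 \<and> ordering_of zs (sphere_at adj 1 x) \<and> admissible_order2 adj x ys \<longrightarrow>
      desargues_decomposition adj x zs ys"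
    by blast
  have dim: "cmat.dim (terwilliger adj x) = 6 ^ 2 + 4 ^ 2 + 2 ^ 2 + 2 ^ 2"
    using dim_terwilliger unfolding x by simp
  show ?thesis
    unfolding A_def T_def
    by (rule conjI[OF spectrum conjI[OF ex conjI[OF ex_admissible
        conjI[OF all_dec[unfolded desargues_decomposition_def] conjI[OF dim]]]]]) simp
qed

end
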